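(* Let $d,m$ be integers with either $d=2$ and $m\ge2$, or $d\ge3$ and $m\ge1$. Let $\omega\in\Omega_{d,m}$, let $G=G_\omega$ be the corresponding spinal group with spinal generating set $S$, and let $\operatorname{Sch}:X^{\mathbb{N}}\to\mathcal{G}_{*,S}$, $\operatorname{Sch}(\xi)=(\Gamma_\xi,\xi)$. Then: (1) The map $\operatorname{Sch}$ is injective. It is continuous at every point of $X^{\mathbb{N}}$ except at the points of $\operatorname{Cof}((d-1)^{\mathbb{N}})$. (2) If $d>2$, the set $\overline{\operatorname{Sch}(X^{\mathbb{N}})}$ has no isolated points. If $d=2$, its set of isolated points is $\operatorname{Sch}(\operatorname{Cof}((d-1)^{\mathbb{N}}))$. (3) The set $\overline{\operatorname{Sch}(X^{\mathbb{N}})}$ is the disjoint union of $\operatorname{Sch}(X^{\mathbb{N}})$ and countably many points, which are obtained from finitely many $d$-ended graphs by choosing the root arbitrarily. These graphs are $\tilde\Gamma_\pi=\operatorname{Star}(\Lambda_\pi,\Gamma_{(d-1)^{\mathbb{N}}},(d-1)^{\mathbb{N}})$, for every $\pi\in\operatorname{Epi}(B,A)$ occurring infinitely often in the sequence $\omega$.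
   Context: Let $X=\{0,\dots,d-1\}$ with addition modulo $d$. $T_d$ is the $d$-ary rooted tree with vertex set $X^*$; its boundary is $X^{\mathbb{N}}$ (infinite words, product topology), on which automorphisms of $T_d$ act via prefixes. Let $a(v_0v_1\dots)=(v_0+1)v_1\dots$ and $A=\langle a\rangle\cong\mathbb{Z}/d\mathbb{Z}$. Let $B=(\mathbb{Z}/d\mathbb{Z})^m$ and let $\operatorname{Epi}(B,A)$ be the set of surjective homomorphisms $B\to A$. $\Omega_{d,m}$ is the set of sequences $\omega=(\omega_n)_{n\ge0}$ in $\operatorname{Epi}(B,A)$ with $\bigcap_{j\ge i}\operatorname{Ker}(\omega_j)=1$ for all $i\ge0$. For $b\in B$, $b_\omega\in\operatorname{Aut}(T_d)$ sends a word of the form $(d-1)^r0v_{r+1}v_{r+2}\dots$ ($r\ge0$) to $(d-1)^r0\,\omega_r(b)(v_{r+1})\,v_{r+2}\dots$ and fixes all other words. The map $b\mapsto b_\omega$ is an injective homomorphism, and $B$ is identified with its image $B_\omega$. The spinal group is $G_\omega=\langle A,B_\omega\rangle$ and its spinal generating set is $S=(A\cup B_\omega)\setminus\{1\}$. The Schreier graph $\Gamma_\xi$ of $\xi\in X^{\mathbb{N}}$ has as vertex set the orbit $G\cdot\xi$ and a directed edge labeled $s$ from $y$ to $s(y)$ for all $y\in G\cdot\xi$, $s\in S$. $\mathcal{G}_{*,S}$ is the space of (isomorphism classes of) rooted, connected, directed graphs with edges labeled by $S$, with the pointed Gromov–Hausdorff topology: basic open sets are the sets of all rooted graphs having a given $r$-ball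 around the root, up to isomorphism of rooted directed labeled graphs, for $r\ge0$. $(\Gamma,v)$ denotes $\Gamma$ rooted at $v$. Closures are taken in $\mathcal{G}_{*,S}$. $\operatorname{Cof}(\xi)$ is the set of infinite words differing from $\xi$ in finitely many letters; $(d-1)^{\mathbb{N}}$ is the constant word. For $\pi\in\operatorname{Epi}(B,A)$, $\Lambda_\pi$ is the graph with vertices $0,\dots,d-1$ and, for every $b\in B\setminus\{1\}$ and every vertex $i$, an edge labeled $b$ from $i$ to $i+j$ (mod $d$), where $\pi(b)=a^j$. For a graph $\Gamma$ with a vertex $v$, $\operatorname{Star}(\Lambda_\pi,\Gamma,v)$ is obtained as follows: let $\tilde\Gamma$ be $\Gamma$ with all loops at $v$ removed, take $d$ disjoint copies $\tilde\Gamma_i$ ($i\in X$) of $\tilde\Gamma$ together with $\Lambda_\pi$, and identify, for each $i\in X$, the vertex $i$ of $\Lambda_\pi$ with the vertex of $\tilde\Gamma_i$ corresponding to $v$; no edges are identified, and edges keep their labels. A graph is $k$-ended if it has exactly $k$ ends in the usual sense, i.e. $k$ is the supremum over finite vertex sets $F$ of the number of infinite connected components of the complement of $F$. *)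

theory Defs
  imports
    "HOL-Analysis.Analysis"
    "HOL-Algebra.Bij"
    "HOL-Algebra.Generated_Groups"
    "HOL-Algebra.Product_Groups"
    "HOL-Algebra.Elementary_Groups"
begin

section \<open>The tree, its boundary and its automorphisms\<close>

definition words :: "nat \<Rightarrow> nat list set" where
  "words d = lists {..<d}"

definition is_child :: "nat list \<Rightarrow> nat list \<Rightarrow> bool" where
  "is_child u w \<longleftrightarrow> (\<exists>x. w = u @ [x])"

definition Aut_tree :: "nat \<Rightarrow> (nat list \<Rightarrow> nat list) monoid" where
  "Aut_tree d = (BijGroup (words d)) \<lparr>carrier :=
     {g \<in> Bij (words d). g [] = [] \<and>
        (\<forall>u\<in>words d. \<forall>w\<in>words d. is_child (g u) (g w) \<longleftrightarrow> is_child u w)}\<rparr>"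

definition boundary :: "nat \<Rightarrow> (nat \<Rightarrow> nat) set" where
  "boundary d = {\<xi>. \<forall>n. \<xi> n < d}"

definition boundary_topology :: "nat \<Rightarrow> (nat \<Rightarrow> nat) topology" where
  "boundary_topology d = product_topology (\<lambda>_. discrete_topology {..<d}) UNIV"

lemma topspace_boundary_topology [simp]: "topspace (boundary_topology d) = boundary d"
  by (auto simp: boundary_topology_def boundary_def)

text \<open>The letter of index \<open>n\<close> of \<open>g \<cdot> \<xi>\<close> is read off the image of the prefix of length \<open>n + 1\<close>.\<close>
definition boundary_act :: "(nat list \<Rightarrow> nat list) \<Rightarrow> (nat \<Rightarrow> nat) \<Rightarrow> nat \<Rightarrow> nat" where
  "boundary_act g \<xi> = (\<lambda>n. g (map \<xi> [0..<Suc n]) ! n)"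

definition Cof :: "nat \<Rightarrow> (nat \<Rightarrow> nat) \<Rightarrow> (nat \<Rightarrow> nat) set" where
  "Cof d \<xi> = {\<eta> \<in> boundary d. finite {n. \<eta> n \<noteq> \<xi> n}}"

definition last_ray :: "nat \<Rightarrow> nat \<Rightarrow> nat" where
  "last_ray d = (\<lambda>_. d - 1)"


section \<open>Spinal groups\<close>

definition rot :: "nat \<Rightarrow> nat list \<Rightarrow> nat list" where
  "rot d = (\<lambda>w\<in>words d. case w of [] \<Rightarrow> [] | v # u \<Rightarrow> ((v + 1) mod d) # u)"

definition Agrp :: "nat \<Rightarrow> (nat list \<Rightarrow> nat list) monoid" where
  "Agrp d = (Aut_tree d) \<lparr>carrier := generate (Aut_tree d) {rot d}\<rparr>"

definition Bgrp :: "nat \<Rightarrow> nat \<Rightarrow> (nat \<Rightarrow> int) monoid" where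
  "Bgrp d m = product_group {..<m} (\<lambda>_. integer_mod_group d)"

text \<open>Extensionality makes equality of elements of \<open>Epi d m\<close> agree with equality of maps on
  the carrier of \<open>Bgrp d m\<close>.\<close>
definition Epi :: "nat \<Rightarrow> nat \<Rightarrow> ((nat \<Rightarrow> int) \<Rightarrow> nat list \<Rightarrow> nat list) set" where
  "Epi d m = epi (Bgrp d m) (Agrp d) \<inter> extensional (carrier (Bgrp d m))"

definition Omega :: "nat \<Rightarrow> nat \<Rightarrow> (nat \<Rightarrow> (nat \<Rightarrow> int) \<Rightarrow> nat list \<Rightarrow> nat list) set" where
  "Omega d m = {\<omega>. (\<forall>n. \<omega> n \<in> Epi d m) \<and>
     (\<forall>i. (\<Inter>j\<in>{i..}. kernel (Bgrp d m) (Agrp d) (\<omega> j)) = {\<one>\<^bsub>Bgrp d m\<^esub>})}"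

text \<open>\<open>r\<close> is the length of the longest prefix consisting of letters \<open>d - 1\<close>; a word of the form
  \<open>(d - 1)\<^sup>r 0 u\<close> is sent to \<open>(d - 1)\<^sup>r 0 \<omega>\<^sub>r(b)(u)\<close>, and all other words are fixed.\<close>
definition spin :: "nat \<Rightarrow> (nat \<Rightarrow> (nat \<Rightarrow> int) \<Rightarrow> nat list \<Rightarrow> nat list) \<Rightarrow> (nat \<Rightarrow> int)
    \<Rightarrow> nat list \<Rightarrow> nat list" where
  "spin d \<omega> b = (\<lambda>w\<in>words d.
     let r = length (takeWhile (\<lambda>v. v = d - 1) w)
     in if r < length w \<and> w ! r = 0
        then take (Suc r) w @ \<omega> r b (drop (Suc r) w)
        else w)"

definition spinal_gens :: "nat \<Rightarrow> nat \<Rightarrow> (nat \<Rightarrow> (nat \<Rightarrow> int) \<Rightarrow> nat list \<Rightarrow> nat list)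
    \<Rightarrow> (nat list \<Rightarrow> nat list) set" where
  "spinal_gens d m \<omega> =
     (carrier (Agrp d) \<union> spin d \<omega> ` carrier (Bgrp d m)) - {\<one>\<^bsub>Aut_tree d\<^esub>}"

definition spinal_group :: "nat \<Rightarrow> nat \<Rightarrow> (nat \<Rightarrow> (nat \<Rightarrow> int) \<Rightarrow> nat list \<Rightarrow> nat list)
    \<Rightarrow> (nat list \<Rightarrow> nat list) set" where
  "spinal_group d m \<omega> =
     generate (Aut_tree d) (carrier (Agrp d) \<union> spin d \<omega> ` carrier (Bgrp d m))"


section \<open>Rooted directed graphs with labelled edges\<close>

text \<open>An edge is a triple (source, label, target).  Loops, and parallel edges with distinct labels,
  are allowed.\<close>
record ('v, 'l) lgraph =
  gverts :: "'v set"
  gedges :: "('v \<times> 'l \<times> 'v) set"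

definition adj :: "('v, 'l) lgraph \<Rightarrow> ('v \<times> 'v) set" where
  "adj \<Gamma> = {(u, w). \<exists>s. (u, s, w) \<in> gedges \<Gamma> \<or> (w, s, u) \<in> gedges \<Gamma>}"

definition connected_lgraph :: "('v, 'l) lgraph \<Rightarrow> bool" where
  "connected_lgraph \<Gamma> \<longleftrightarrow> (\<forall>u\<in>gverts \<Gamma>. \<forall>w\<in>gverts \<Gamma>. (u, w) \<in> (adj \<Gamma>)\<^sup>*)"

definition induced :: "('v, 'l) lgraph \<Rightarrow> 'v set \<Rightarrow> ('v, 'l) lgraph" where
  "induced \<Gamma> W = \<lparr>gverts = gverts \<Gamma> \<inter> W, gedges = gedges \<Gamma> \<inter> (W \<times> UNIV \<times> W)\<rparr>"

type_synonym ('v, 'l) rgraph = "('v, 'l) lgraph \<times> 'v"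

definition riso :: "('v, 'l) rgraph \<Rightarrow> ('w, 'l) rgraph \<Rightarrow> bool" where
  "riso X Y \<longleftrightarrow> (\<exists>\<phi>. bij_betw \<phi> (gverts (fst X)) (gverts (fst Y)) \<and> \<phi> (snd X) = snd Y \<and>
     (\<forall>u\<in>gverts (fst X). \<forall>w\<in>gverts (fst X). \<forall>s.
        (u, s, w) \<in> gedges (fst X) \<longleftrightarrow> (\<phi> u, s, \<phi> w) \<in> gedges (fst Y)))"

text \<open>Distances ignore the orientation of edges.\<close>
definition rball :: "nat \<Rightarrow> ('v, 'l) rgraph \<Rightarrow> ('v, 'l) rgraph" where
  "rball r X = (induced (fst X) {u. \<exists>k\<le>r. (snd X, u) \<in> adj (fst X) ^^ k}, snd X)"

text \<open>Rooted connected graphs with labels in \<open>S\<close>.  Locally finite connected graphs are countable,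
  so a vertex set inside \<open>nat\<close> represents all of their isomorphism classes.\<close>
definition rooted_graphs :: "'l set \<Rightarrow> (nat, 'l) rgraph set" where
  "rooted_graphs S = {(\<Gamma>, v). gedges \<Gamma> \<subseteq> gverts \<Gamma> \<times> S \<times> gverts \<Gamma> \<and>
     connected_lgraph \<Gamma> \<and> v \<in> gverts \<Gamma>}"

text \<open>The isomorphism class of a rooted graph over an arbitrary vertex type, represented by its
  isomorphic copies with vertices in \<open>nat\<close>; it is nonempty whenever the given graph is countable,
  connected, and has its edge labels in \<open>S\<close>.\<close>
definition iso_class :: "'l set \<Rightarrow> ('v, 'l) rgraph \<Rightarrow> (nat, 'l) rgraph set" where
  "iso_class S X = {Y \<in> rooted_graphs S. riso X Y}"

definition graph_space :: "'l set \<Rightarrow> (nat, 'l) rgraph set set" where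
  "graph_space S = iso_class S ` rooted_graphs S"

definition ball_cylinder :: "'l set \<Rightarrow> nat \<Rightarrow> (nat, 'l) rgraph \<Rightarrow> (nat, 'l) rgraph set set" where
  "ball_cylinder S r X = {C \<in> graph_space S. \<exists>Y\<in>C. riso (rball r X) (rball r Y)}"

definition graph_topology :: "'l set \<Rightarrow> (nat, 'l) rgraph set topology" where
  "graph_topology S =
     topology_generated_by {ball_cylinder S r X | r X. X \<in> rooted_graphs S}"

definition isolated_points :: "'a topology \<Rightarrow> 'a set \<Rightarrow> 'a set" where
  "isolated_points T C = {x \<in> C. \<exists>U. openin T U \<and> U \<inter> C = {x}}"

definition components_off :: "('v, 'l) lgraph \<Rightarrow> 'v set \<Rightarrow> 'v set set" where
  "components_off \<Gamma> F =
     {{w. (u, w) \<in> (adj (induced \<Gamma> (- F)))\<^sup>*} | u. u \<in> gverts \<Gamma> - F}"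

definition num_ends :: "('v, 'l) lgraph \<Rightarrow> enat" where
  "num_ends \<Gamma> = (SUP F\<in>{F. finite F \<and> F \<subseteq> gverts \<Gamma>}.
     let K = {C \<in> components_off \<Gamma> F. infinite C} in if finite K then enat (card K) else \<infinity>)"


section \<open>Schreier graphs and the limit graphs\<close>

definition Schreier :: "nat \<Rightarrow> nat \<Rightarrow> (nat \<Rightarrow> (nat \<Rightarrow> int) \<Rightarrow> nat list \<Rightarrow> nat list)
    \<Rightarrow> (nat \<Rightarrow> nat) \<Rightarrow> (nat \<Rightarrow> nat, nat list \<Rightarrow> nat list) lgraph" where
  "Schreier d m \<omega> \<xi> = (let orb = (\<lambda>g. boundary_act g \<xi>) ` spinal_group d m \<omega> in
     \<lparr>gverts = orb,
      gedges = {(y, s, boundary_act s y) | y s. y \<in> orb \<and> s \<in> spinal_gens d m \<omega>}\<rparr>)"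

definition Sch :: "nat \<Rightarrow> nat \<Rightarrow> (nat \<Rightarrow> (nat \<Rightarrow> int) \<Rightarrow> nat list \<Rightarrow> nat list)
    \<Rightarrow> (nat \<Rightarrow> nat) \<Rightarrow> (nat, nat list \<Rightarrow> nat list) rgraph set" where
  "Sch d m \<omega> \<xi> = iso_class (spinal_gens d m \<omega>) (Schreier d m \<omega> \<xi>, \<xi>)"

text \<open>The sequence \<open>\<omega>\<close> enters only through the identification of \<open>b\<close> with its image \<open>spin d \<omega> b\<close>,
  so that the labels lie in \<open>spinal_gens d m \<omega>\<close>.\<close>
definition Lambda :: "nat \<Rightarrow> nat \<Rightarrow> (nat \<Rightarrow> (nat \<Rightarrow> int) \<Rightarrow> nat list \<Rightarrow> nat list)
    \<Rightarrow> ((nat \<Rightarrow> int) \<Rightarrow> nat list \<Rightarrow> nat list) \<Rightarrow> (nat, nat list \<Rightarrow> nat list) lgraph" where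
  "Lambda d m \<omega> \<pi> =
     \<lparr>gverts = {..<d},
      gedges = {(i, spin d \<omega> b, (i + j) mod d) | i b j.
        i < d \<and> b \<in> carrier (Bgrp d m) - {\<one>\<^bsub>Bgrp d m\<^esub>} \<and> \<pi> b = rot d [^]\<^bsub>Aut_tree d\<^esub> (j::nat)}\<rparr>"

definition remove_loops :: "('v, 'l) lgraph \<Rightarrow> 'v \<Rightarrow> ('v, 'l) lgraph" where
  "remove_loops \<Gamma> v = \<lparr>gverts = gverts \<Gamma>, gedges = gedges \<Gamma> - {(v, s, v) | s. True}\<rparr>"

text \<open>The pair \<open>(i, u)\<close> is the vertex \<open>u\<close> of the \<open>i\<close>-th copy, and the vertex \<open>i\<close> of \<open>\<Lambda>\<close> is
  represented by \<open>(i, v)\<close>.  As the copies have no loops at \<open>v\<close>, no edge of a copy has the same two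
  end vertices as an edge of \<open>\<Lambda>\<close>, so the union of the edge sets is disjoint.\<close>
definition Star :: "('i, 'l) lgraph \<Rightarrow> ('v, 'l) lgraph \<Rightarrow> 'v \<Rightarrow> ('i \<times> 'v, 'l) lgraph" where
  "Star \<Lambda> \<Gamma> v =
     \<lparr>gverts = gverts \<Lambda> \<times> gverts \<Gamma>,
      gedges =
        {((i, u), s, (i, w)) | i u s w. i \<in> gverts \<Lambda> \<and> (u, s, w) \<in> gedges (remove_loops \<Gamma> v)}
        \<union> {((i, v), s, (j, v)) | i s j. (i, s, j) \<in> gedges \<Lambda>}\<rparr>"

definition limit_graph :: "nat \<Rightarrow> nat \<Rightarrow> (nat \<Rightarrow> (nat \<Rightarrow> int) \<Rightarrow> nat list \<Rightarrow> nat list)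
    \<Rightarrow> ((nat \<Rightarrow> int) \<Rightarrow> nat list \<Rightarrow> nat list)
    \<Rightarrow> (nat \<times> (nat \<Rightarrow> nat), nat list \<Rightarrow> nat list) lgraph" where
  "limit_graph d m \<omega> \<pi> =
     Star (Lambda d m \<omega> \<pi>) (Schreier d m \<omega> (last_ray d)) (last_ray d)"

definition recurrent_epis :: "nat \<Rightarrow> nat \<Rightarrow> (nat \<Rightarrow> (nat \<Rightarrow> int) \<Rightarrow> nat list \<Rightarrow> nat list)
    \<Rightarrow> ((nat \<Rightarrow> int) \<Rightarrow> nat list \<Rightarrow> nat list) set" where
  "recurrent_epis d m \<omega> = {\<pi> \<in> Epi d m. infinite {n. \<omega> n = \<pi>}}"

definition limit_points :: "nat \<Rightarrow> nat \<Rightarrow> (nat \<Rightarrow> (nat \<Rightarrow> int) \<Rightarrow> nat list \<Rightarrow> nat list)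
    \<Rightarrow> (nat, nat list \<Rightarrow> nat list) rgraph set set" where
  "limit_points d m \<omega> =
     {iso_class (spinal_gens d m \<omega>) (limit_graph d m \<omega> \<pi>, x) | \<pi> x.
        \<pi> \<in> recurrent_epis d m \<omega> \<and> x \<in> gverts (limit_graph d m \<omega> \<pi>)}"

definition Sch_closure :: "nat \<Rightarrow> nat \<Rightarrow> (nat \<Rightarrow> (nat \<Rightarrow> int) \<Rightarrow> nat list \<Rightarrow> nat list)
    \<Rightarrow> (nat, nat list \<Rightarrow> nat list) rgraph set set" where
  "Sch_closure d m \<omega> =
     graph_topology (spinal_gens d m \<omega>) closure_of (Sch d m \<omega> ` boundary d)"

end

(* A point of the closure is determined by its code: the set of generator words that label a closed
   path at the root.  The labels act by permutations and are closed under inversion, so balls of two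
   such graphs are isomorphic when the codes agree up to a certain length, and the topology becomes
   pointwise convergence of codes.

   A ray (d-1)^k x ... with x different from d-1 sees only finitely many letters when a generator
   acts, hence the code is locally constant at every ray that is not cofinal with (d-1)^N.  A ray that
   agrees with u in Cof((d-1)^N) up to a far letter n, where it is not d-1, imitates u itself if this
   letter is not 0; if it is 0, then near the root the copy of (d-1)^N can only be left by rotating
   letter n+1 through omega_n, which is precisely the star of d copies over Lambda_(omega_n).
   Compactness of the boundary and pigeonhole on omega_n give the closure.

   Different rays are separated by a word whose effect depends on finitely many letters, so
   the separation passes to limits: this gives injectivity and the disjointness from the limit
   graphs. *)
theory Submission
  imports Defs
begin

section \<open>Rooted isomorphisms and balls\<close>

text \<open>Two rays are told apart by an element of B that moves one of them and fixes the other.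
  At the first letter \<open>n\<close> where they differ, the difference of the two letters modulo d
  is invariant under all words, since what a generator adds to letter \<open>n\<close> depends on
  the earlier letters only. For d > 2 one ray is brought to (d-1)^n 0..., and, after exchanging the
  rays if the difference is -1, the other one to (d-1)^n x... with x neither 0 nor d-1, where all of
  B acts trivially. For d = 2 there is no such x; a nontrivial element of the kernel of omega_n
  replaces it, and this is where m >= 2 enters. The same x decides about isolated points. Placed far
  out, it produces graphs converging to that of a given point of Cof((d-1)^N). For d = 2 the ray
  (d-1)^N is the only one fixed by all of B, and a finite ball can see this. A limit in the space of
  graphs is a priori an arbitrary labelled graph. It is again given by permutations because a ball
  reaching one step beyond a vertex shows all edges at that vertex.\<close>

definition riso_by :: "('v \<Rightarrow> 'w) \<Rightarrow> ('v, 'l) rgraph \<Rightarrow> ('w, 'l) rgraph \<Rightarrow> bool" where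
  "riso_by \<phi> X Y \<longleftrightarrow> bij_betw \<phi> (gverts (fst X)) (gverts (fst Y)) \<and> \<phi> (snd X) = snd Y \<and>
     (\<forall>u\<in>gverts (fst X). \<forall>w\<in>gverts (fst X). \<forall>s.
        (u, s, w) \<in> gedges (fst X) \<longleftrightarrow> (\<phi> u, s, \<phi> w) \<in> gedges (fst Y))"

lemma riso_iff: "riso X Y \<longleftrightarrow> (\<exists>\<phi>. riso_by \<phi> X Y)"
  by (simp add: riso_def riso_by_def)

text \<open>\<open>riso\<close> and \<open>adj\<close> do not check that edges end in vertices.
  Without this condition a path from the root could leave the vertex set, where an isomorphism says
  nothing.\<close>

definition wf_rgraph :: "('v, 'l) rgraph \<Rightarrow> bool" where
  "wf_rgraph X \<longleftrightarrow> gedges (fst X) \<subseteq> gverts (fst X) \<times> UNIV \<times> gverts (fst X)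
     \<and> snd X \<in> gverts (fst X)"

lemma rooted_graphs_wf: "X \<in> rooted_graphs S \<Longrightarrow> wf_rgraph X"
  by (auto simp: rooted_graphs_def wf_rgraph_def)

lemma riso_refl: "riso X X"
  unfolding riso_def by (rule exI[of _ id]) auto

lemma riso_by_inv:
  assumes "riso_by \<phi> X Y" "snd X \<in> gverts (fst X)"
  shows "riso_by (inv_into (gverts (fst X)) \<phi>) Y X"
proof -
  let ?f = "inv_into (gverts (fst X)) \<phi>"
  have b: "bij_betw \<phi> (gverts (fst X)) (gverts (fst Y))" using assms by (simp add: riso_by_def)
  have inv: "\<phi> (?f u) = u" "?f u \<in> gverts (fst X)" if "u \<in> gverts (fst Y)" for u
    using that b by (auto simp: bij_betw_def f_inv_into_f inv_into_into)
  have "?f (snd Y) = snd X"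
    using assms b by (metis bij_betw_inv_into_left riso_by_def)
  then show ?thesis
    using assms b inv unfolding riso_by_def
    by (auto simp: bij_betw_inv_into)
qed

text \<open>The root has to be a vertex: \<open>inv_into\<close> undoes the isomorphism on vertices
  only, so it might otherwise miss the old root.\<close>

lemma riso_sym: "riso X Y \<Longrightarrow> snd X \<in> gverts (fst X) \<Longrightarrow> riso Y X"
  using riso_by_inv by (metis riso_iff)

lemma riso_trans: "riso X Y \<Longrightarrow> riso Y Z \<Longrightarrow> riso X Z"
proof -
  assume "riso X Y" "riso Y Z"
  then obtain f g where f: "riso_by f X Y" and g: "riso_by g Y Z" by (auto simp: riso_iff)
  have "f u \<in> gverts (fst Y)" if "u \<in> gverts (fst X)" for u
    using f that by (auto simp: riso_by_def bij_betw_def)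
  then have "riso_by (g \<circ> f) X Z"
    using f g unfolding riso_by_def by (auto intro: bij_betw_trans)
  then show ?thesis by (auto simp: riso_iff)
qed

lemma adj_verts: "wf_rgraph X \<Longrightarrow> (snd X, u) \<in> adj (fst X) ^^ k \<Longrightarrow> u \<in> gverts (fst X)"
  by (cases k) (auto simp: wf_rgraph_def adj_def)

lemma rball_verts: "gverts (fst (rball r X)) = gverts (fst X) \<inter> {u. \<exists>k\<le>r. (snd X, u) \<in> adj (fst X) ^^ k}"
  and rball_root [simp]: "snd (rball r X) = snd X"
  and rball_edges: "gedges (fst (rball r X)) = gedges (fst X) \<inter>
    ({u. \<exists>k\<le>r. (snd X, u) \<in> adj (fst X) ^^ k} \<times> UNIV \<times> {u. \<exists>k\<le>r. (snd X, u) \<in> adj (fst X) ^^ k})"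
  by (auto simp: rball_def induced_def)

lemma riso_by_rball_edge:
  assumes "riso_by \<phi> (rball R X) (rball R Y)" "u \<in> gverts (fst (rball R X))" "w \<in> gverts (fst (rball R X))"
  shows "(u, s, w) \<in> gedges (fst X) \<longleftrightarrow> (\<phi> u, s, \<phi> w) \<in> gedges (fst Y)"
proof -
  have "\<phi> u \<in> gverts (fst (rball R Y))" "\<phi> w \<in> gverts (fst (rball R Y))"
    using assms by (auto simp: riso_by_def bij_betw_def)
  moreover have "(u, s, w) \<in> gedges (fst (rball R X)) \<longleftrightarrow> (\<phi> u, s, \<phi> w) \<in> gedges (fst (rball R Y))"
    using assms unfolding riso_by_def by blast
  ultimately show ?thesis
    using assms(2,3) by (auto simp: rball_edges rball_verts)
qed

text \<open>Edges are transported in one direction only, on a set \<open>W\<close> containing all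
  short paths. With \<open>W\<close> a ball or the whole vertex set, one induction serves both
  uses.\<close>

lemma riso_by_path:
  assumes wf: "wf_rgraph X" and e: "\<And>u w s. u \<in> W \<Longrightarrow> w \<in> W \<Longrightarrow>
      (u, s, w) \<in> gedges (fst X) \<Longrightarrow> (\<phi> u, s, \<phi> w) \<in> gedges (fst Y)"
    and W: "\<And>u k. k \<le> R \<Longrightarrow> (snd X, u) \<in> adj (fst X) ^^ k \<Longrightarrow> u \<in> W"
    and r: "\<phi> (snd X) = snd Y"
  shows "k \<le> R \<Longrightarrow> (snd X, u) \<in> adj (fst X) ^^ k \<Longrightarrow> (snd Y, \<phi> u) \<in> adj (fst Y) ^^ k"
proof (induction k arbitrary: u)
  case (Suc k)
  then obtain y where y: "(snd X, y) \<in> adj (fst X) ^^ k" "(y, u) \<in> adj (fst X)" by auto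
  have "y \<in> W" "u \<in> W" using W[of k y] W[of "Suc k" u] y Suc.prems by auto
  then have "(\<phi> y, \<phi> u) \<in> adj (fst Y)" using y e by (fastforce simp: adj_def)
  then show ?case using Suc y by auto
qed (use r in auto)

lemma riso_by_rball_path:
  assumes "wf_rgraph X" "riso_by \<phi> (rball R X) (rball R Y)"
    and "k \<le> R" "(snd X, u) \<in> adj (fst X) ^^ k"
  shows "(snd Y, \<phi> u) \<in> adj (fst Y) ^^ k"
  using assms(1) _ _ _ assms(3,4)
proof (rule riso_by_path[where W = "gverts (fst (rball R X))"])
  show "\<phi> (snd X) = snd Y" using assms(2) by (simp add: riso_by_def)
  show "u \<in> gverts (fst (rball R X))" if "k \<le> R" "(snd X, u) \<in> adj (fst X) ^^ k" for u k
    using that adj_verts[OF assms(1)] by (auto simp: rball_verts)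
qed (use riso_by_rball_edge[OF assms(2)] in blast)

lemma riso_rball:
  assumes "riso X Y" "wf_rgraph X" "wf_rgraph Y"
  shows "riso (rball r X) (rball r Y)"
proof -
  obtain \<phi> where p: "riso_by \<phi> X Y" using assms by (auto simp: riso_iff)
  define \<psi> where "\<psi> = inv_into (gverts (fst X)) \<phi>"
  have q: "riso_by \<psi> Y X" using riso_by_inv[OF p] assms(2) by (simp add: \<psi>_def wf_rgraph_def)
  have P: "(snd Y, \<phi> u) \<in> adj (fst Y) ^^ k" if "(snd X, u) \<in> adj (fst X) ^^ k" for u k
  proof (rule riso_by_path[of X "gverts (fst X)" \<phi> Y k k u])
    show "wf_rgraph X" by fact
    show "(\<phi> u, s, \<phi> w) \<in> gedges (fst Y)" if "(u, s, w) \<in> gedges (fst X)"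
       "u \<in> gverts (fst X)" "w \<in> gverts (fst X)" for u s w
      using p that by (auto simp: riso_by_def)
  qed (use that p adj_verts[OF assms(2)] in \<open>auto simp: riso_by_def\<close>)
  have Q: "(snd X, \<psi> u) \<in> adj (fst X) ^^ k" if "(snd Y, u) \<in> adj (fst Y) ^^ k" for u k
  proof (rule riso_by_path[of Y "gverts (fst Y)" \<psi> X k k u])
    show "wf_rgraph Y" by fact
    show "(\<psi> u, s, \<psi> w) \<in> gedges (fst X)" if "(u, s, w) \<in> gedges (fst Y)"
       "u \<in> gverts (fst Y)" "w \<in> gverts (fst Y)" for u s w
      using q that by (auto simp: riso_by_def)
  qed (use that q adj_verts[OF assms(3)] in \<open>auto simp: riso_by_def\<close>)
  have bX: "bij_betw \<phi> (gverts (fst X)) (gverts (fst Y))" using p by (simp add: riso_by_def)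
  have inv: "\<phi> (\<psi> u) = u" "\<psi> u \<in> gverts (fst X)" if "u \<in> gverts (fst Y)" for u
    using that bX by (auto simp: \<psi>_def bij_betw_def f_inv_into_f inv_into_into)
  have "bij_betw \<phi> (gverts (fst (rball r X))) (gverts (fst (rball r Y)))"
    unfolding bij_betw_def
  proof
    show "inj_on \<phi> (gverts (fst (rball r X)))"
      using bX by (auto simp: bij_betw_def rball_verts intro: inj_on_subset)
    show "\<phi> ` gverts (fst (rball r X)) = gverts (fst (rball r Y))"
    proof (intro equalityI subsetI)
      fix y assume "y \<in> \<phi> ` gverts (fst (rball r X))"
      then show "y \<in> gverts (fst (rball r Y))" using P bX by (auto simp: rball_verts bij_betw_def)
    next
      fix y assume "y \<in> gverts (fst (rball r Y))"
      then have "\<psi> y \<in> gverts (fst (rball r X))" "\<phi> (\<psi> y) = y" using Q inv by (auto simp: rball_verts)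
      then show "y \<in> \<phi> ` gverts (fst (rball r X))" by (metis imageI)
    qed
  qed
  moreover have "(u, s, w) \<in> gedges (fst (rball r X)) \<longleftrightarrow> (\<phi> u, s, \<phi> w) \<in> gedges (fst (rball r Y))"
    if "u \<in> gverts (fst (rball r X))" "w \<in> gverts (fst (rball r X))" for u s w
    using that p P by (auto simp: rball_verts rball_edges riso_by_def)
  ultimately show ?thesis using p by (auto simp: riso_iff riso_by_def)
qed

lemma iso_class_eq:
  assumes "riso X Y" "snd X \<in> gverts (fst X)"
  shows "iso_class S X = iso_class S Y"
  using assms riso_sym[OF assms] riso_trans unfolding iso_class_def by (metis (mono_tags, lifting))

lemma iso_class_self: "X \<in> rooted_graphs S \<Longrightarrow> X \<in> iso_class S X"
  by (simp add: iso_class_def riso_refl)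


section \<open>Schreier-type graphs and their codes\<close>

definition action_graph :: "'l set \<Rightarrow> 'v set \<Rightarrow> ('l \<Rightarrow> 'v \<Rightarrow> 'v) \<Rightarrow> ('v, 'l) lgraph" where
  "action_graph S V act = \<lparr>gverts = V, gedges = {(y, s, act s y) | y s. y \<in> V \<and> s \<in> S}\<rparr>"

lemma action_graph_simps [simp]: "gverts (action_graph S V act) = V"
  "(u, s, w) \<in> gedges (action_graph S V act) \<longleftrightarrow> u \<in> V \<and> s \<in> S \<and> w = act s u"
  by (auto simp: action_graph_def)

text \<open>For a Schreier graph these are the words representing elements of the stabilizer of the
  root; \<open>fold\<close> lets the first letter act first.\<close>

definition code :: "'l set \<Rightarrow> ('l \<Rightarrow> 'v \<Rightarrow> 'v) \<Rightarrow> 'v \<Rightarrow> 'l list set" where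
  "code S act v = {ws \<in> lists S. fold act ws v = v}"

locale labels =
  fixes S :: "'l set" and iv :: "'l \<Rightarrow> 'l"
  assumes iv: "s \<in> S \<Longrightarrow> iv s \<in> S"
begin

text \<open>Only the invertibility of each letter is demanded, not the relations of a group, so that
  the limit graphs, which arise by gluing, qualify too.\<close>

definition action :: "'v set \<Rightarrow> ('l \<Rightarrow> 'v \<Rightarrow> 'v) \<Rightarrow> bool" where
  "action V act \<longleftrightarrow> (\<forall>s\<in>S. \<forall>y\<in>V. act s y \<in> V \<and> act (iv s) (act s y) = y \<and> act s (act (iv s) y) = y)"

definition trans_action :: "'v set \<Rightarrow> ('l \<Rightarrow> 'v \<Rightarrow> 'v) \<Rightarrow> 'v \<Rightarrow> bool" where
  "trans_action V act v \<longleftrightarrow> action V act \<and> v \<in> V \<and> (\<forall>y\<in>V. \<exists>ws\<in>lists S. fold act ws v = y)"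

definition ivw :: "'l list \<Rightarrow> 'l list" where
  "ivw ws = rev (map iv ws)"

lemma ivw_lists [simp]: "ws \<in> lists S \<Longrightarrow> ivw ws \<in> lists S"
  using iv by (auto simp: ivw_def)

lemma length_ivw [simp]: "length (ivw ws) = length ws"
  by (simp add: ivw_def)

lemma fold_closed: "action V act \<Longrightarrow> ws \<in> lists S \<Longrightarrow> y \<in> V \<Longrightarrow> fold act ws y \<in> V"
  by (induction ws arbitrary: y) (auto simp: action_def)

lemma fold_ivw_left:
  assumes "action V act"
  shows "ws \<in> lists S \<Longrightarrow> y \<in> V \<Longrightarrow> fold act (ivw ws) (fold act ws y) = y"
proof (induction ws arbitrary: y)
  case (Cons s ws)
  then have "fold act (ivw ws) (fold act ws (act s y)) = act s y"
    using assms by (auto simp: action_def)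
  then show ?case using Cons assms by (auto simp: action_def ivw_def)
qed (simp add: ivw_def)

lemma fold_ivw_right:
  assumes "action V act"
  shows "ws \<in> lists S \<Longrightarrow> y \<in> V \<Longrightarrow> fold act ws (fold act (ivw ws) y) = y"
proof (induction ws arbitrary: y rule: rev_induct)
  case (snoc s ws)
  then have "fold act ws (fold act (ivw ws) (act (iv s) y)) = act (iv s) y"
    using assms iv[of s] by (auto simp: action_def)
  then show ?case using snoc assms by (auto simp: action_def ivw_def)
qed (simp add: ivw_def)

text \<open>Go out along \<open>ws\<close> and return along the reverse of \<open>ws'\<close>. This
  is how closedness of \<open>S\<close> under inversion turns every coincidence of vertices into a
  statement about the code.\<close>

lemma fold_eq_iff_code:
  assumes "action V act" "v \<in> V" "ws \<in> lists S" "ws' \<in> lists S"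
  shows "fold act ws v = fold act ws' v \<longleftrightarrow> ws @ ivw ws' \<in> code S act v"
proof
  assume "fold act ws v = fold act ws' v"
  then show "ws @ ivw ws' \<in> code S act v"
    using assms ivw_lists[of ws'] fold_ivw_left[OF assms(1,4,2)] by (auto simp: code_def)
next
  assume "ws @ ivw ws' \<in> code S act v"
  then have "fold act (ivw ws') (fold act ws v) = v" by (simp add: code_def)
  then show "fold act ws v = fold act ws' v"
    using fold_ivw_right[OF assms(1,4) fold_closed[OF assms(1,3,2)]] by simp
qed

text \<open>Conjugation moves the root: the code at the end of \<open>ws\<close> can be read from
  the code at \<open>v\<close>.\<close>

lemma conj_code_iff:
  assumes "action V act" "v \<in> V" "ws \<in> lists S" "us \<in> lists S"
  shows "ws @ us @ ivw ws \<in> code S act v \<longleftrightarrow> fold act us (fold act ws v) = fold act ws v"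
  using fold_eq_iff_code[OF assms(1,2), of "ws @ us" ws] assms by simp

text \<open>An edge labelled \<open>s\<close> is reversed by one labelled \<open>iv s\<close>, so
  ignoring orientation adds no neighbours and distance is word length.\<close>

lemma adj_action_graph:
  assumes "action V act"
  shows "(u, w) \<in> adj (action_graph S V act) \<longleftrightarrow> u \<in> V \<and> (\<exists>s\<in>S. w = act s u)"
  using assms iv unfolding adj_def by (auto simp: action_def) metis+

lemma adj_pow_action_graph:
  assumes "action V act" "v \<in> V"
  shows "(v, u) \<in> adj (action_graph S V act) ^^ k \<longleftrightarrow> (\<exists>ws\<in>lists S. length ws = k \<and> fold act ws v = u)"
proof (induction k arbitrary: u)
  case (Suc k)
  show ?case
  proof
    assume "(v, u) \<in> adj (action_graph S V act) ^^ Suc k"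
    then obtain y where "(v, y) \<in> adj (action_graph S V act) ^^ k" "(y, u) \<in> adj (action_graph S V act)" by auto
    then obtain ws s where "ws \<in> lists S" "length ws = k" "fold act ws v = y" "s \<in> S" "u = act s y"
      using Suc adj_action_graph[OF assms(1)] by auto
    then show "\<exists>ws\<in>lists S. length ws = Suc k \<and> fold act ws v = u"
      by (intro bexI[of _ "ws @ [s]"]) auto
  next
    assume "\<exists>ws\<in>lists S. length ws = Suc k \<and> fold act ws v = u"
    then obtain ws where ws: "ws \<in> lists S" "length ws = Suc k" "fold act ws v = u" by auto
    then obtain us s where us: "ws = us @ [s]" by (metis length_Suc_conv_rev)
    have "(v, fold act us v) \<in> adj (action_graph S V act) ^^ k" using Suc ws us by auto
    moreover have "(fold act us v, u) \<in> adj (action_graph S V act)"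
      using adj_action_graph[OF assms(1)] ws us fold_closed[OF assms(1) _ assms(2), of us] by auto
    ultimately show "(v, u) \<in> adj (action_graph S V act) ^^ Suc k" by auto
  qed
qed auto

definition words_le :: "nat \<Rightarrow> 'l list set" where
  "words_le r = {ws \<in> lists S. length ws \<le> r}"

lemma rball_action_graph:
  assumes "action V act" "v \<in> V"
  shows "rball r (action_graph S V act, v) = (induced (action_graph S V act) {fold act ws v | ws. ws \<in> words_le r}, v)"
  unfolding rball_def fst_conv snd_conv adj_pow_action_graph[OF assms] words_le_def
  by (rule arg_cong[where f = "\<lambda>W. (induced (action_graph S V act) W, v)"]) blast


text \<open>The isomorphism sends the endpoint of a word to the endpoint of the same word.
  \<open>P\<close> is the set of words up to some length for balls, and all words for whole
  graphs.\<close>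

lemma riso_inducedI:
  assumes a: "action V act" "v \<in> V" and a': "action V' act'" "v' \<in> V'" and P: "P \<subseteq> lists S" "[] \<in> P"
    and eq: "\<And>ws ws'. ws \<in> P \<Longrightarrow> ws' \<in> P \<Longrightarrow>
        fold act ws v = fold act ws' v \<longleftrightarrow> fold act' ws v' = fold act' ws' v'"
    and eqs: "\<And>ws ws' s. ws \<in> P \<Longrightarrow> ws' \<in> P \<Longrightarrow> s \<in> S \<Longrightarrow>
        act s (fold act ws v) = fold act ws' v \<longleftrightarrow> act' s (fold act' ws v') = fold act' ws' v'"
  shows "riso (induced (action_graph S V act) {fold act ws v | ws. ws \<in> P}, v)
              (induced (action_graph S V' act') {fold act' ws v' | ws. ws \<in> P}, v')"
proof -
  let ?W = "{fold act ws v | ws. ws \<in> P}" and ?W' = "{fold act' ws v' | ws. ws \<in> P}"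
  \<comment> \<open>Any word leading to \<open>y\<close> may be chosen; by \<open>eq\<close> the
    image does not depend on it.\<close>
  define \<phi> where "\<phi> y = fold act' (SOME ws. ws \<in> P \<and> fold act ws v = y) v'" for y
  have \<phi>: "\<phi> (fold act ws v) = fold act' ws v'" if "ws \<in> P" for ws
  proof -
    have "(SOME us. us \<in> P \<and> fold act us v = fold act ws v) \<in> P \<and>
        fold act (SOME us. us \<in> P \<and> fold act us v = fold act ws v) v = fold act ws v"
      using someI[of "\<lambda>us. us \<in> P \<and> fold act us v = fold act ws v" ws] that by blast
    then show ?thesis using eq that unfolding \<phi>_def by blast
  qed
  have "?W \<subseteq> V" "?W' \<subseteq> V'" using fold_closed a a' P by fastforce+
  then have V: "V \<inter> ?W = ?W" "V' \<inter> ?W' = ?W'" by auto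
  have "inj_on \<phi> ?W" using eq \<phi> by (auto simp: inj_on_def)
  moreover have "\<phi> ` ?W = ?W'" using \<phi> by (auto simp: image_def)
  ultimately have "bij_betw \<phi> ?W ?W'" by (simp add: bij_betw_def)
  moreover have "\<phi> v = v'" using \<phi>[OF P(2)] by simp
  moreover have "(u, s, w) \<in> gedges (induced (action_graph S V act) ?W) \<longleftrightarrow>
     (\<phi> u, s, \<phi> w) \<in> gedges (induced (action_graph S V' act') ?W')"
    if uw: "u \<in> ?W" "w \<in> ?W" for u s w
  proof -
    obtain ws us where w: "ws \<in> P" "us \<in> P" "u = fold act ws v" "w = fold act us v" using uw by auto
    have "u \<in> V" "\<phi> u \<in> V'" "\<phi> u \<in> ?W'" "\<phi> w \<in> ?W'"
      using w \<open>?W \<subseteq> V\<close> \<open>?W' \<subseteq> V'\<close> \<phi> by auto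
    moreover have "s \<in> S \<Longrightarrow> act s u = w \<longleftrightarrow> act' s (\<phi> u) = \<phi> w" using eqs \<phi> w by auto
    ultimately show ?thesis using uw by (auto simp: induced_def)
  qed
  ultimately show ?thesis
    unfolding riso_def using V by (intro exI[of _ \<phi>]) (simp add: induced_def)
qed

lemma words_le_subset: "words_le r \<subseteq> lists S" by (auto simp: words_le_def)

text \<open>An edge between two vertices of the ball closes up to a word: at most \<open>r\<close>
  letters out, one for the edge, at most \<open>r\<close> back. This gives the length
  \<open>2 * r + 1\<close>.\<close>

lemma riso_rball_of_code:
  assumes a: "action V act" "v \<in> V" and a': "action V' act'" "v' \<in> V'"
    and c: "\<And>ws. ws \<in> words_le (2 * r + 1) \<Longrightarrow> ws \<in> code S act v \<longleftrightarrow> ws \<in> code S act' v'"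
  shows "riso (rball r (action_graph S V act, v)) (rball r (action_graph S V' act', v'))"
  unfolding rball_action_graph[OF a] rball_action_graph[OF a']
proof (rule riso_inducedI[OF a a' words_le_subset])
  fix ws ws' assume w: "ws \<in> words_le r" "ws' \<in> words_le r"
  then have "ws \<in> lists S" "ws' \<in> lists S" by (auto simp: words_le_def)
  moreover have "ws @ ivw ws' \<in> words_le (2 * r + 1)" using w ivw_lists[of ws'] by (auto simp: words_le_def)
  ultimately show "fold act ws v = fold act ws' v \<longleftrightarrow> fold act' ws v' = fold act' ws' v'"
    using c fold_eq_iff_code[OF a] fold_eq_iff_code[OF a'] by blast
  fix s assume s: "s \<in> S"
  have "ws @ [s] \<in> lists S" "ws' \<in> lists S" using w s by (auto simp: words_le_def)
  moreover have "(ws @ [s]) @ ivw ws' \<in> words_le (2 * r + 1)" using s w ivw_lists[of ws'] by (auto simp: words_le_def)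
  ultimately have "fold act (ws @ [s]) v = fold act ws' v \<longleftrightarrow> fold act' (ws @ [s]) v' = fold act' ws' v'"
    using c fold_eq_iff_code[OF a] fold_eq_iff_code[OF a'] by blast
  then show "act s (fold act ws v) = fold act ws' v \<longleftrightarrow> act' s (fold act' ws v') = fold act' ws' v'"
    by simp
qed (auto simp: words_le_def)

lemma induced_all: "trans_action V act v \<Longrightarrow>
  induced (action_graph S V act) {fold act ws v | ws. ws \<in> lists S} = action_graph S V act"
proof -
  assume t: "trans_action V act v"
  have *: "{fold act ws v | ws. ws \<in> lists S} = V"
    using t fold_closed by (fastforce simp: trans_action_def)
  have "gedges (action_graph S V act) \<inter> (V \<times> UNIV \<times> V) = gedges (action_graph S V act)"
    using t by (auto simp: trans_action_def action_def)
  then show ?thesis unfolding * by (simp add: induced_def)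
qed

lemma riso_of_code:
  assumes t: "trans_action V act v" "trans_action V' act' v'" and c: "code S act v = code S act' v'"
  shows "riso (action_graph S V act, v) (action_graph S V' act', v')"
proof -
  have a: "action V act" "v \<in> V" "action V' act'" "v' \<in> V'" using t by (auto simp: trans_action_def)
  have eq: "fold act ws v = fold act ws' v \<longleftrightarrow> fold act' ws v' = fold act' ws' v'"
    if "ws \<in> lists S" "ws' \<in> lists S" for ws ws'
    using that c fold_eq_iff_code[OF a(1,2)] fold_eq_iff_code[OF a(3,4)] by blast
  show ?thesis
    using riso_inducedI[OF a, of "lists S", OF _ _ eq] eq[of "_ @ [_]"] 
    unfolding induced_all[OF t(1)] induced_all[OF t(2)] by simp
qed

text \<open>All initial segments of a word of length at most \<open>r\<close> end inside the ball.
  Each label has a single target at every vertex, so the isomorphism must follow the word, and by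
  injectivity it closes on one side exactly if it does on the other.\<close>

lemma code_of_riso_rball:
  assumes a: "action V act" "v \<in> V" and a': "action V' act'" "v' \<in> V'"
    and i: "riso (rball r (action_graph S V act, v)) (rball r (action_graph S V' act', v'))"
    and ws: "ws \<in> words_le r"
  shows "ws \<in> code S act v \<longleftrightarrow> ws \<in> code S act' v'"
proof -
  let ?X = "(action_graph S V act, v)" and ?Y = "(action_graph S V' act', v')"
  obtain \<phi> where p: "riso_by \<phi> (rball r ?X) (rball r ?Y)" using i by (auto simp: riso_iff)
  have in_ball: "fold act us v \<in> gverts (fst (rball r ?X))" if "us \<in> words_le r" for us
    using that fold_closed[OF a(1) subsetD[OF words_le_subset that] a(2)]
    unfolding rball_action_graph[OF a] by (auto simp: induced_def)
  have root: "\<phi> v = v'" using p by (simp add: riso_by_def)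
  have "us \<in> words_le r \<Longrightarrow> \<phi> (fold act us v) = fold act' us v'" for us
  proof (induction us rule: rev_induct)
    case (snoc s us)
    then have u: "us \<in> words_le r" "s \<in> S" by (auto simp: words_le_def)
    have "fold act us v \<in> V" using fold_closed[OF a(1) subsetD[OF words_le_subset u(1)] a(2)] .
    then have "(fold act us v, s, fold act (us @ [s]) v) \<in> gedges (fst ?X)" using u by simp
    then have "(\<phi> (fold act us v), s, \<phi> (fold act (us @ [s]) v)) \<in> gedges (fst ?Y)"
      using riso_by_rball_edge[OF p in_ball[OF u(1)] in_ball[OF snoc.prems]] by blast
    then show ?case using snoc u by simp
  qed (use root in simp)
  then have "\<phi> (fold act ws v) = fold act' ws v'" using ws by blast
  moreover have "inj_on \<phi> (gverts (fst (rball r ?X)))" using p by (simp add: riso_by_def bij_betw_def)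
  then have "\<phi> (fold act ws v) = \<phi> v \<longleftrightarrow> fold act ws v = v"
    using in_ball[OF ws] in_ball[of "[]"] by (auto simp: inj_on_def words_le_def)
  ultimately show ?thesis using ws root by (auto simp: code_def words_le_def)
qed

lemma action_graph_wf: "action V act \<Longrightarrow> v \<in> V \<Longrightarrow> wf_rgraph (action_graph S V act, v)"
  by (auto simp: wf_rgraph_def action_def)

lemma code_of_riso:
  assumes a: "action V act" "v \<in> V" and a': "action V' act'" "v' \<in> V'"
    and i: "riso (action_graph S V act, v) (action_graph S V' act', v')"
  shows "code S act v = code S act' v'"
proof -
  have "ws \<in> code S act v \<longleftrightarrow> ws \<in> code S act' v'" if "ws \<in> lists S" for ws
    using code_of_riso_rball[OF a a' riso_rball[OF i action_graph_wf[OF a] action_graph_wf[OF a']], of ws "length ws"] that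
    by (auto simp: words_le_def)
  then show ?thesis by (auto simp: code_def)
qed

lemma trans_action_rooted:
  assumes t: "trans_action V act v"
  shows "(action_graph S V act, v) \<in> rooted_graphs S"
proof -
  have a: "action V act" "v \<in> V" using t by (auto simp: trans_action_def)
  have "sym (adj (action_graph S V act))" by (auto simp: sym_def adj_def)
  then have sy: "sym ((adj (action_graph S V act))\<^sup>*)" by (rule sym_rtrancl)
  have "(v, y) \<in> (adj (action_graph S V act))\<^sup>*" if "y \<in> V" for y
  proof -
    obtain ws where "ws \<in> lists S" "fold act ws v = y" using t \<open>y \<in> V\<close> by (auto simp: trans_action_def)
    then have "(v, y) \<in> adj (action_graph S V act) ^^ length ws" using adj_pow_action_graph[OF a] by blast
    then show ?thesis by (rule relpow_imp_rtrancl)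
  qed
  then have "connected_lgraph (action_graph S V act)"
    unfolding connected_lgraph_def using sy by simp (meson rtrancl_trans symD)
  then show ?thesis using a by (auto simp: rooted_graphs_def action_def)
qed

text \<open>Classes consist of graphs on natural numbers, while the graphs of interest have rays or
  pairs as vertices; a countable action is transported along an injection.\<close>

lemma trans_action_nat:
  fixes V :: "'v set"
  assumes t: "trans_action V act v" and c: "countable V"
  obtains V' act' and v' :: nat where "trans_action V' act' v'" 
    "riso (action_graph S V act, v) (action_graph S V' act', v')"
proof -
  define f where "f = to_nat_on V"
  define g where "g = inv_into V f"
  define act' where "act' s n = f (act s (g n))" for s n
  have a: "action V act" "v \<in> V" using t by (auto simp: trans_action_def)
  have inj: "inj_on f V" using c by (auto simp: f_def)
  then have gf: "g (f y) = y" if "y \<in> V" for y using that by (simp add: g_def)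
  have a': "action (f ` V) act'" 
    using a iv gf by (auto simp: action_def act'_def)
  have fd: "fold act' ws (f y) = f (fold act ws y)" if "ws \<in> lists S" "y \<in> V" for ws y
    using that
  proof (induction ws arbitrary: y)
    case (Cons s ws)
    then show ?case using a gf by (auto simp: act'_def action_def)
  qed simp
  have t': "trans_action (f ` V) act' (f v)"
    using t a' fd unfolding trans_action_def by (metis image_iff)
  have "code S act v = code S act' (f v)"
    using fd[OF _ a(2)] inj_on_eq_iff[OF inj fold_closed[OF a(1) _ a(2)] a(2)] unfolding code_def
    by (intro Collect_cong conj_cong refl) simp
  then show ?thesis using that t' riso_of_code[OF t t'] by blast
qed


subsection \<open>The topology in terms of codes\<close>

text \<open>The ambient space contains arbitrary labelled graphs. Only these classes have a code,
  and by \<open>closure_points\<close> closures of sets of such classes stay among them.\<close>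

definition points :: "(nat, 'l) rgraph set set" where
  "points = {iso_class S (action_graph S V act, v) | V act (v::nat). trans_action V act v}"

text \<open>The choice is harmless: by \<open>iso_class_action_graph_eq_iff_code\<close> all
  representatives of a point have the same code.\<close>

definition class_code :: "(nat, 'l) rgraph set \<Rightarrow> 'l list set" where
  "class_code C = (SOME W. \<exists>V act (v::nat). trans_action V act v \<and> C = iso_class S (action_graph S V act, v) \<and> W = code S act v)"

lemma iso_class_action_graph_eq_iff_code:
  assumes t: "trans_action V act (v::nat)" and t': "trans_action V' act' (v'::nat)"
  shows "iso_class S (action_graph S V act, v) = iso_class S (action_graph S V' act', v') \<longleftrightarrow> code S act v = code S act' v'"
proof
  have a: "action V act" "v \<in> V" "action V' act'" "v' \<in> V'" using t t' by (auto simp: trans_action_def)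
  { assume "iso_class S (action_graph S V act, v) = iso_class S (action_graph S V' act', v')"
    then have "riso (action_graph S V act, v) (action_graph S V' act', v')"
      using iso_class_self[OF trans_action_rooted[OF t']] by (auto simp: iso_class_def)
    then show "code S act v = code S act' v'" using code_of_riso[OF a] by blast }
  { assume "code S act v = code S act' v'"
    then show "iso_class S (action_graph S V act, v) = iso_class S (action_graph S V' act', v')"
      using riso_of_code[OF t t'] iso_class_eq a by (metis action_graph_simps(1) fst_conv snd_conv) }
qed

lemma class_code_nat: 
  assumes t: "trans_action V act (v::nat)"
  shows "class_code (iso_class S (action_graph S V act, v)) = code S act v"
  unfolding class_code_def
  by (rule some_equality) (use t iso_class_action_graph_eq_iff_code[OF t] in blast)+

lemma points_of_action:
  assumes t: "trans_action V act v" and c: "countable V"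
  shows "iso_class S (action_graph S V act, v) \<in> points"
    and "class_code (iso_class S (action_graph S V act, v)) = code S act v"
proof -
  obtain V' act' and v' :: nat where t': "trans_action V' act' v'" 
    "riso (action_graph S V act, v) (action_graph S V' act', v')" using trans_action_nat[OF t c] by blast
  have e: "iso_class S (action_graph S V act, v) = iso_class S (action_graph S V' act', v')"
    using iso_class_eq[OF t'(2)] t by (simp add: trans_action_def)
  then show "iso_class S (action_graph S V act, v) \<in> points" using t' by (auto simp: points_def)
  have "code S act v = code S act' v'"
    using code_of_riso t t' by (metis trans_action_def)
  then show "class_code (iso_class S (action_graph S V act, v)) = code S act v"
    using e class_code_nat[OF t'(1)] by simp
qed

text \<open>These relations play the role of balls of a metric; \<open>points_open\<close> and
  \<open>points_open_agree\<close> compare them with the given topology.\<close>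

definition agree :: "nat \<Rightarrow> (nat, 'l) rgraph set \<Rightarrow> (nat, 'l) rgraph set \<Rightarrow> bool" where
  "agree r C D \<longleftrightarrow> (\<forall>ws\<in>words_le r. ws \<in> class_code C \<longleftrightarrow> ws \<in> class_code D)"

lemma agree_mono: "agree r C D \<Longrightarrow> r' \<le> r \<Longrightarrow> agree r' C D"
  by (auto simp: agree_def words_le_def)

lemma agree_sym: "agree r C D \<Longrightarrow> agree r D C"
  by (auto simp: agree_def)

lemma points_eqI:
  assumes "C \<in> points" "D \<in> points" "\<And>r. agree r C D"
  shows "C = D"
proof -
  obtain V act and v :: nat where C: "trans_action V act v" "C = iso_class S (action_graph S V act, v)" using assms unfolding points_def by blast
  obtain V' act' and v' :: nat where D: "trans_action V' act' v'" "D = iso_class S (action_graph S V' act', v')" using assms unfolding points_def by blast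
  have "ws \<in> code S act v \<longleftrightarrow> ws \<in> code S act' v'" if "ws \<in> lists S" for ws
    using assms(3)[of "length ws"] that class_code_nat C D by (auto simp: agree_def words_le_def)
  then have "code S act v = code S act' v'" by (auto simp: code_def)
  then show ?thesis using iso_class_action_graph_eq_iff_code C D by blast
qed

lemma points_graph_space: "C \<in> points \<Longrightarrow> C \<in> graph_space S"
  using trans_action_rooted by (auto simp: points_def graph_space_def)

lemma topspace_graph_topology: "topspace (graph_topology S) = graph_space S"
proof -
  have "iso_class S X \<in> ball_cylinder S 0 X" if "X \<in> rooted_graphs S" for X
    using that iso_class_self riso_refl by (fastforce simp: ball_cylinder_def graph_space_def)
  then have "C \<in> \<Union>{ball_cylinder S r X | r X. X \<in> rooted_graphs S}" if "C \<in> graph_space S" for C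
    using that unfolding graph_space_def by blast
  then show ?thesis unfolding graph_topology_def topology_generated_by_topspace
    by (auto simp: ball_cylinder_def)
qed

text \<open>Induction over the generation of the topology. A cylinder of radius \<open>r\<close> is
  controlled by words of length \<open>2 * r + 1\<close>, and a finite intersection takes the larger
  of two lengths.\<close>

lemma points_open:
  assumes "openin (graph_topology S) U" "C \<in> U" "C \<in> points"
  shows "\<exists>r. \<forall>D\<in>points. agree r C D \<longrightarrow> D \<in> U"
  using openin_topology_generated_by[OF assms(1)[unfolded graph_topology_def]] assms(2)
proof induction
  case (Int a b)
  then obtain r r' where "\<forall>D\<in>points. agree r C D \<longrightarrow> D \<in> a" "\<forall>D\<in>points. agree r' C D \<longrightarrow> D \<in> b" by auto
  then have "\<forall>D\<in>points. agree (max r r') C D \<longrightarrow> D \<in> a \<inter> b" 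
    using agree_mono by (meson IntI max.cobounded1 max.cobounded2)
  then show ?case by blast
next
  case (UN K)
  then show ?case by (meson Union_iff)
next
  case (Basis s)
  then obtain r X where s: "s = ball_cylinder S r X" "X \<in> rooted_graphs S" by auto
  obtain V act and v :: nat where C: "trans_action V act v" "C = iso_class S (action_graph S V act, v)" using assms unfolding points_def by blast
  obtain Y where Y: "Y \<in> C" "riso (rball r X) (rball r Y)" using Basis s by (auto simp: ball_cylinder_def)
  have a: "action V act" "v \<in> V" using C by (auto simp: trans_action_def)
  have Y': "riso (action_graph S V act, v) Y" "Y \<in> rooted_graphs S" using Y C by (auto simp: iso_class_def)
  have "riso Y (action_graph S V act, v)" using riso_sym[OF Y'(1)] a by simp
  then have 1: "riso (rball r X) (rball r (action_graph S V act, v))"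
    using riso_rball rooted_graphs_wf Y' Y(2) a action_graph_wf riso_trans by metis
  have "D \<in> s" if D: "D \<in> points" "agree (2 * r + 1) C D" for D
  proof -
    obtain V' act' and v' :: nat where D': "trans_action V' act' v'" "D = iso_class S (action_graph S V' act', v')" using D unfolding points_def by blast
    have a': "action V' act'" "v' \<in> V'" using D' by (auto simp: trans_action_def)
    have "riso (rball r (action_graph S V act, v)) (rball r (action_graph S V' act', v'))"
      using D(2) C D' class_code_nat by (intro riso_rball_of_code[OF a a']) (auto simp: agree_def)
    then have "riso (rball r X) (rball r (action_graph S V' act', v'))" using 1 riso_trans by blast
    moreover have "(action_graph S V' act', v') \<in> D" using D' iso_class_self trans_action_rooted by blast
    ultimately show ?thesis using s points_graph_space[OF D(1)] by (auto simp: ball_cylinder_def)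
  qed
  then show ?case by blast
qed auto

lemma cylinder_open: "X \<in> rooted_graphs S \<Longrightarrow> openin (graph_topology S) (ball_cylinder S r X)"
  unfolding graph_topology_def by (rule topology_generated_by_Basis) blast

lemma ball_cylinder_points:
  assumes "D \<in> points" "D \<in> ball_cylinder S r X"
  obtains V' act' and v' :: nat where "trans_action V' act' v'" "D = iso_class S (action_graph S V' act', v')"
     "riso (rball r X) (rball r (action_graph S V' act', v'))"
proof -
  obtain V' act' and v' :: nat where D': "trans_action V' act' v'" "D = iso_class S (action_graph S V' act', v')" using assms unfolding points_def by blast
  have a': "action V' act'" "v' \<in> V'" using D' by (auto simp: trans_action_def)
  obtain Z where Z: "Z \<in> D" "riso (rball r X) (rball r Z)" using assms by (auto simp: ball_cylinder_def)
  have Z': "riso (action_graph S V' act', v') Z" "Z \<in> rooted_graphs S" using Z D' by (auto simp: iso_class_def)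
  have "riso Z (action_graph S V' act', v')" using riso_sym[OF Z'(1)] a' by simp
  then have "riso (rball r X) (rball r (action_graph S V' act', v'))"
    using riso_rball rooted_graphs_wf Z' Z a' action_graph_wf riso_trans by metis
  then show ?thesis using that D' by blast
qed

lemma points_open_agree:
  assumes "C \<in> points"
  shows "\<exists>U. openin (graph_topology S) U \<and> C \<in> U \<and> (\<forall>D\<in>U \<inter> points. agree r C D)"
proof -
  obtain V act and v :: nat where C: "trans_action V act v" "C = iso_class S (action_graph S V act, v)" using assms unfolding points_def by blast
  have a: "action V act" "v \<in> V" using C by (auto simp: trans_action_def)
  let ?U = "ball_cylinder S r (action_graph S V act, v)"
  have "C \<in> ?U" using C(2) trans_action_rooted[OF C(1)] iso_class_self points_graph_space[OF assms] riso_refl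
    by (fastforce simp: ball_cylinder_def)
  moreover have "agree r C D" if "D \<in> ?U" "D \<in> points" for D
  proof -
    obtain V' act' and v' :: nat where D: "trans_action V' act' v'" "D = iso_class S (action_graph S V' act', v')"
      "riso (rball r (action_graph S V act, v)) (rball r (action_graph S V' act', v'))"
      using ball_cylinder_points \<open>D \<in> ?U\<close> \<open>D \<in> points\<close> by metis
    have a': "action V' act'" "v' \<in> V'" using D by (auto simp: trans_action_def)
    show ?thesis using code_of_riso_rball[OF a a' D(3)] class_code_nat[OF C(1)] class_code_nat[OF D(1)] C(2) D(2)
      by (simp add: agree_def)
  qed
  ultimately show ?thesis using cylinder_open[OF trans_action_rooted[OF C(1)]] by blast
qed

text \<open>Balls of finite radius see all edges at a given vertex, so every limit of action graphs is one.\<close>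
lemma locally_action:
  fixes Y :: "(nat, 'l) rgraph"
  assumes Y: "Y \<in> rooted_graphs S"
    and loc: "\<And>r. \<exists>V act v. action V act \<and> v \<in> V \<and> riso (rball r Y) (rball r (action_graph S V act, v :: nat))"
  shows "\<exists>act. trans_action (gverts (fst Y)) act (snd Y) \<and> Y = (action_graph S (gverts (fst Y)) act, snd Y)"
proof -
  obtain \<Gamma> y0 where Yeq: "Y = (\<Gamma>, y0)" by (cases Y)
  define V where "V = gverts \<Gamma>" 
  define E where "E = gedges \<Gamma>"
  have wf: "wf_rgraph Y" using Y rooted_graphs_wf by blast
  have E: "E \<subseteq> V \<times> S \<times> V" and y0: "y0 \<in> V" and con: "connected_lgraph \<Gamma>" 
    using Y by (auto simp: Yeq E_def V_def rooted_graphs_def)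
  \<comment> \<open>Existence and uniqueness of the target make \<open>E\<close> a family of maps;
    the pairing of \<open>s\<close> with \<open>iv s\<close> makes them mutually inverse.\<close>
  have key: "(\<exists>!w. (u, s, w) \<in> E) \<and> (\<forall>w. (u, s, w) \<in> E \<longleftrightarrow> (w, iv s, u) \<in> E)" if u: "u \<in> V" and s: "s \<in> S" for u s
  proof -
    have "(y0, u) \<in> (adj \<Gamma>)\<^sup>*" using con u y0 by (auto simp: connected_lgraph_def V_def)
    then obtain k where k: "(y0, u) \<in> adj \<Gamma> ^^ k" by (metis rtrancl_imp_relpow)
    \<comment> \<open>The vertex \<open>u\<close> is joined to the root by \<open>k\<close> edges,
      so the radius \<open>Suc k\<close> captures all neighbours of \<open>u\<close>, and of its
      image as well.\<close>
    obtain V' act and v :: nat where a: "action V' act" "v \<in> V'" "riso (rball (Suc k) Y) (rball (Suc k) (action_graph S V' act, v))"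
      using loc by blast
    let ?Z = "(action_graph S V' act, v)"
    obtain \<phi> where p: "riso_by \<phi> (rball (Suc k) Y) (rball (Suc k) ?Z)" using a by (auto simp: riso_iff)
    let ?B = "gverts (fst (rball (Suc k) Y))" and ?B' = "gverts (fst (rball (Suc k) ?Z))"
    have nb: "w \<in> ?B" if "(u, w) \<in> adj \<Gamma>" for w
    proof -
      have "(y0, w) \<in> adj \<Gamma> ^^ Suc k" using k that by auto
      then show ?thesis using adj_verts[OF wf, of w "Suc k"] unfolding rball_verts Yeq by (auto simp del: relpow.simps)
    qed
    have uB: "u \<in> ?B" using k u by (auto simp: Yeq rball_verts V_def simp del: relpow.simps intro!: exI[of _ k])
    have \<phi>u: "(v, \<phi> u) \<in> adj (fst ?Z) ^^ k"
      using riso_by_rball_path[OF wf p, of k u] k by (simp add: Yeq)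
    have \<phi>uV: "\<phi> u \<in> V'" using adj_verts[OF action_graph_wf[OF a(1,2)]] \<phi>u by simp
    have nb': "w \<in> ?B'" if "(\<phi> u, w) \<in> adj (fst ?Z)" for w
    proof -
      have "(v, w) \<in> adj (fst ?Z) ^^ Suc k" using \<phi>u that by auto
      then show ?thesis using adj_verts[OF action_graph_wf[OF a(1,2)], of w "Suc k"] unfolding rball_verts by (auto simp del: relpow.simps)
    qed
    have bij: "bij_betw \<phi> ?B ?B'" using p by (simp add: riso_by_def)
    have ed: "x \<in> ?B \<Longrightarrow> y \<in> ?B \<Longrightarrow> (x, t, y) \<in> E \<longleftrightarrow> (\<phi> x, t, \<phi> y) \<in> gedges (fst ?Z)" for x t y
      using riso_by_rball_edge[OF p, of x y t] by (simp add: Yeq E_def)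
    have e1: "(u, t, w) \<in> E \<Longrightarrow> w \<in> ?B" "(w, t, u) \<in> E \<Longrightarrow> w \<in> ?B" for t w
      using nb by (auto simp: adj_def E_def)
    have "(\<phi> u, act s (\<phi> u)) \<in> adj (fst ?Z)" using \<phi>uV s by (auto simp: adj_def)
    then obtain w where w: "w \<in> ?B" "\<phi> w = act s (\<phi> u)" using nb' bij by (metis bij_betw_iff_bijections)
    have "(u, s, w) \<in> E" using ed[OF uB w(1)] w \<phi>uV s by simp
    moreover have "w' = w" if "(u, s, w') \<in> E" for w'
    proof -
      have "w' \<in> ?B" "\<phi> w' = act s (\<phi> u)" using that e1 ed[OF uB, of w' s] by auto
      then show ?thesis using w bij by (metis bij_betw_imp_inj_on inj_onD)
    qed
    moreover have "(u, s, w) \<in> E \<longleftrightarrow> (w, iv s, u) \<in> E" for w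
    proof -
      have "(\<phi> u, s, \<phi> w) \<in> gedges (fst ?Z) \<longleftrightarrow> (\<phi> w, iv s, \<phi> u) \<in> gedges (fst ?Z)" if "w \<in> ?B"
      proof -
        have "\<phi> w \<in> V'" using that bij by (auto simp: bij_betw_def rball_verts)
        then show ?thesis using s iv[OF s] a(1) \<phi>uV by (auto simp: action_def)
      qed
      then show ?thesis using ed[OF uB, of w s] ed[OF _ uB, of w "iv s"] e1 by blast
    qed
    ultimately show ?thesis by blast
  qed
  define act where "act s u = (THE w. (u, s, w) \<in> E)" for s u
  have act: "(u, s, w) \<in> E \<longleftrightarrow> w = act s u" if "u \<in> V" "s \<in> S" for u s w
    unfolding act_def using key[OF that] by (metis the_equality)
  have actV: "act s u \<in> V" if "u \<in> V" "s \<in> S" for u s using act[OF that, of "act s u"] E by auto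
  have act_iv: "act (iv s) (act s u) = u" if "u \<in> V" "s \<in> S" for u s
    using act[OF that] key[OF that] act[OF actV[OF that] iv[OF that(2)]] by metis
  have act_iv2: "act s (act (iv s) u) = u" if u: "u \<in> V" and s: "s \<in> S" for u s
  proof -
    have w: "(u, iv s, act (iv s) u) \<in> E" "act (iv s) u \<in> V" using act actV iv u s by blast+
    then have "(act (iv s) u, s, u) \<in> E" using key[OF w(2) s] by blast
    then show ?thesis using act[OF w(2) s, of u] by simp
  qed
  have a: "action V act" unfolding action_def using actV act_iv act_iv2 by blast
  have \<Gamma>: "\<Gamma> = action_graph S V act" 
  proof -
    have "gedges \<Gamma> = {(y, s, act s y) | y s. y \<in> V \<and> s \<in> S}"
      using E act by (fastforce simp: E_def[symmetric])
    then show ?thesis by (simp add: action_graph_def V_def)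
  qed
  have "\<exists>ws\<in>lists S. fold act ws y0 = y" if "y \<in> V" for y
  proof -
    have "(y0, y) \<in> (adj \<Gamma>)\<^sup>*" using con that y0 by (auto simp: connected_lgraph_def V_def)
    then show ?thesis using adj_pow_action_graph[OF a y0] unfolding \<Gamma> by (metis rtrancl_imp_relpow)
  qed
  then have "trans_action V act y0" using a y0 by (auto simp: trans_action_def)
  then show ?thesis using \<Gamma> by (auto simp: Yeq V_def[symmetric])
qed

text \<open>Every cylinder around a representative of \<open>C\<close> meets \<open>Q\<close>, so
  each ball of the representative is a ball of an action graph, as \<open>locally_action\<close>
  requires.\<close>

lemma closure_points:
  assumes Q: "Q \<subseteq> points" and C: "C \<in> graph_topology S closure_of Q"
  shows "C \<in> points"
proof -
  have "C \<in> graph_space S" using C topspace_graph_topology by (auto simp: closure_of_def)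
  then obtain Y where Y: "Y \<in> rooted_graphs S" "C = iso_class S Y" by (auto simp: graph_space_def)
  have "\<exists>V act v. action V act \<and> v \<in> V \<and> riso (rball r Y) (rball r (action_graph S V act, v :: nat))" for r
  proof -
    have "C \<in> ball_cylinder S r Y" using Y iso_class_self riso_refl by (fastforce simp: ball_cylinder_def graph_space_def)
    then obtain D where "D \<in> Q" "D \<in> ball_cylinder S r Y"
      using C cylinder_open[OF Y(1), of r] by (auto simp: in_closure_of)
    then show ?thesis using ball_cylinder_points Q by (metis subsetD trans_action_def)
  qed
  then obtain act where "trans_action (gverts (fst Y)) act (snd Y)" "Y = (action_graph S (gverts (fst Y)) act, snd Y)"
    using locally_action[OF Y(1)] by blast
  then show ?thesis using Y(2) unfolding points_def by (metis (mono_tags, lifting) mem_Collect_eq)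
qed

lemma in_closure_points_iff:
  assumes Q: "Q \<subseteq> points"
  shows "C \<in> graph_topology S closure_of Q \<longleftrightarrow> C \<in> points \<and> (\<forall>r. \<exists>D\<in>Q. agree r C D)"
proof
  assume C: "C \<in> graph_topology S closure_of Q"
  then have p: "C \<in> points" using closure_points Q by blast
  show "C \<in> points \<and> (\<forall>r. \<exists>D\<in>Q. agree r C D)"
    using p C points_open_agree[OF p] Q unfolding in_closure_of by (metis IntI subsetD)
next
  assume R: "C \<in> points \<and> (\<forall>r. \<exists>D\<in>Q. agree r C D)"
  then show "C \<in> graph_topology S closure_of Q"
    using points_open[of _ C] points_graph_space[of C] Q unfolding in_closure_of topspace_graph_topology
    by (meson subsetD)
qed

lemma isolated_points_iff:
  assumes Q: "Q \<subseteq> points"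
  shows "C \<in> isolated_points (graph_topology S) Q \<longleftrightarrow> C \<in> Q \<and> (\<exists>r. \<forall>D\<in>Q. agree r C D \<longrightarrow> D = C)"
proof
  assume C: "C \<in> isolated_points (graph_topology S) Q"
  then obtain U where U: "C \<in> Q" "openin (graph_topology S) U" "U \<inter> Q = {C}" by (auto simp: isolated_points_def)
  then obtain r where "\<forall>D\<in>points. agree r C D \<longrightarrow> D \<in> U" using points_open[OF U(2), of C] Q by blast
  then show "C \<in> Q \<and> (\<exists>r. \<forall>D\<in>Q. agree r C D \<longrightarrow> D = C)" using U Q by blast
next
  assume "C \<in> Q \<and> (\<exists>r. \<forall>D\<in>Q. agree r C D \<longrightarrow> D = C)"
  then obtain r where C: "C \<in> Q" "\<forall>D\<in>Q. agree r C D \<longrightarrow> D = C" by blast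
  then obtain U where "openin (graph_topology S) U" "C \<in> U" "\<forall>D\<in>U \<inter> points. agree r C D"
    using points_open_agree[of C r] Q by blast
  then have "openin (graph_topology S) U \<and> U \<inter> Q = {C}" using C Q by blast
  then show "C \<in> isolated_points (graph_topology S) Q" using C by (auto simp: isolated_points_def)
qed

lemma topcontinuous_at_points_iff:
  assumes f: "\<And>x. x \<in> topspace T \<Longrightarrow> f x \<in> points" and x: "x \<in> topspace T"
  shows "topcontinuous_at T (graph_topology S) f x \<longleftrightarrow>
    (\<forall>r. \<exists>U. openin T U \<and> x \<in> U \<and> (\<forall>y\<in>U. agree r (f x) (f y)))"
proof
  assume c: "topcontinuous_at T (graph_topology S) f x"
  show "\<forall>r. \<exists>U. openin T U \<and> x \<in> U \<and> (\<forall>y\<in>U. agree r (f x) (f y))"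
  proof
    fix r
    obtain V where V: "openin (graph_topology S) V" "f x \<in> V" "\<forall>D\<in>V \<inter> points. agree r (f x) D"
      using points_open_agree[OF f[OF x]] by blast
    then obtain U where U: "openin T U" "x \<in> U" "\<forall>y\<in>U. f y \<in> V" using c by (auto simp: topcontinuous_at_def)
    then have "\<forall>y\<in>U. f y \<in> points" using f openin_subset by blast
    then show "\<exists>U. openin T U \<and> x \<in> U \<and> (\<forall>y\<in>U. agree r (f x) (f y))" using U V by blast
  qed
next
  assume R: "\<forall>r. \<exists>U. openin T U \<and> x \<in> U \<and> (\<forall>y\<in>U. agree r (f x) (f y))"
  have "\<exists>U. openin T U \<and> x \<in> U \<and> (\<forall>y\<in>U. f y \<in> V)" if V: "openin (graph_topology S) V" "f x \<in> V" for V
  proof -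
    obtain r where r: "\<forall>D\<in>points. agree r (f x) D \<longrightarrow> D \<in> V" using points_open[OF V f[OF x]] by blast
    obtain U where U: "openin T U" "x \<in> U" "\<forall>y\<in>U. agree r (f x) (f y)" using R by blast
    then have "\<forall>y\<in>U. f y \<in> points" using f openin_subset by blast
    then show ?thesis using U r by blast
  qed
  then show "topcontinuous_at T (graph_topology S) f x"
    using x f points_graph_space unfolding topcontinuous_at_def topspace_graph_topology by blast
qed

end


section \<open>Spinal generators\<close>

lemma words_append [simp]: "u @ w \<in> words d \<longleftrightarrow> u \<in> words d \<and> w \<in> words d"
  and words_Cons [simp]: "x # w \<in> words d \<longleftrightarrow> x < d \<and> w \<in> words d"
  and words_Nil [simp]: "[] \<in> words d"
  by (auto simp: words_def)

lemma words_replicate: "x < d \<Longrightarrow> replicate r x \<in> words d"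
  by (induction r) auto

lemma map_ray_words: "\<xi> \<in> boundary d \<Longrightarrow> map \<xi> [i..<n] \<in> words d"
  by (auto simp: words_def boundary_def)

lemma is_child_snoc [simp]: "is_child u (u @ [x])"
  by (simp add: is_child_def)

lemma carrier_Aut_tree: "g \<in> carrier (Aut_tree d) \<longleftrightarrow> g \<in> Bij (words d) \<and> g [] = [] \<and>
        (\<forall>u\<in>words d. \<forall>w\<in>words d. is_child (g u) (g w) \<longleftrightarrow> is_child u w)"
  by (auto simp: Aut_tree_def)

lemma Aut_tree_mult: "g \<in> Bij (words d) \<Longrightarrow> h \<in> Bij (words d) \<Longrightarrow>
    g \<otimes>\<^bsub>Aut_tree d\<^esub> h = compose (words d) g h"
  and Aut_tree_one: "\<one>\<^bsub>Aut_tree d\<^esub> = (\<lambda>w\<in>words d. w)"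
  by (auto simp: Aut_tree_def BijGroup_def)

lemma group_Aut_tree: "group (Aut_tree d)"
proof -
  interpret W: group "BijGroup (words d)" by (rule group_BijGroup)
  have mem: "g w \<in> words d" if "g \<in> Bij (words d)" "w \<in> words d" for g w
    using that Bij_imp_funcset by blast
  have "subgroup (carrier (Aut_tree d)) (BijGroup (words d))"
  proof (rule W.subgroupI)
    show "carrier (Aut_tree d) \<subseteq> carrier (BijGroup (words d))"
      by (auto simp: carrier_Aut_tree BijGroup_def)
    have "(\<lambda>x\<in>words d. x) \<in> carrier (Aut_tree d)"
      using id_Bij[of "words d"] by (simp add: carrier_Aut_tree)
    then show "carrier (Aut_tree d) \<noteq> {}" by blast
  next
    fix g assume g: "g \<in> carrier (Aut_tree d)"
    let ?h = "\<lambda>x\<in>words d. inv_into (words d) g x"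
    have gB: "g \<in> Bij (words d)" using g by (simp add: carrier_Aut_tree)
    have gh: "g (inv_into (words d) g w) = w" "inv_into (words d) g w \<in> words d" if "w \<in> words d" for w
      using gB that by (auto simp: Bij_def bij_betw_def f_inv_into_f inv_into_into)
    have "?h [] = []" using g gB
      by (metis Bij_def Int_iff bij_betw_def carrier_Aut_tree inv_into_f_f mem_Collect_eq restrict_apply' words_Nil)
    moreover have "is_child (?h u) (?h w) \<longleftrightarrow> is_child u w" if "u \<in> words d" "w \<in> words d" for u w
      using g gh that unfolding carrier_Aut_tree by (metis restrict_apply')
    ultimately show "inv\<^bsub>BijGroup (words d)\<^esub> g \<in> carrier (Aut_tree d)"
      using restrict_inv_into_Bij[OF gB] unfolding inv_BijGroup[OF gB] carrier_Aut_tree by blast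
  next
    fix g h assume "g \<in> carrier (Aut_tree d)" "h \<in> carrier (Aut_tree d)"
    then show "g \<otimes>\<^bsub>BijGroup (words d)\<^esub> h \<in> carrier (Aut_tree d)"
      using mem[of h] compose_Bij[of g "words d" h] by (auto simp: carrier_Aut_tree BijGroup_def compose_def)
  qed
  then have "group ((BijGroup (words d))\<lparr>carrier := carrier (Aut_tree d)\<rparr>)"
    by (rule W.subgroup_imp_group)
  then show ?thesis by (simp add: Aut_tree_def)
qed

lemma Aut_tree_mem: "g \<in> carrier (Aut_tree d) \<Longrightarrow> w \<in> words d \<Longrightarrow> g w \<in> words d"
  using Bij_imp_funcset by (auto simp: carrier_Aut_tree)

lemma Aut_tree_mult_apply: "g \<in> carrier (Aut_tree d) \<Longrightarrow> h \<in> carrier (Aut_tree d) \<Longrightarrow> w \<in> words d \<Longrightarrow>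
   (g \<otimes>\<^bsub>Aut_tree d\<^esub> h) w = g (h w)"
  by (simp add: carrier_Aut_tree Aut_tree_mult compose_def)

lemma Aut_tree_eqI:
  assumes "g \<in> carrier (Aut_tree d)" "h \<in> carrier (Aut_tree d)" "\<And>w. w \<in> words d \<Longrightarrow> g w = h w"
  shows "g = h"
  using assms by (intro extensionalityI[of g "words d" h]) (auto simp: carrier_Aut_tree Bij_def)

lemma Aut_tree_snoc:
  assumes "g \<in> carrier (Aut_tree d)" "w @ [x] \<in> words d"
  obtains y where "g (w @ [x]) = g w @ [y]"
  using assms is_child_snoc[of w x] unfolding carrier_Aut_tree by (metis is_child_def words_append)

lemma Aut_tree_length: "g \<in> carrier (Aut_tree d) \<Longrightarrow> w \<in> words d \<Longrightarrow> length (g w) = length w"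
proof (induction w rule: rev_induct)
  case (snoc x w)
  then show ?case using Aut_tree_snoc[OF snoc.prems] by (metis length_append_singleton words_append)
qed (simp add: carrier_Aut_tree)

text \<open>Children go to children, so the image of a prefix is a prefix of the image. The
  letterwise definition of \<open>boundary_act\<close> rests on this coherence.\<close>

lemma Aut_tree_take: "g \<in> carrier (Aut_tree d) \<Longrightarrow> w \<in> words d \<Longrightarrow> take n (g w) = g (take n w)"
proof (induction w rule: rev_induct)
  case (snoc x w)
  then obtain y where y: "g (w @ [x]) = g w @ [y]" using Aut_tree_snoc[OF snoc.prems] by blast
  have l: "length (g w) = length w" using Aut_tree_length snoc.prems by simp
  show ?case
  proof (cases "n \<le> length w")
    case True
    then show ?thesis using snoc l y by simp
  next
    case False
    then show ?thesis using l y by simp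
  qed
qed (simp add: carrier_Aut_tree)

text \<open>Preservation of children is asked in one direction, but for both \<open>g\<close> and
  its inverse \<open>h\<close>; the direction for \<open>h\<close> yields the converse for
  \<open>g\<close>.\<close>

lemma Aut_treeI:
  assumes "g \<in> extensional (words d)" "g [] = []" "h [] = []"
    and "\<And>w. w \<in> words d \<Longrightarrow> g w \<in> words d" "\<And>w. w \<in> words d \<Longrightarrow> h w \<in> words d"
    and inv: "\<And>w. w \<in> words d \<Longrightarrow> h (g w) = w" "\<And>w. w \<in> words d \<Longrightarrow> g (h w) = w"
    and c: "\<And>w x. w @ [x] \<in> words d \<Longrightarrow> is_child (g w) (g (w @ [x]))"
      "\<And>w x. w @ [x] \<in> words d \<Longrightarrow> is_child (h w) (h (w @ [x]))"
  shows "g \<in> carrier (Aut_tree d)"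
proof -
  have "bij_betw g (words d) (words d)"
    by (rule bij_betw_byWitness[where f' = h]) (use assms in auto)
  moreover have "is_child (g u) (g w) \<longleftrightarrow> is_child u w" if u: "u \<in> words d" and w: "w \<in> words d" for u w
  proof
    assume "is_child u w"
    then show "is_child (g u) (g w)" using c(1) w by (auto simp: is_child_def)
  next
    assume "is_child (g u) (g w)"
    then obtain x where x: "g w = g u @ [x]" by (auto simp: is_child_def)
    then have "is_child (h (g u)) (h (g w))" using c(2)[of "g u" x] assms(4)[OF w] by simp
    then show "is_child u w" using inv u w by simp
  qed
  ultimately show ?thesis using assms(1,2) by (simp add: carrier_Aut_tree Bij_def)
qed

lemma boundary_act_prefix:
  assumes g: "g \<in> carrier (Aut_tree d)" and \<xi>: "\<xi> \<in> boundary d"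
  shows "map (boundary_act g \<xi>) [0..<n] = g (map \<xi> [0..<n])"
proof (rule nth_equalityI)
  have l: "length (g (map \<xi> [0..<k])) = k" for k
    using Aut_tree_length[OF g map_ray_words[OF \<xi>]] by simp
  then show "length (map (boundary_act g \<xi>) [0..<n]) = length (g (map \<xi> [0..<n]))" by simp
  fix i assume i: "i < length (map (boundary_act g \<xi>) [0..<n])"
  have "take (Suc i) (g (map \<xi> [0..<n])) = g (map \<xi> [0..<Suc i])"
    using Aut_tree_take[OF g map_ray_words[OF \<xi>], of "Suc i" 0 n] i by (simp add: take_map)
  then have "g (map \<xi> [0..<Suc i]) ! i = g (map \<xi> [0..<n]) ! i" by (metis lessI nth_take)
  then show "map (boundary_act g \<xi>) [0..<n] ! i = g (map \<xi> [0..<n]) ! i"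
    using i by (simp add: boundary_act_def)
qed

lemma boundary_act_closed:
  assumes g: "g \<in> carrier (Aut_tree d)" and \<xi>: "\<xi> \<in> boundary d"
  shows "boundary_act g \<xi> \<in> boundary d"
proof -
  have "boundary_act g \<xi> n < d" for n
  proof -
    have "map (boundary_act g \<xi>) [0..<Suc n] \<in> words d"
      unfolding boundary_act_prefix[OF assms] using Aut_tree_mem[OF g map_ray_words[OF \<xi>]] .
    then show ?thesis by (simp add: words_def)
  qed
  then show ?thesis by (simp add: boundary_def)
qed

lemma boundary_act_mult:
  assumes g: "g \<in> carrier (Aut_tree d)" "h \<in> carrier (Aut_tree d)" and \<xi>: "\<xi> \<in> boundary d"
  shows "boundary_act (g \<otimes>\<^bsub>Aut_tree d\<^esub> h) \<xi> = boundary_act g (boundary_act h \<xi>)"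
proof
  fix n
  have "boundary_act (g \<otimes>\<^bsub>Aut_tree d\<^esub> h) \<xi> n = g (h (map \<xi> [0..<Suc n])) ! n"
    using Aut_tree_mult_apply[OF g map_ray_words[OF \<xi>]] by (simp add: boundary_act_def del: upt_Suc)
  then show "boundary_act (g \<otimes>\<^bsub>Aut_tree d\<^esub> h) \<xi> n = boundary_act g (boundary_act h \<xi>) n"
    unfolding boundary_act_prefix[OF g(2) \<xi>, symmetric] by (simp add: boundary_act_def[of g])
qed

lemma boundary_act_one: "\<xi> \<in> boundary d \<Longrightarrow> boundary_act \<one>\<^bsub>Aut_tree d\<^esub> \<xi> = \<xi>"
  by (rule ext) (simp add: boundary_act_def Aut_tree_one map_ray_words nth_append del: upt_Suc)


section \<open>Powers of the rotation and the group A\<close>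

definition rotk :: "nat \<Rightarrow> nat \<Rightarrow> nat list \<Rightarrow> nat list" where
  "rotk d j = (\<lambda>w\<in>words d. case w of [] \<Rightarrow> [] | v # u \<Rightarrow> ((v + j) mod d) # u)"

lemma rotk_Nil [simp]: "rotk d j [] = []" and
  rotk_Cons [simp]: "v # u \<in> words d \<Longrightarrow> rotk d j (v # u) = ((v + j) mod d) # u"
  by (auto simp: rotk_def)

lemma rotk_words: "0 < d \<Longrightarrow> w \<in> words d \<Longrightarrow> rotk d j w \<in> words d"
  by (cases w) auto

lemma rotk_snoc: "w @ [x] \<in> words d \<Longrightarrow> is_child (rotk d j w) (rotk d j (w @ [x]))"
  by (cases w) (auto simp: is_child_def)

lemma rotk_rotk: "0 < d \<Longrightarrow> w \<in> words d \<Longrightarrow> rotk d j (rotk d k w) = rotk d (j + k) w"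
  by (cases w) (auto simp: mod_simps ac_simps)

lemma rotk_mod: "w \<in> words d \<Longrightarrow> rotk d (j mod d) w = rotk d j w"
  by (cases w) (auto simp: mod_simps)

lemma rotk_0: "w \<in> words d \<Longrightarrow> rotk d 0 w = w"
  by (cases w) auto

lemma rotk_mod_eq: "rotk d (j mod d) = rotk d j"
  unfolding rotk_def by (intro restrict_ext) (auto split: list.splits simp: mod_simps)

lemma rotk_Aut_tree:
  assumes "0 < d"
  shows "rotk d j \<in> carrier (Aut_tree d)"
\<comment> \<open>\<open>(d - 1) * j\<close> is a natural number congruent to \<open>- j\<close>
  modulo \<open>d\<close>.\<close>
proof (rule Aut_treeI[where h = "rotk d ((d - 1) * j)"])
  have *: "(d - 1) * j + j = d * j" using assms by (cases d) auto
  then have "j + (d - 1) * j = d * j" by simp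
  then show "rotk d ((d - 1) * j) (rotk d j w) = w" "rotk d j (rotk d ((d - 1) * j) w) = w" if "w \<in> words d" for w
    using rotk_mod[OF that, of "d * j"] rotk_0[OF that]
    unfolding rotk_rotk[OF assms that] * \<open>j + (d - 1) * j = d * j\<close> by simp_all
qed (auto simp: rotk_words assms rotk_snoc, simp add: rotk_def)

lemma rotk_mult: "0 < d \<Longrightarrow> rotk d j \<otimes>\<^bsub>Aut_tree d\<^esub> rotk d k = rotk d (j + k)"
  by (rule Aut_tree_eqI[of _ d])
    (auto simp: Aut_tree_mult_apply rotk_Aut_tree rotk_rotk group.is_monoid[OF group_Aut_tree] monoid.m_closed)

lemma rotk_one: "\<one>\<^bsub>Aut_tree d\<^esub> = rotk d 0"
  unfolding Aut_tree_one rotk_def by (intro restrict_ext) (auto split: list.splits)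

lemma rotk_eq_iff: "0 < d \<Longrightarrow> rotk d j = rotk d k \<longleftrightarrow> j mod d = k mod d"
proof
  assume "0 < d" "rotk d j = rotk d k"
  then have "rotk d j [0] = rotk d k [0]" by simp
  then show "j mod d = k mod d" using \<open>0 < d\<close> by simp
next
  show "j mod d = k mod d \<Longrightarrow> rotk d j = rotk d k" by (metis rotk_mod_eq)
qed

lemma rotk_inv: 
  assumes "0 < d"
  shows "inv\<^bsub>Aut_tree d\<^esub> (rotk d j) = rotk d ((d - 1) * j)"
proof -
  interpret group "Aut_tree d" by (rule group_Aut_tree)
  have "(d - 1) * j + j = d * j" using assms by (cases d) auto
  then have "rotk d ((d - 1) * j) \<otimes>\<^bsub>Aut_tree d\<^esub> rotk d j = \<one>\<^bsub>Aut_tree d\<^esub>"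
    using rotk_mult[OF assms] rotk_one rotk_eq_iff[OF assms] by simp
  then show ?thesis using inv_equality rotk_Aut_tree[OF assms] by metis
qed

lemma rot_eq: "rot d = rotk d (Suc 0)"
  unfolding rot_def rotk_def Suc_eq_plus1 add_0 ..

lemma rot_pow:
  assumes "0 < d"
  shows "rot d [^]\<^bsub>Aut_tree d\<^esub> (j::nat) = rotk d j"
proof (induction j)
  case (Suc j)
  then show ?case using assms by (simp add: rot_eq rotk_mult)
qed (simp add: rotk_one)

lemma carrier_Agrp:
  assumes "0 < d"
  shows "carrier (Agrp d) = rotk d ` {..<d}"
proof -
  interpret group "Aut_tree d" by (rule group_Aut_tree)
  have all: "rotk d j \<in> rotk d ` {..<d}" for j
    using rotk_mod_eq[of d j] assms by (metis imageI lessThan_iff mod_less_divisor)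
  have "g \<in> rotk d ` {..<d}" if "g \<in> generate (Aut_tree d) {rot d}" for g
    using that
  proof induction
    case (inv h)
    then show ?case using all rotk_inv assms rot_eq by auto
  qed (use all rotk_mult assms rotk_one rot_eq in auto)
  moreover have "rotk d j \<in> generate (Aut_tree d) {rot d}" for j
  proof (induction j)
    case 0
    then show ?case using generate.one[of "Aut_tree d"] by (simp add: rotk_one)
  next
    case (Suc j)
    then have "rotk d j \<otimes>\<^bsub>Aut_tree d\<^esub> rot d \<in> generate (Aut_tree d) {rot d}"
      by (rule generate.eng) (rule generate.incl, simp)
    then show ?case using assms by (simp add: rot_eq rotk_mult)
  qed
  ultimately show ?thesis by (auto simp: Agrp_def)
qed

lemma boundary_act_rotk:
  assumes "\<xi> \<in> boundary d"
  shows "boundary_act (rotk d j) \<xi> = \<xi>(0 := (\<xi> 0 + j) mod d)"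
proof
  fix n
  have "map \<xi> [0..<Suc n] = \<xi> 0 # map \<xi> [1..<Suc n]" by (simp add: upt_conv_Cons del: upt_Suc)
  moreover have "map \<xi> [0..<Suc n] \<in> words d" by (rule map_ray_words[OF assms])
  ultimately have "boundary_act (rotk d j) \<xi> n = (((\<xi> 0 + j) mod d) # map \<xi> [1..<Suc n]) ! n"
    unfolding boundary_act_def by (metis rotk_Cons)
  then show "boundary_act (rotk d j) \<xi> n = (\<xi>(0 := (\<xi> 0 + j) mod d)) n"
    by (cases n) (simp_all del: upt_Suc)
qed


section \<open>The group B and its epimorphisms onto A\<close>

lemma group_Bgrp: "group (Bgrp d m)"
  unfolding Bgrp_def by (rule product_group) (auto)

lemma finite_Bgrp: "0 < d \<Longrightarrow> finite (carrier (Bgrp d m))"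
  by (auto simp: Bgrp_def carrier_integer_mod_group intro: finite_PiE)

lemma card_Bgrp: "0 < d \<Longrightarrow> card (carrier (Bgrp d m)) = d ^ m"
  by (simp add: Bgrp_def carrier_integer_mod_group card_PiE)


text \<open>This is the epimorphism viewed as a map to Z/dZ, with values represented in 0, ..., d-1.
  The description is meaningful for \<open>\<pi>\<close> in \<open>Epi\<close> and \<open>b\<close>
  in B.\<close>

definition exponent :: "nat \<Rightarrow> ((nat \<Rightarrow> int) \<Rightarrow> nat list \<Rightarrow> nat list) \<Rightarrow> (nat \<Rightarrow> int) \<Rightarrow> nat" where
  "exponent d \<pi> b = (THE j. j < d \<and> \<pi> b = rotk d j)"

text \<open>For d >= 2 a ray is active at no more than one position, and (d-1)^N at none. The letter
  changed by B is the one after the active position.\<close>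

definition active_at :: "nat \<Rightarrow> nat \<Rightarrow> (nat \<Rightarrow> nat) \<Rightarrow> bool" where
  "active_at d k \<xi> \<longleftrightarrow> (\<forall>i<k. \<xi> i = d - 1) \<and> \<xi> k = 0"

locale spinal =
  fixes d m :: nat and \<omega> :: "nat \<Rightarrow> (nat \<Rightarrow> int) \<Rightarrow> nat list \<Rightarrow> nat list"
  assumes dm: "(d = 2 \<and> m \<ge> 2) \<or> (d \<ge> 3 \<and> m \<ge> 1)" and \<omega>: "\<omega> \<in> Omega d m"
begin

abbreviation "B \<equiv> carrier (Bgrp d m)"
abbreviation "B1 \<equiv> \<one>\<^bsub>Bgrp d m\<^esub>"
abbreviation "S \<equiv> spinal_gens d m \<omega>"
abbreviation "sp \<equiv> spin d \<omega>"
abbreviation "inva s \<equiv> inv\<^bsub>Aut_tree d\<^esub> s"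

lemma d2: "2 \<le> d" using dm by auto
lemma d0: "0 < d" using d2 by auto

sublocale Bg: group "Bgrp d m" by (rule group_Bgrp)
sublocale Au: group "Aut_tree d" by (rule group_Aut_tree)

lemma \<omega>_Epi: "\<omega> n \<in> Epi d m" using \<omega> by (auto simp: Omega_def)

lemma exponent_props:
  assumes "\<pi> \<in> Epi d m" "b \<in> B"
  shows "exponent d \<pi> b < d" "\<pi> b = rotk d (exponent d \<pi> b)"
proof -
  have "\<pi> b \<in> rotk d ` {..<d}" using assms carrier_Agrp[OF d0] by (auto simp: Epi_def epi_def hom_def)
  then obtain j where "j < d" "\<pi> b = rotk d j" by auto
  then have "\<exists>!j. j < d \<and> \<pi> b = rotk d j" using rotk_eq_iff[OF d0] by auto
  then show "exponent d \<pi> b < d" "\<pi> b = rotk d (exponent d \<pi> b)" unfolding exponent_def by (metis (mono_tags, lifting) theI)+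
qed

lemma exponent_eq: "\<pi> \<in> Epi d m \<Longrightarrow> b \<in> B \<Longrightarrow> \<pi> b = rotk d j \<Longrightarrow> exponent d \<pi> b = j mod d"
  using exponent_props[of \<pi> b] rotk_eq_iff[OF d0] by auto

lemma exponent_mult:
  assumes "\<pi> \<in> Epi d m" "b \<in> B" "b' \<in> B"
  shows "exponent d \<pi> (b \<otimes>\<^bsub>Bgrp d m\<^esub> b') = (exponent d \<pi> b + exponent d \<pi> b') mod d"
proof (rule exponent_eq)
  have "\<pi> (b \<otimes>\<^bsub>Bgrp d m\<^esub> b') = \<pi> b \<otimes>\<^bsub>Aut_tree d\<^esub> \<pi> b'"
    using assms by (auto simp: Epi_def epi_def hom_def Agrp_def)
  then show "\<pi> (b \<otimes>\<^bsub>Bgrp d m\<^esub> b') = rotk d (exponent d \<pi> b + exponent d \<pi> b')"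
    using exponent_props assms rotk_mult[OF d0] by metis
qed (use assms in auto)

lemma exponent_one: 
  assumes "\<pi> \<in> Epi d m"
  shows "exponent d \<pi> B1 = 0"
proof -
  let ?e = "exponent d \<pi> B1"
  have e: "?e < d" using exponent_props(1)[OF assms, of B1] by simp
  have "exponent d \<pi> (B1 \<otimes>\<^bsub>Bgrp d m\<^esub> B1) = (?e + ?e) mod d"
    by (rule exponent_mult[OF assms]) auto
  then have "?e = (?e + ?e) mod d" by simp
  then show ?thesis using e by (cases "?e + ?e < d") (auto simp: le_mod_geq)
qed

lemma exponent_surj:
  assumes "\<pi> \<in> Epi d m" "j < d"
  shows "\<exists>b\<in>B. exponent d \<pi> b = j"
proof -
  have "rotk d j \<in> \<pi> ` B" using assms carrier_Agrp[OF d0] by (auto simp: Epi_def epi_def)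
  then obtain b where b: "b \<in> B" "\<pi> b = rotk d j" by auto
  then have "exponent d \<pi> b = j" using exponent_eq[OF assms(1)] assms(2) by simp
  then show ?thesis using b by blast
qed

lemma exponent_inv: "\<pi> \<in> Epi d m \<Longrightarrow> b \<in> B \<Longrightarrow> (exponent d \<pi> (inv\<^bsub>Bgrp d m\<^esub> b) + exponent d \<pi> b) mod d = 0"
  using exponent_mult[of \<pi> "inv\<^bsub>Bgrp d m\<^esub> b" b] exponent_one by auto

text \<open>Otherwise \<open>b\<close> would lie in all kernels from index \<open>i\<close> on,
  against the definition of \<open>Omega\<close>. It provides arbitrarily late positions at which
  \<open>b\<close> acts nontrivially.\<close>

lemma ker_late:
  assumes "b \<in> B" "b \<noteq> B1"
  shows "\<exists>k\<ge>i. exponent d (\<omega> k) b \<noteq> 0"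
proof (rule ccontr)
  assume "\<not> ?thesis"
  then have "\<omega> k b = \<one>\<^bsub>Agrp d\<^esub>" if "k \<ge> i" for k
    using that exponent_props[OF \<omega>_Epi assms(1), of k] rotk_one[of d] by (simp add: Agrp_def)
  then have "b \<in> (\<Inter>j\<in>{i..}. kernel (Bgrp d m) (Agrp d) (\<omega> j))"
    using assms by (auto simp: kernel_def)
  moreover have "(\<Inter>j\<in>{i..}. kernel (Bgrp d m) (Agrp d) (\<omega> j)) = {B1}"
    using \<omega> unfolding Omega_def by blast
  ultimately show False using assms by blast
qed

text \<open>Extensionality leaves only finitely many functions on the finite group B. The finiteness
  feeds the pigeonhole arguments on \<open>\<omega>\<close>.\<close>

lemma finite_Epi: "finite (Epi d m)"
proof -
  have "Epi d m \<subseteq> PiE B (\<lambda>_. carrier (Agrp d))"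
    by (auto simp: Epi_def epi_def hom_def PiE_def)
  moreover have "finite (PiE B (\<lambda>_. carrier (Agrp d)))"
    using finite_Bgrp[OF d0] carrier_Agrp[OF d0] by (intro finite_PiE) auto
  ultimately show ?thesis by (rule finite_subset)
qed

section \<open>The elements of B as tree automorphisms\<close>

definition spinal_word :: "nat list \<Rightarrow> nat \<Rightarrow> nat list \<Rightarrow> bool" where
  "spinal_word w r u \<longleftrightarrow> w = replicate r (d - 1) @ 0 # u"

lemma spinal_word_takeWhile: "spinal_word w r u \<Longrightarrow> length (takeWhile (\<lambda>v. v = d - 1) w) = r"
proof -
  have "takeWhile (\<lambda>v. v = d - 1) (replicate r (d - 1) @ 0 # u) = replicate r (d - 1) @ takeWhile (\<lambda>v. v = d - 1) (0 # u)"
    by (rule takeWhile_append2) simp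
  then show "spinal_word w r u \<Longrightarrow> length (takeWhile (\<lambda>v. v = d - 1) w) = r" using d2 by (simp add: spinal_word_def)
qed

lemma sp_spinal_word:
  assumes "b \<in> B" "w \<in> words d" "spinal_word w r u"
  shows "sp b w = replicate r (d - 1) @ 0 # rotk d (exponent d (\<omega> r) b) u"
  using assms spinal_word_takeWhile[OF assms(3)] exponent_props(2)[OF \<omega>_Epi assms(1), of r]
  by (simp add: spin_def spinal_word_def Let_def nth_append)

lemma sp_not_spinal_word:
  assumes "w \<in> words d" "\<nexists>r u. spinal_word w r u"
  shows "sp b w = w"
proof -
  let ?r = "length (takeWhile (\<lambda>v. v = d - 1) w)"
  have "spinal_word w ?r (drop (Suc ?r) w)" if "?r < length w" "w ! ?r = 0"
  proof -
    have "takeWhile (\<lambda>v. v = d - 1) w = replicate ?r (d - 1)"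
      by (metis (mono_tags, lifting) replicate_length_same set_takeWhileD)
    then have "take ?r w = replicate ?r (d - 1)" using takeWhile_eq_take by metis
    then show ?thesis unfolding spinal_word_def using that by (metis id_take_nth_drop)
  qed
  then show ?thesis using assms by (auto simp: spin_def Let_def)
qed

lemma sp_words: 
  assumes "b \<in> B" "w \<in> words d"
  shows "sp b w \<in> words d"
proof (cases "\<exists>r u. spinal_word w r u")
  case True
  then obtain r u where r: "spinal_word w r u" by auto
  then show ?thesis using assms sp_spinal_word[OF assms r] rotk_words[OF d0] by (simp add: spinal_word_def)
qed (use sp_not_spinal_word assms in auto)

text \<open>\<open>sp b\<close> leaves the prefix (d-1)^r 0 intact, so \<open>sp b'\<close> acts at
  the same position and the two rotations add up.\<close>

lemma sp_inverse:
  assumes "b \<in> B" "b' \<in> B" "w \<in> words d" "\<And>r. (exponent d (\<omega> r) b' + exponent d (\<omega> r) b) mod d = 0"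
  shows "sp b' (sp b w) = w"
proof (cases "\<exists>r u. spinal_word w r u")
  case True
  then obtain r u where r: "spinal_word w r u" by auto
  then have u: "u \<in> words d" using assms(3) by (simp add: spinal_word_def)
  have "spinal_word (sp b w) r (rotk d (exponent d (\<omega> r) b) u)" using sp_spinal_word[OF assms(1,3) r] by (simp add: spinal_word_def)
  then have "sp b' (sp b w) = replicate r (d - 1) @ 0 # rotk d (exponent d (\<omega> r) b') (rotk d (exponent d (\<omega> r) b) u)"
    using sp_spinal_word[OF assms(2) sp_words[OF assms(1,3)]] by blast
  also have "rotk d (exponent d (\<omega> r) b') (rotk d (exponent d (\<omega> r) b) u) = u"
    using rotk_rotk[OF d0 u] rotk_mod[OF u] assms(4)[of r] rotk_0[OF u] by metis
  finally show ?thesis using r by (simp add: spinal_word_def)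
qed (use sp_not_spinal_word assms in auto)

lemma sp_snoc:
  assumes "b \<in> B" "w @ [x] \<in> words d"
  shows "is_child (sp b w) (sp b (w @ [x]))"
proof (cases "\<exists>r u. spinal_word w r u")
  case True
  then obtain r u where r: "spinal_word w r u" by auto
  then have "spinal_word (w @ [x]) r (u @ [x])" by (simp add: spinal_word_def)
  moreover have "u @ [x] \<in> words d" using r assms(2) by (simp add: spinal_word_def)
  ultimately show ?thesis using r assms sp_spinal_word[OF assms(1), of w] sp_spinal_word[OF assms] rotk_snoc
    by (auto simp: is_child_def)
next
  case False
  then have w: "sp b w = w" using sp_not_spinal_word assms by auto
  have "sp b (w @ [x]) = w @ [x]"
  proof (cases "\<exists>r u. spinal_word (w @ [x]) r u")
    case True
    then obtain r u where r: "spinal_word (w @ [x]) r u" by auto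
    \<comment> \<open>As \<open>w\<close> is not of spinal form, the 0 is the appended letter
      itself; nothing follows it that could be rotated.\<close>
    have "u = []"
    proof (cases u rule: rev_cases)
      case (snoc v y)
      then have "spinal_word w r v" using r by (simp add: spinal_word_def)
      then show ?thesis using False by blast
    qed
    then show ?thesis using sp_spinal_word[OF assms r] r by (simp add: spinal_word_def)
  qed (use sp_not_spinal_word assms in auto)
  then show ?thesis using w by simp
qed

lemma sp_Aut_tree:
  assumes "b \<in> B"
  shows "sp b \<in> carrier (Aut_tree d)"
proof (rule Aut_treeI[where h = "sp (inv\<^bsub>Bgrp d m\<^esub> b)"])
  have i: "inv\<^bsub>Bgrp d m\<^esub> b \<in> B" using assms by simp
  have "\<nexists>r u. spinal_word [] r u" by (simp add: spinal_word_def)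
  then show "sp b [] = []" "sp (inv\<^bsub>Bgrp d m\<^esub> b) [] = []" using sp_not_spinal_word by auto
  fix w assume w: "w \<in> words d"
  show "sp (inv\<^bsub>Bgrp d m\<^esub> b) (sp b w) = w"
    by (rule sp_inverse[OF assms i w]) (rule exponent_inv[OF \<omega>_Epi assms])
  show "sp b (sp (inv\<^bsub>Bgrp d m\<^esub> b) w) = w"
    by (rule sp_inverse[OF i assms w]) (metis add.commute exponent_inv[OF \<omega>_Epi assms])
qed (use assms sp_words sp_snoc in \<open>auto simp: spin_def\<close>)

lemma sp_inv:
  assumes "b \<in> B"
  shows "inva (sp b) = sp (inv\<^bsub>Bgrp d m\<^esub> b)"
proof -
  have i: "inv\<^bsub>Bgrp d m\<^esub> b \<in> B" using assms by simp
  have "sp (inv\<^bsub>Bgrp d m\<^esub> b) \<otimes>\<^bsub>Aut_tree d\<^esub> sp b = \<one>\<^bsub>Aut_tree d\<^esub>"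
  proof (rule Aut_tree_eqI[of _ d])
    fix w assume w: "w \<in> words d"
    then show "(sp (inv\<^bsub>Bgrp d m\<^esub> b) \<otimes>\<^bsub>Aut_tree d\<^esub> sp b) w = \<one>\<^bsub>Aut_tree d\<^esub> w"
      using sp_inverse[OF assms i w exponent_inv[OF \<omega>_Epi assms]] sp_Aut_tree assms i
      by (simp add: Aut_tree_mult_apply Aut_tree_one)
  qed (use assms i sp_Aut_tree in auto)
  then show ?thesis using Au.inv_equality sp_Aut_tree assms i by metis
qed

text \<open>The word (d-1)^r 0 0 reveals the exponent of \<open>b\<close> under
  \<open>\<omega> r\<close>. Equal exponents for all \<open>r\<close> put the quotient of the two
  elements into every kernel.\<close>

lemma sp_inj: "inj_on sp B"
proof (rule inj_onI)
  fix b b' assume b: "b \<in> B" "b' \<in> B" "sp b = sp b'"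
  have e: "exponent d (\<omega> r) b = exponent d (\<omega> r) b'" for r
  proof -
    let ?w = "replicate r (d - 1) @ 0 # [0]"
    have w: "?w \<in> words d" using d0 words_replicate[of "d - 1" d r] by simp
    have "spinal_word ?w r [0]" by (simp add: spinal_word_def)
    then have "rotk d (exponent d (\<omega> r) b) [0] = rotk d (exponent d (\<omega> r) b') [0]"
      using sp_spinal_word[OF b(1) w] sp_spinal_word[OF b(2) w] b(3) by force
    then show ?thesis using exponent_props(1)[OF \<omega>_Epi b(1)] exponent_props(1)[OF \<omega>_Epi b(2)] d0 by simp
  qed
  have i: "inv\<^bsub>Bgrp d m\<^esub> b' \<in> B" using b by simp
  have "exponent d (\<omega> r) (inv\<^bsub>Bgrp d m\<^esub> b' \<otimes>\<^bsub>Bgrp d m\<^esub> b) = 0" for r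
    using exponent_mult[OF \<omega>_Epi i b(1), of r] exponent_inv[OF \<omega>_Epi b(2), of r] e by simp
  then have "inv\<^bsub>Bgrp d m\<^esub> b' \<otimes>\<^bsub>Bgrp d m\<^esub> b = B1"
    using ker_late[of "inv\<^bsub>Bgrp d m\<^esub> b' \<otimes>\<^bsub>Bgrp d m\<^esub> b" 0] i b by (metis Bg.m_closed)
  then show "b = b'" using i b by (metis Bg.inv_comm Bg.inv_equality Bg.inv_inv)
qed

lemma sp_one: "sp B1 = \<one>\<^bsub>Aut_tree d\<^esub>"
proof (rule Aut_tree_eqI)
  fix w assume w: "w \<in> words d"
  show "sp B1 w = \<one>\<^bsub>Aut_tree d\<^esub> w"
  proof (cases "\<exists>r u. spinal_word w r u")
    case True
    then obtain r u where r: "spinal_word w r u" by auto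
    then have "u \<in> words d" using w by (simp add: spinal_word_def)
    then show ?thesis using sp_spinal_word[OF _ w r, of B1] exponent_one[OF \<omega>_Epi] rotk_0 r w
      by (simp add: Aut_tree_one spinal_word_def)
  qed (use sp_not_spinal_word w in \<open>auto simp: Aut_tree_one\<close>)
qed (use sp_Aut_tree in auto)

text \<open>B fixes words of length one while nontrivial rotations move them. Hence A and B meet
  trivially, and a label tells from which of the two it comes.\<close>

lemma sp_ne_rotk:
  assumes "b \<in> B" "rotk d j = sp b"
  shows "rotk d j = \<one>\<^bsub>Aut_tree d\<^esub>"
proof -
  have "spinal_word [0] 0 []" by (simp add: spinal_word_def)
  then have "sp b [0] = [0]" using sp_spinal_word[OF assms(1), of "[0]" 0 "[]"] d0 by simp
  then have "rotk d j [0] = [0]" using assms by simp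
  then have "j mod d = 0" using d0 by simp
  then show ?thesis using rotk_eq_iff[OF d0, of j 0] by (simp add: rotk_one)
qed

lemma S_cases:
  assumes "s \<in> S"
  obtains j where "0 < j" "j < d" "s = rotk d j" | b where "b \<in> B" "b \<noteq> B1" "s = sp b"
proof -
  have "s \<in> rotk d ` {..<d} \<union> sp ` B" "s \<noteq> \<one>\<^bsub>Aut_tree d\<^esub>" using assms carrier_Agrp[OF d0] by (auto simp: spinal_gens_def)
  then show ?thesis using that sp_one rotk_one by (auto) (metis neq0_conv)
qed

lemma rotk_S: "0 < j \<Longrightarrow> j < d \<Longrightarrow> rotk d j \<in> S"
  using carrier_Agrp[OF d0] rotk_eq_iff[OF d0, of j 0] by (auto simp: spinal_gens_def rotk_one)

lemma sp_S: "b \<in> B \<Longrightarrow> b \<noteq> B1 \<Longrightarrow> sp b \<in> S"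
  using sp_inj sp_one by (auto simp: spinal_gens_def inj_on_def)

lemma S_Aut_tree: "s \<in> S \<Longrightarrow> s \<in> carrier (Aut_tree d)"
  using rotk_Aut_tree[OF d0] sp_Aut_tree by (auto elim!: S_cases)

lemma finite_S: "finite S"
  using finite_Bgrp[OF d0] carrier_Agrp[OF d0] by (auto simp: spinal_gens_def)

lemma inva_S: 
  assumes "s \<in> S"
  shows "inva s \<in> S"
proof -
  have "inva s \<noteq> \<one>\<^bsub>Aut_tree d\<^esub>" using assms S_Aut_tree[OF assms] by (auto simp: spinal_gens_def)
  moreover have "inva s \<in> carrier (Agrp d) \<union> sp ` B"
    using assms
  proof (rule S_cases)
    fix j assume "s = rotk d j"
    then have "inva s = rotk d (((d - 1) * j) mod d)" using rotk_inv[OF d0] rotk_mod_eq by simp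
    then show ?thesis using carrier_Agrp[OF d0] d0 by simp
  qed (use sp_inv in auto)
  ultimately show ?thesis by (simp add: spinal_gens_def)
qed

section \<open>The elements of B acting on rays\<close>

lemma boundary_act_sp_active:
  assumes b: "b \<in> B" and \<xi>: "\<xi> \<in> boundary d" and p: "active_at d k \<xi>"
  shows "boundary_act (sp b) \<xi> = \<xi>(Suc k := (\<xi> (Suc k) + exponent d (\<omega> k) b) mod d)"
proof
  fix n
  let ?w = "map \<xi> [0..<Suc n]"
  have w: "?w \<in> words d" by (rule map_ray_words[OF \<xi>])
  show "boundary_act (sp b) \<xi> n = (\<xi>(Suc k := (\<xi> (Suc k) + exponent d (\<omega> k) b) mod d)) n"
  proof (cases "k \<le> n")
    case False
    \<comment> \<open>All letters of this prefix equal \<open>d - 1\<close>, which is not 0, so it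
      ends before the active position.\<close>
    have "\<nexists>r u. spinal_word ?w r u"
    proof
      assume "\<exists>r u. spinal_word ?w r u"
      then obtain r u where r: "spinal_word ?w r u" by blast
      then have l: "length ?w = r + Suc (length u)" by (simp add: spinal_word_def del: upt_Suc)
      then have rn: "r \<le> n" by (simp del: upt_Suc)
      have "?w ! r = 0" using r by (simp add: spinal_word_def nth_append del: upt_Suc)
      moreover have "?w ! r = \<xi> r" using rn by (metis add_0 le_imp_less_Suc length_map length_upt minus_nat.diff_0 nth_map nth_upt)
      moreover have "\<xi> r = d - 1" using p False rn by (simp add: active_at_def)
      ultimately show False using d2 by simp
    qed
    then have "sp b ?w = ?w" using sp_not_spinal_word w by blast
    then show ?thesis using False by (simp add: boundary_act_def nth_append)
  next
    case True
    have "[0..<Suc n] = [0..<k] @ k # [Suc k..<Suc n]"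
      using True upt_add_eq_append[of 0 k "Suc n - k"] by (simp add: upt_conv_Cons del: upt_Suc)
    moreover have "map \<xi> [0..<k] = replicate k (d - 1)" using p by (intro nth_equalityI) (auto simp: active_at_def)
    ultimately have sf: "spinal_word ?w k (map \<xi> [Suc k..<Suc n])" using p by (simp add: spinal_word_def active_at_def del: upt_Suc)
    have eq: "sp b ?w = replicate k (d - 1) @ 0 # rotk d (exponent d (\<omega> k) b) (map \<xi> [Suc k..<Suc n])"
      by (rule sp_spinal_word[OF b w sf])
    have u: "map \<xi> [Suc k..<Suc n] \<in> words d" by (rule map_ray_words[OF \<xi>])
    show ?thesis
    proof (cases "k = n")
      case True
      then show ?thesis using eq p by (simp add: boundary_act_def nth_append active_at_def del: upt_Suc)
    next
      case False
      then have *: "map \<xi> [Suc k..<Suc n] = \<xi> (Suc k) # map \<xi> [Suc (Suc k)..<Suc n]" using True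
        by (simp add: upt_conv_Cons del: upt_Suc)
      have "rotk d (exponent d (\<omega> k) b) (map \<xi> [Suc k..<Suc n]) =
          ((\<xi> (Suc k) + exponent d (\<omega> k) b) mod d) # map \<xi> [Suc (Suc k)..<Suc n]"
        using u unfolding * by (rule rotk_Cons)
      then have "boundary_act (sp b) \<xi> n = (((\<xi> (Suc k) + exponent d (\<omega> k) b) mod d) # map \<xi> [Suc (Suc k)..<Suc n]) ! (n - Suc k)"
        using eq True False by (simp add: boundary_act_def nth_append nth_Cons' del: upt_Suc)
      moreover have "Suc (Suc (n - 2)) = n" if "n \<noteq> Suc k" using that True False by simp
      ultimately show ?thesis using True False by (auto simp: nth_Cons' simp del: upt_Suc)
    qed
  qed
qed

lemma boundary_act_sp_not_active:
  assumes \<xi>: "\<xi> \<in> boundary d" and p: "\<nexists>k. active_at d k \<xi>"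
  shows "boundary_act (sp b) \<xi> = \<xi>"
proof
  fix n
  let ?w = "map \<xi> [0..<Suc n]"
  have w: "?w \<in> words d" by (rule map_ray_words[OF \<xi>])
  have "\<nexists>r u. spinal_word ?w r u"
  proof
    assume "\<exists>r u. spinal_word ?w r u"
    then obtain r u where r: "spinal_word ?w r u" by blast
    then have "length ?w = r + Suc (length u)" by (simp add: spinal_word_def del: upt_Suc)
    then have rn: "r \<le> n" by (simp del: upt_Suc)
    have nth: "i \<le> n \<Longrightarrow> ?w ! i = \<xi> i" for i by (metis add_0 le_imp_less_Suc length_map length_upt minus_nat.diff_0 nth_map nth_upt)
    have "?w ! r = 0" "\<And>i. i < r \<Longrightarrow> ?w ! i = d - 1" using r by (auto simp add: spinal_word_def nth_append simp del: upt_Suc)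
    then have "active_at d r \<xi>" using nth rn by (simp add: active_at_def del: upt_Suc)
    then show False using p by blast
  qed
  then have "sp b ?w = ?w" using sp_not_spinal_word w by blast
  then show "boundary_act (sp b) \<xi> n = \<xi> n" by (simp add: boundary_act_def nth_append)
qed

end


section \<open>The action on rays\<close>

definition same_prefix :: "nat \<Rightarrow> (nat \<Rightarrow> nat) \<Rightarrow> (nat \<Rightarrow> nat) \<Rightarrow> bool" where
  "same_prefix N \<xi> \<eta> \<longleftrightarrow> (\<forall>i<N. \<xi> i = \<eta> i)"

lemma same_prefix_refl [simp]: "same_prefix N \<xi> \<xi>" by (simp add: same_prefix_def)

lemma same_prefix_mono: "same_prefix N \<xi> \<eta> \<Longrightarrow> M \<le> N \<Longrightarrow> same_prefix M \<xi> \<eta>" by (simp add: same_prefix_def)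

lemma active_at_same_prefix: "same_prefix (Suc k) \<xi> \<eta> \<Longrightarrow> active_at d k \<xi> \<longleftrightarrow> active_at d k \<eta>"
  by (auto simp: same_prefix_def active_at_def)

lemma Cof_boundary: "y \<in> Cof d \<xi> \<Longrightarrow> y \<in> boundary d"
  by (simp add: Cof_def)

lemma Cof_refl: "\<xi> \<in> boundary d \<Longrightarrow> \<xi> \<in> Cof d \<xi>"
  by (simp add: Cof_def)

lemma Cof_trans: "y \<in> Cof d \<xi> \<Longrightarrow> z \<in> Cof d y \<Longrightarrow> z \<in> Cof d \<xi>"
  unfolding Cof_def
  by (auto elim!: rev_finite_subset[OF finite_UnI[of "{n. y n \<noteq> \<xi> n}" "{n. z n \<noteq> y n}"]])

lemma Cof_sym: "y \<in> Cof d \<xi> \<Longrightarrow> \<xi> \<in> boundary d \<Longrightarrow> \<xi> \<in> Cof d y"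
  by (simp add: Cof_def eq_commute)

text \<open>These finite sets exhaust \<open>Cof d \<xi>\<close> as \<open>N\<close> grows. They
  serve as the blocks of the orbit in the connectivity proofs and as the finite sets deleted when
  ends are counted.\<close>

definition same_tail :: "nat \<Rightarrow> nat \<Rightarrow> (nat \<Rightarrow> nat) \<Rightarrow> (nat \<Rightarrow> nat) set" where
  "same_tail d N \<xi> = {\<eta> \<in> boundary d. \<forall>i\<ge>N. \<eta> i = \<xi> i}"

lemma Cof_same_tail: "Cof d \<xi> = (\<Union>N. same_tail d N \<xi>)"
proof -
  have "(\<exists>N. \<forall>i\<ge>N. \<eta> i = \<xi> i) \<longleftrightarrow> finite {n. \<eta> n \<noteq> \<xi> n}" for \<eta>
  proof
    assume "\<exists>N. \<forall>i\<ge>N. \<eta> i = \<xi> i"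
    then obtain N where "\<forall>i\<ge>N. \<eta> i = \<xi> i" by blast
    then have "{n. \<eta> n \<noteq> \<xi> n} \<subseteq> {..<N}" using not_le by auto
    then show "finite {n. \<eta> n \<noteq> \<xi> n}" using finite_subset by blast
  next
    assume "finite {n. \<eta> n \<noteq> \<xi> n}"
    then obtain N where "\<forall>n\<in>{n. \<eta> n \<noteq> \<xi> n}. n < N" using finite_nat_set_iff_bounded by blast
    then show "\<exists>N. \<forall>i\<ge>N. \<eta> i = \<xi> i" using not_le by auto
  qed
  then show ?thesis by (auto simp: Cof_def same_tail_def)
qed

lemma finite_same_tail: "finite (same_tail d N \<xi>)"
proof -
  have "same_tail d N \<xi> \<subseteq> (\<lambda>f i. if i < N then f i else \<xi> i) ` (PiE {..<N} (\<lambda>_. {..<d}))"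
  proof
    fix \<eta> assume "\<eta> \<in> same_tail d N \<xi>"
    then have "\<eta> = (\<lambda>i. if i < N then restrict \<eta> {..<N} i else \<xi> i)"
      "restrict \<eta> {..<N} \<in> PiE {..<N} (\<lambda>_. {..<d})" by (auto simp: same_tail_def boundary_def)
    then show "\<eta> \<in> (\<lambda>f i. if i < N then f i else \<xi> i) ` (PiE {..<N} (\<lambda>_. {..<d}))" by blast
  qed
  moreover have "finite (PiE {..<N} (\<lambda>_. {..<d}))" by (intro finite_PiE) auto
  ultimately show ?thesis using finite_surj by blast
qed

lemma countable_Cof: "countable (Cof d \<xi>)"
  unfolding Cof_same_tail using finite_same_tail by (intro countable_UN) (auto intro: countable_finite)

context spinal
begin

sublocale labels S "\<lambda>s. inv\<^bsub>Aut_tree d\<^esub> s"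
  by unfold_locales (rule inva_S)

abbreviation "X \<equiv> boundary d"
abbreviation "bact \<equiv> boundary_act"
abbreviation "ray \<equiv> last_ray d"
abbreviation "ray_code \<equiv> code S boundary_act"

lemma ray_X [simp]: "ray \<in> X" using d0 by (simp add: boundary_def last_ray_def)

lemma X_lt: "\<xi> \<in> X \<Longrightarrow> \<xi> n < d" by (simp add: boundary_def)

lemma bact_X: "s \<in> S \<Longrightarrow> \<xi> \<in> X \<Longrightarrow> bact s \<xi> \<in> X"
  using boundary_act_closed S_Aut_tree by blast

lemma not_active_at_ray: "\<not> active_at d k ray" using d2 by (simp add: active_at_def last_ray_def)

lemma bact_inva: 
  assumes "s \<in> S" "\<xi> \<in> X"
  shows "bact (inva s) (bact s \<xi>) = \<xi>" "bact s (bact (inva s) \<xi>) = \<xi>"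
proof -
  have s: "s \<in> carrier (Aut_tree d)" "inva s \<in> carrier (Aut_tree d)" using assms S_Aut_tree by auto
  show "bact (inva s) (bact s \<xi>) = \<xi>" "bact s (bact (inva s) \<xi>) = \<xi>"
    using boundary_act_mult[OF s assms(2)] boundary_act_mult[OF s(2,1) assms(2)] s(1)
      boundary_act_one[OF assms(2)] by auto
qed

lemma bact_Cof1:
  assumes "s \<in> S" "\<xi> \<in> X"
  shows "bact s \<xi> \<in> Cof d \<xi>"
proof -
  have *: "finite {n. (\<xi>(k := a)) n \<noteq> \<xi> n}" for k a
    by (rule finite_subset[of _ "{k}"]) auto
  have "finite {n. bact s \<xi> n \<noteq> \<xi> n}"
    using assms(1)
  proof (cases rule: S_cases)
    case (1 j)
    then show ?thesis using * boundary_act_rotk[OF assms(2)] by simp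
  next
    case (2 b)
    show ?thesis
    proof (cases "\<exists>k. active_at d k \<xi>")
      case True
      then obtain k where "active_at d k \<xi>" by blast
      then show ?thesis using * boundary_act_sp_active[OF 2(1) assms(2)] 2(3) by presburger
    next
      case False
      then show ?thesis using boundary_act_sp_not_active[OF assms(2)] 2(3) by simp
    qed
  qed
  then show ?thesis using bact_X assms by (simp add: Cof_def)
qed

lemma action_X: "action X bact"
  unfolding action_def using bact_X bact_inva by blast

lemma action_Cof: "\<xi> \<in> X \<Longrightarrow> action (Cof d \<xi>) bact"
proof -
  have "bact s y \<in> Cof d \<xi>" if "s \<in> S" "y \<in> Cof d \<xi>" for s y
    using Cof_trans[OF that(2) bact_Cof1[OF that(1) Cof_boundary[OF that(2)]]] .
  then show ?thesis unfolding action_def using Cof_boundary bact_inva by blast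
qed

lemma fold_X: "ws \<in> lists S \<Longrightarrow> \<xi> \<in> X \<Longrightarrow> fold bact ws \<xi> \<in> X"
  by (rule fold_closed[OF action_X])

text \<open>Steps are confined to \<open>W\<close>, so that the same relation describes whole orbits
  and what remains of them after deleting a finite block.\<close>

definition stepR :: "(nat \<Rightarrow> nat) set \<Rightarrow> ((nat \<Rightarrow> nat) \<times> (nat \<Rightarrow> nat)) set" where
  "stepR W = {(y, bact s y) | y s. s \<in> S \<and> y \<in> W \<and> bact s y \<in> W}"

lemma stepRI: "s \<in> S \<Longrightarrow> y \<in> W \<Longrightarrow> bact s y = z \<Longrightarrow> z \<in> W \<Longrightarrow> (y, z) \<in> stepR W"
  by (auto simp: stepR_def)

lemma stepR_mono: "W \<subseteq> W' \<Longrightarrow> (x, y) \<in> (stepR W)\<^sup>* \<Longrightarrow> (x, y) \<in> (stepR W')\<^sup>*"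
  by (rule rtrancl_mono[THEN subsetD]) (auto simp: stepR_def)

lemma stepR_words: "(x, y) \<in> (stepR W)\<^sup>* \<Longrightarrow> \<exists>ws\<in>lists S. fold bact ws x = y"
proof (induction rule: rtrancl_induct)
  case base
  show ?case by (rule bexI[of _ "[]"]) auto
next
  case (step y z)
  then obtain ws s where "ws \<in> lists S" "fold bact ws x = y" "s \<in> S" "z = bact s y" by (auto simp: stepR_def)
  then show ?case by (intro bexI[of _ "ws @ [s]"]) auto
qed

lemma stepR_rotate:
  assumes "\<xi> \<in> W" "\<xi>(0 := a) \<in> W" "W \<subseteq> X"
  shows "(\<xi>, \<xi>(0 := a)) \<in> (stepR W)\<^sup>*"
proof (cases "\<xi> 0 = a")
  case False
  \<comment> \<open>The residue of \<open>a - \<xi> 0\<close>, written so that natural subtraction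
    does not truncate.\<close>
  let ?j = "(a + (d - \<xi> 0)) mod d"
  have lt: "\<xi> 0 < d" "a < d" using assms X_lt[of \<xi> 0] X_lt[of "\<xi>(0 := a)" 0] by auto
  have "(\<xi> 0 + ?j) mod d = (a + d) mod d" using lt by (simp add: mod_simps)
  then have a: "(\<xi> 0 + ?j) mod d = a" using lt by simp
  have "?j \<noteq> 0" using a False lt by (metis add.right_neutral mod_less)
  then have "rotk d ?j \<in> S" using rotk_S d0 by simp
  moreover have "bact (rotk d ?j) \<xi> = \<xi>(0 := a)" using boundary_act_rotk[of \<xi> d ?j] a assms by auto
  ultimately show ?thesis using stepRI assms(1,2) by blast
qed auto

lemma stepR_spin:
  assumes "\<xi> \<in> W" "\<xi>(Suc k := a) \<in> W" "W \<subseteq> X" "active_at d k \<xi>"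
  shows "(\<xi>, \<xi>(Suc k := a)) \<in> (stepR W)\<^sup>*"
proof (cases "\<xi> (Suc k) = a")
  case False
  let ?j = "(a + (d - \<xi> (Suc k))) mod d"
  have lt: "\<xi> (Suc k) < d" "a < d" using assms X_lt[of \<xi> "Suc k"] X_lt[of "\<xi>(Suc k := a)" "Suc k"] by auto
  have "(\<xi> (Suc k) + ?j) mod d = (a + d) mod d" using lt by (simp add: mod_simps)
  then have a: "(\<xi> (Suc k) + ?j) mod d = a" using lt by simp
  have j0: "?j \<noteq> 0" using a False lt by (metis add.right_neutral mod_less)
  obtain b where b: "b \<in> B" "exponent d (\<omega> k) b = ?j" using exponent_surj[OF \<omega>_Epi, of ?j k] d0 by auto
  then have "b \<noteq> B1" using exponent_one[OF \<omega>_Epi] j0 by metis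
  then have "sp b \<in> S" using sp_S b by blast
  moreover have "bact (sp b) \<xi> = \<xi>(Suc k := a)" using boundary_act_sp_active[OF b(1) _ assms(4)] assms a b(2) by auto
  ultimately show ?thesis using stepRI assms(1,2) by blast
qed auto

text \<open>A block is made of \<open>d\<close> smaller blocks, one for each value of its last free
  letter. To change that letter, walk inside a smaller block to the vertex where B acts on it,
  change it, and continue inside the new smaller block.\<close>

lemma block_connected:
  "\<xi> \<in> X \<Longrightarrow> \<eta> \<in> same_tail d k \<xi> \<Longrightarrow> (\<xi>, \<eta>) \<in> (stepR (same_tail d k \<xi>))\<^sup>*"
proof (induction k arbitrary: \<xi> \<eta>)
  case 0
  then have "\<eta> = \<xi>" by (auto simp: same_tail_def)
  then show ?case by simp
next
  case (Suc k)
  let ?W = "same_tail d (Suc k) \<xi>"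
  have WX: "?W \<subseteq> X" and mem: "\<xi> \<in> ?W" using Suc.prems by (auto simp: same_tail_def)
  show ?case
  proof (cases k)
    case 0
    then have e: "\<eta> = \<xi>(0 := \<eta> 0)" using Suc.prems by (auto simp: same_tail_def fun_eq_iff Suc_le_eq)
    then have "\<xi>(0 := \<eta> 0) \<in> ?W" using Suc.prems by simp
    from stepR_rotate[OF mem this WX] e show ?thesis by simp
  next
    case (Suc k')
    \<comment> \<open>This vertex is active at \<open>k'\<close>, so B rotates letter
      \<open>Suc k'\<close>, which is letter \<open>k\<close>.\<close>
    let ?c = "\<lambda>i. if i < k' then d - 1 else if i = k' then 0 else \<xi> i"
    let ?c' = "?c(Suc k' := \<eta> k)"
    have \<eta>: "\<eta> \<in> X" "\<And>i. i \<ge> Suc k \<Longrightarrow> \<eta> i = \<xi> i" using Suc.prems by (auto simp: same_tail_def)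
    have c: "?c \<in> same_tail d k \<xi>" using Suc Suc.prems d0 by (auto simp: same_tail_def boundary_def)
    have sub: "same_tail d k \<xi> \<subseteq> ?W" by (auto simp: same_tail_def)
    have c': "?c' \<in> ?W" using Suc Suc.prems d0 by (auto simp: same_tail_def boundary_def)
    have c'X: "?c' \<in> X" using c' WX by blast
    have sub': "same_tail d k ?c' \<subseteq> ?W" using Suc \<eta> by (auto simp: same_tail_def)
    have m: "\<eta> \<in> same_tail d k ?c'" using Suc \<eta> by (auto simp: same_tail_def Suc_le_eq not_less)
    have "(\<xi>, ?c) \<in> (stepR ?W)\<^sup>*" using stepR_mono[OF sub Suc.IH[OF Suc.prems(1) c]] .
    also have "(?c, ?c') \<in> (stepR ?W)\<^sup>*"
      using c sub c' WX by (intro stepR_spin) (auto simp: active_at_def)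
    also have "(?c', \<eta>) \<in> (stepR ?W)\<^sup>*" using stepR_mono[OF sub' Suc.IH[OF c'X m]] .
    finally show ?thesis .
  qed
qed

lemma Cof_words:
  assumes "\<xi> \<in> X" "y \<in> Cof d \<xi>"
  shows "\<exists>ws\<in>lists S. fold bact ws \<xi> = y"
  using assms block_connected stepR_words unfolding Cof_same_tail by blast

lemma trans_action_Cof: "\<xi> \<in> X \<Longrightarrow> y \<in> Cof d \<xi> \<Longrightarrow> trans_action (Cof d \<xi>) bact y"
  unfolding trans_action_def
  using action_Cof Cof_words[OF Cof_boundary, of y] Cof_trans[OF Cof_sym, of y] by blast

lemma gen_cases: "h \<in> carrier (Agrp d) \<union> sp ` B \<Longrightarrow> h = \<one>\<^bsub>Aut_tree d\<^esub> \<or> h \<in> S"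
  by (auto simp: spinal_gens_def)

text \<open>A generator changes at most one letter, so orbits stay inside cofinality classes;
  \<open>block_connected\<close> makes them fill the class.\<close>

lemma orbit_eq_Cof:
  assumes \<xi>: "\<xi> \<in> X"
  shows "(\<lambda>g. bact g \<xi>) ` spinal_group d m \<omega> = Cof d \<xi>"
proof -
  have "g \<in> carrier (Aut_tree d) \<and> (\<forall>\<xi>\<in>X. bact g \<xi> \<in> Cof d \<xi>)" if "g \<in> spinal_group d m \<omega>" for g
    using that unfolding spinal_group_def
  proof induction
    case one
    then show ?case using boundary_act_one Cof_refl by auto
  next
    case (incl h)
    then have "h = \<one>\<^bsub>Aut_tree d\<^esub> \<or> h \<in> S" by (rule gen_cases)
    then show ?case using boundary_act_one Cof_refl S_Aut_tree bact_Cof1 by auto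
  next
    case (inv h)
    then have "inva h = \<one>\<^bsub>Aut_tree d\<^esub> \<or> inva h \<in> S" using gen_cases inva_S by fastforce
    then show ?case using boundary_act_one Cof_refl S_Aut_tree bact_Cof1 by auto
  next
    case (eng g h)
    have "bact (g \<otimes>\<^bsub>Aut_tree d\<^esub> h) \<xi> \<in> Cof d \<xi>" if "\<xi> \<in> X" for \<xi>
    proof -
      have h: "bact h \<xi> \<in> Cof d \<xi>" using eng that by blast
      then have "bact g (bact h \<xi>) \<in> Cof d (bact h \<xi>)" using eng Cof_boundary by blast
      then show ?thesis using boundary_act_mult[of g d h \<xi>] eng that Cof_trans[OF h] by auto
    qed
    then show ?case using eng by auto
  qed
  moreover have "\<exists>g\<in>spinal_group d m \<omega>. g \<in> carrier (Aut_tree d) \<and> (\<forall>\<xi>\<in>X. fold bact ws \<xi> = bact g \<xi>)"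
    if "ws \<in> lists S" for ws
    using that
  proof (induction ws rule: rev_induct)
    case Nil
    have "\<one>\<^bsub>Aut_tree d\<^esub> \<in> spinal_group d m \<omega>" unfolding spinal_group_def by (rule generate.one)
    then show ?case using boundary_act_one by force
  next
    case (snoc s ws)
    then obtain g where g: "g \<in> spinal_group d m \<omega>" "g \<in> carrier (Aut_tree d)"
      "\<forall>\<xi>\<in>X. fold bact ws \<xi> = bact g \<xi>" by auto
    have s: "s \<in> S" "s \<in> carrier (Aut_tree d)" using snoc.prems S_Aut_tree by auto
    have "s \<in> spinal_group d m \<omega>" unfolding spinal_group_def
      by (rule generate.incl) (use s in \<open>simp add: spinal_gens_def\<close>)
    then have "s \<otimes>\<^bsub>Aut_tree d\<^esub> g \<in> spinal_group d m \<omega>"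
      using g unfolding spinal_group_def by (intro generate.eng)
    moreover have "fold bact (ws @ [s]) \<xi> = bact (s \<otimes>\<^bsub>Aut_tree d\<^esub> g) \<xi>" if "\<xi> \<in> X" for \<xi>
      using boundary_act_mult[OF s(2) g(2) that] g that by simp
    ultimately show ?case using s g by blast
  qed
  ultimately show ?thesis using Cof_words[OF \<xi>] \<xi> by (fastforce simp: image_iff)
qed

lemma Schreier_action_graph: "\<xi> \<in> X \<Longrightarrow> Schreier d m \<omega> \<xi> = action_graph S (Cof d \<xi>) bact"
  by (simp add: Schreier_def orbit_eq_Cof action_graph_def Let_def)

lemma Sch_points:
  assumes "\<xi> \<in> X"
  shows "Sch d m \<omega> \<xi> \<in> points" "class_code (Sch d m \<omega> \<xi>) = ray_code \<xi>"
  using points_of_action[OF trans_action_Cof[OF assms Cof_refl[OF assms]] countable_Cof]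
  unfolding Sch_def Schreier_action_graph[OF assms] by auto


subsection \<open>Separating words\<close>

text \<open>What \<open>s\<close> adds to letter \<open>n\<close> depends on the letters before
  \<open>n\<close> only. Hence the difference at a first point of disagreement is an invariant of
  the pair of rays.\<close>

lemma bact_diff:
  assumes s: "s \<in> S" and X: "\<xi> \<in> X" "\<eta> \<in> X" and e: "same_prefix n \<xi> \<eta>"
  shows "same_prefix n (bact s \<xi>) (bact s \<eta>) \<and>
    (int (bact s \<xi> n) - int (bact s \<eta> n)) mod int d = (int (\<xi> n) - int (\<eta> n)) mod int d"
  using s
proof (cases rule: S_cases)
  case (1 j)
  then show ?thesis using e boundary_act_rotk[OF X(1)] boundary_act_rotk[OF X(2)]
    by (auto simp: same_prefix_def zmod_int mod_simps)
next
  case (2 b)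
  show ?thesis
  proof (cases "\<exists>k<n. active_at d k \<xi>")
    case True
    then obtain k where k: "k < n" "active_at d k \<xi>" by blast
    then have "active_at d k \<eta>" using active_at_same_prefix[OF same_prefix_mono[OF e]] by (simp add: Suc_le_eq)
    then show ?thesis using 2 e k boundary_act_sp_active[OF 2(1) X(1)] boundary_act_sp_active[OF 2(1) X(2)]
      by (auto simp: same_prefix_def zmod_int mod_simps)
  next
    case False
    \<comment> \<open>An active position, if there is one, is at least \<open>n\<close>, so only a
      letter beyond \<open>n\<close> can change.\<close>
    have unch: "bact s \<zeta> i = \<zeta> i" if "\<zeta> \<in> X" "same_prefix n \<xi> \<zeta>" "i \<le> n" for \<zeta> i
    proof (cases "\<exists>k. active_at d k \<zeta>")
      case True
      then obtain k where k: "active_at d k \<zeta>" by blast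
      then have "\<not> k < n" using active_at_same_prefix[OF same_prefix_mono[OF that(2)], of k] False by (metis Suc_le_eq)
      then show ?thesis using boundary_act_sp_active[OF 2(1) that(1) k] 2(3) that by auto
    qed (use 2 boundary_act_sp_not_active[OF that(1)] in auto)
    then show ?thesis using unch[OF X(1)] unch[OF X(2) e] e by (auto simp: same_prefix_def)
  qed
qed

lemma fold_diff:
  assumes "same_prefix n \<xi> \<eta>" "\<xi> \<in> X" "\<eta> \<in> X" "ws \<in> lists S"
  shows "same_prefix n (fold bact ws \<xi>) (fold bact ws \<eta>) \<and>
    (int (fold bact ws \<xi> n) - int (fold bact ws \<eta> n)) mod int d = (int (\<xi> n) - int (\<eta> n)) mod int d"
  using assms
proof (induction ws arbitrary: \<xi> \<eta>)
  case (Cons s ws)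
  then have s: "s \<in> S" "ws \<in> lists S" by auto
  then show ?case using Cons.IH[of "bact s \<xi>" "bact s \<eta>"] bact_diff[OF s(1) Cons.prems(2,3,1)]
      bact_X[OF s(1)] Cons.prems by auto
qed auto

lemma words_to_active_at:
  assumes "\<eta> \<in> X"
  shows "\<exists>ws\<in>lists S. active_at d k (fold bact ws \<eta>)"
proof -
  let ?y = "\<lambda>i. if i < k then d - 1 else if i = k then 0 else \<eta> i"
  have "?y \<in> same_tail d (Suc k) \<eta>" using assms d0 by (auto simp: same_tail_def boundary_def)
  then obtain ws where "ws \<in> lists S" "fold bact ws \<eta> = ?y"
    using Cof_words[OF assms, of ?y] unfolding Cof_same_tail by blast
  then show ?thesis by (intro bexI[of _ ws]) (auto simp: active_at_def)
qed

text \<open>The exclusive or is asked for all pairs of nearby rays, which makes membership constant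
  around each of the two rays. This uniformity is what survives a passage to limits.\<close>

definition separates :: "(nat list \<Rightarrow> nat list) list \<Rightarrow> nat \<Rightarrow> (nat \<Rightarrow> nat) \<Rightarrow> (nat \<Rightarrow> nat) \<Rightarrow> bool" where
  "separates ws N \<xi> \<eta> \<longleftrightarrow> ws \<in> lists S \<and> (\<forall>\<xi>'\<in>X. \<forall>\<eta>'\<in>X. same_prefix N \<xi> \<xi>' \<longrightarrow> same_prefix N \<eta> \<eta>' \<longrightarrow>
     (ws \<in> ray_code \<xi>' \<longleftrightarrow> ws \<notin> ray_code \<eta>'))"

lemma separates_sym: "separates ws N \<xi> \<eta> \<Longrightarrow> separates ws N \<eta> \<xi>"
  unfolding separates_def by blast

lemma conj_ray_code_iff: "\<xi> \<in> X \<Longrightarrow> ws \<in> lists S \<Longrightarrow> s \<in> S \<Longrightarrow>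
  ws @ [s] @ ivw ws \<in> ray_code \<xi> \<longleftrightarrow> bact s (fold bact ws \<xi>) = fold bact ws \<xi>"
  using conj_code_iff[OF action_X, of \<xi> ws "[s]"] by simp

text \<open>The word conjugates \<open>b\<close>: it takes \<open>\<eta>\<close> to a ray moved by \<open>b\<close>, and \<open>\<xi>\<close> to one fixed by \<open>b\<close>.\<close>
lemma separates_core:
  assumes X: "\<xi> \<in> X" "\<eta> \<in> X" and ws: "ws \<in> lists S" and b: "b \<in> B"
    and \<eta>: "active_at d k (fold bact ws \<eta>)" "exponent d (\<omega> k) b \<noteq> 0"
    and \<xi>: "\<And>i. i < n \<Longrightarrow> fold bact ws \<xi> i = d - 1" "fold bact ws \<xi> n \<noteq> d - 1"
      "fold bact ws \<xi> n = 0 \<Longrightarrow> exponent d (\<omega> n) b = 0"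
  shows "\<exists>ws N. separates ws N \<xi> \<eta>"
proof -
  \<comment> \<open>The letters up to \<open>n\<close> show that \<open>b\<close> fixes the image of
    the first ray, and the letters up to \<open>k\<close> that it moves the image of the
    second.\<close>
  let ?N = "max (Suc n) (Suc k)" and ?w = "ws @ [sp b] @ ivw ws"
  have "b \<noteq> B1" using \<eta>(2) exponent_one[OF \<omega>_Epi] by metis
  then have bS: "sp b \<in> S" using b sp_S by blast
  have "?w \<in> ray_code \<xi>'" if \<xi>': "\<xi>' \<in> X" "same_prefix ?N \<xi> \<xi>'" for \<xi>'
  proof -
    let ?z = "fold bact ws \<xi>'"
    have zX: "?z \<in> X" by (rule fold_X[OF ws \<xi>'(1)])
    have "same_prefix ?N (fold bact ws \<xi>) ?z" using fold_diff[OF \<xi>'(2) X(1) \<xi>'(1) ws] by blast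
    then have z: "\<And>i. i < n \<Longrightarrow> ?z i = d - 1" "?z n \<noteq> d - 1" "?z n = 0 \<Longrightarrow> exponent d (\<omega> n) b = 0"
      using \<xi> by (auto simp: same_prefix_def) 
    have "bact (sp b) ?z = ?z"
    proof (cases "\<exists>k. active_at d k ?z")
      case True
      then obtain l where l: "active_at d l ?z" by blast
      have "\<not> l < n" using z(1)[of l] l d2 by (auto simp: active_at_def)
      moreover have "\<not> n < l" using z(2) l by (auto simp: active_at_def)
      ultimately have "l = n" by simp
      then have "exponent d (\<omega> l) b = 0" using z(3) l by (simp add: active_at_def)
      then show ?thesis using boundary_act_sp_active[OF b zX l] X_lt[OF zX] by simp
    qed (use boundary_act_sp_not_active[OF zX] in blast)
    then show ?thesis using conj_ray_code_iff[OF \<xi>'(1) ws bS] by blast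
  qed
  moreover have "?w \<notin> ray_code \<eta>'" if \<eta>': "\<eta>' \<in> X" "same_prefix ?N \<eta> \<eta>'" for \<eta>'
  proof -
    let ?z = "fold bact ws \<eta>'"
    have zX: "?z \<in> X" by (rule fold_X[OF ws \<eta>'(1)])
    have "same_prefix ?N (fold bact ws \<eta>) ?z" using fold_diff[OF \<eta>'(2) X(2) \<eta>'(1) ws] by blast
    then have p: "active_at d k ?z" using \<eta>(1) active_at_same_prefix[OF same_prefix_mono] by (metis max.cobounded2)
    let ?e = "exponent d (\<omega> k) b"
    have "?e < d" using exponent_props[OF \<omega>_Epi b] by blast
    then have "(?z (Suc k) + ?e) mod d \<noteq> ?z (Suc k)"
      using X_lt[OF zX, of "Suc k"] \<eta>(2) by (cases "?z (Suc k) + ?e < d") (auto simp: le_mod_geq)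
    then have "bact (sp b) ?z \<noteq> ?z" using boundary_act_sp_active[OF b zX p] by (metis fun_upd_same)
    then show ?thesis using conj_ray_code_iff[OF \<eta>'(1) ws bS] by blast
  qed
  moreover have "?w \<in> lists S" using ws bS ivw_lists[OF ws] by simp
  ultimately show ?thesis unfolding separates_def by blast
qed

text \<open>Once the second ray is carried to letter 0 at position \<open>n\<close>, the letter of
  the first one equals the invariant difference. The two excluded values keep it away from 0 and
  \<open>d - 1\<close>.\<close>

lemma separation_by_one_letter:
  assumes X: "\<xi> \<in> X" "\<eta> \<in> X" and e: "same_prefix n \<xi> \<eta>" 
    and \<delta>: "(int (\<xi> n) - int (\<eta> n)) mod int d \<noteq> 0" "(int (\<xi> n) - int (\<eta> n)) mod int d \<noteq> int d - 1"
  shows "\<exists>ws N. separates ws N \<xi> \<eta>"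
proof -
  obtain ws where ws: "ws \<in> lists S" "active_at d n (fold bact ws \<eta>)" using words_to_active_at[OF X(2)] by blast
  obtain b where b: "b \<in> B" "exponent d (\<omega> n) b = 1" using exponent_surj[OF \<omega>_Epi, of 1] d2 by auto
  have f: "same_prefix n (fold bact ws \<xi>) (fold bact ws \<eta>)" 
    "(int (fold bact ws \<xi> n) - int (fold bact ws \<eta> n)) mod int d = (int (\<xi> n) - int (\<eta> n)) mod int d"
    using fold_diff[OF e X ws(1)] by auto
  have "fold bact ws \<xi> n < d" by (rule X_lt[OF fold_X[OF ws(1) X(1)]])
  then have "int (fold bact ws \<xi> n) = (int (\<xi> n) - int (\<eta> n)) mod int d"
    using f(2) ws(2) by (simp add: active_at_def)
  then have n: "fold bact ws \<xi> n \<noteq> 0" "fold bact ws \<xi> n \<noteq> d - 1" using \<delta> d2 by auto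
  show ?thesis
    by (rule separates_core[OF X ws(1) b(1) ws(2)]) (use b n f(1) ws(2) in \<open>auto simp: same_prefix_def active_at_def\<close>)
qed

text \<open>B has at least four elements and the exponent takes only two values.\<close>

lemma ker_nontrivial:
  assumes "d = 2"
  shows "\<exists>b\<in>B. b \<noteq> B1 \<and> exponent d (\<omega> n) b = 0"
proof -
  have m: "m \<ge> 2" using dm assms by auto
  have "(2::nat) ^ 2 \<le> 2 ^ m" using m by (intro power_increasing) auto
  then have "card {..<d} < card B" using assms card_Bgrp[OF d0] by simp
  moreover have "exponent d (\<omega> n) ` B \<subseteq> {..<d}" using exponent_props[OF \<omega>_Epi] by auto
  ultimately have "\<not> inj_on (exponent d (\<omega> n)) B" by (metis card_inj_on_le finite_lessThan leD)
  then obtain b b' where b: "b \<in> B" "b' \<in> B" "b \<noteq> b'" "exponent d (\<omega> n) b = exponent d (\<omega> n) b'" by (auto simp: inj_on_def)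
  have i: "inv\<^bsub>Bgrp d m\<^esub> b' \<in> B" using b by simp
  let ?c = "inv\<^bsub>Bgrp d m\<^esub> b' \<otimes>\<^bsub>Bgrp d m\<^esub> b"
  have "exponent d (\<omega> n) ?c = 0"
    using exponent_mult[OF \<omega>_Epi i b(1), of n] exponent_inv[OF \<omega>_Epi b(2), of n] b(4) by simp
  moreover have "?c \<noteq> B1" using i b by (metis Bg.inv_comm Bg.inv_equality Bg.inv_inv)
  ultimately show ?thesis using i b by (metis Bg.m_closed)
qed

text \<open>For \<open>d = 2\<close> every \<open>b\<close> outside the kernel of \<open>\<omega>\<^sub>n\<close> moves the ray with prefix \<open>1\<^sup>n 0\<close>.  One takes \<open>b\<close> in this
  kernel, which is nontrivial because \<open>m \<ge> 2\<close>, and lets it act on the other ray at some \<open>k > n\<close>.\<close>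
lemma separation:
  assumes X: "\<xi> \<in> X" "\<eta> \<in> X" and ne: "\<xi> \<noteq> \<eta>"
  shows "\<exists>ws N. separates ws N \<xi> \<eta>"
proof -
  define n where "n = (LEAST n. \<xi> n \<noteq> \<eta> n)"
  have ex: "\<exists>n. \<xi> n \<noteq> \<eta> n" using ne by (auto simp: fun_eq_iff)
  then have n: "\<xi> n \<noteq> \<eta> n" unfolding n_def by (rule LeastI_ex)
  have e: "same_prefix n \<xi> \<eta>" unfolding same_prefix_def n_def using not_less_Least by blast
  then have e': "same_prefix n \<eta> \<xi>" by (simp add: same_prefix_def)
  have lt: "\<xi> n < d" "\<eta> n < d" using X X_lt by auto
  have nz: "(int (\<xi> n) - int (\<eta> n)) mod int d \<noteq> 0"
  proof
    assume "(int (\<xi> n) - int (\<eta> n)) mod int d = 0"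
    then have "int (\<xi> n) mod int d = int (\<eta> n) mod int d" by (simp add: mod_eq_dvd_iff mod_0_imp_dvd)
    then show False using n lt by simp
  qed
  show ?thesis
  proof (cases "d = 2")
    case False
    then have d3: "d \<ge> 3" using dm by auto
    show ?thesis
    proof (cases "(int (\<xi> n) - int (\<eta> n)) mod int d = int d - 1")
      case False
      then show ?thesis using separation_by_one_letter[OF X e nz] by blast
    next
      \<comment> \<open>The difference is -1. With the rays exchanged it is 1, which is admissible
        because \<open>d\<close> is at least 3.\<close>
      case True
      have "(int (\<eta> n) - int (\<xi> n)) mod int d = (- ((int (\<xi> n) - int (\<eta> n)) mod int d)) mod int d"
        by (simp add: mod_minus_eq)
      also have "\<dots> = (1 - int d) mod int d" by (simp add: True)
      also have "\<dots> = 1 mod int d" by (simp add: mod_diff_right_eq[symmetric])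
      also have "\<dots> = 1" using d3 by simp
      finally have "(int (\<eta> n) - int (\<xi> n)) mod int d = 1" .
      then show ?thesis using separation_by_one_letter[OF X(2,1) e'] d3 separates_sym by fastforce
    qed
  next
    case True
    obtain b where b: "b \<in> B" "b \<noteq> B1" "exponent d (\<omega> n) b = 0" using ker_nontrivial[OF True] by blast
    obtain k where k: "k \<ge> Suc n" "exponent d (\<omega> k) b \<noteq> 0" using ker_late[OF b(1,2)] by blast
    obtain ws where ws: "ws \<in> lists S" "active_at d k (fold bact ws \<eta>)" using words_to_active_at[OF X(2)] by blast
    have f: "same_prefix n (fold bact ws \<xi>) (fold bact ws \<eta>)" 
      "(int (fold bact ws \<xi> n) - int (fold bact ws \<eta> n)) mod int d \<noteq> 0"
      using fold_diff[OF e X ws(1)] nz by auto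
    have "fold bact ws \<xi> n \<noteq> fold bact ws \<eta> n" using f(2) by auto
    \<comment> \<open>Since \<open>n < k\<close>, the image of the second ray has letter
      \<open>d - 1\<close> at \<open>n\<close>, and the images still differ there. The first image
      is therefore (d-1)^n 0..., where \<open>b\<close> acts through \<open>\<omega> n\<close>, that
      is, trivially.\<close>
    then have "fold bact ws \<xi> n \<noteq> d - 1" using ws(2) k by (simp add: active_at_def)
    moreover have "fold bact ws \<xi> i = d - 1" if "i < n" for i
      using that f(1) ws(2) k by (simp add: same_prefix_def active_at_def)
    ultimately show ?thesis using separates_core[OF X ws(1) b(1) ws(2) k(2)] b(3) by blast
  qed
qed


subsection \<open>Local constancy off the orbit of the last ray\<close>

lemma not_ray_least:
  assumes "\<xi> \<noteq> ray"
  obtains l where "\<xi> l \<noteq> d - 1" "\<And>i. i < l \<Longrightarrow> \<xi> i = d - 1"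
proof -
  have "\<exists>n. \<xi> n \<noteq> d - 1" using assms by (auto simp: last_ray_def)
  then have "\<xi> (LEAST n. \<xi> n \<noteq> d - 1) \<noteq> d - 1" by (rule LeastI_ex)
  then show ?thesis using that not_less_Least[of _ "\<lambda>n. \<xi> n \<noteq> d - 1"] by blast
qed

text \<open>The first letter other than \<open>d - 1\<close> decides what an element of B does. The
  ray (d-1)^N is excluded because no finite prefix of it makes this decision.\<close>

lemma bact_locally_constant:
  assumes s: "s \<in> S" and \<xi>: "\<xi> \<in> X" "\<xi> \<noteq> ray"
  shows "\<exists>N. \<forall>\<eta>\<in>X. same_prefix N \<xi> \<eta> \<longrightarrow> same_prefix N (bact s \<xi>) (bact s \<eta>) \<and> (\<forall>i\<ge>N. bact s \<eta> i = \<eta> i)"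
  using s
proof (cases rule: S_cases)
  case (1 j)
  then show ?thesis using boundary_act_rotk \<xi> by (intro exI[of _ 1]) (auto simp: same_prefix_def)
next
  case (2 b)
  obtain l where l: "\<xi> l \<noteq> d - 1" "\<And>i. i < l \<Longrightarrow> \<xi> i = d - 1" using not_ray_least[OF \<xi>(2)] by blast
  \<comment> \<open>The letters 0, ..., \<open>l\<close> decide about activity, and letter
    \<open>l + 1\<close> is the one that may change.\<close>
  have "same_prefix (l + 2) (bact s \<xi>) (bact s \<eta>) \<and> (\<forall>i\<ge>l + 2. bact s \<eta> i = \<eta> i)"
    if \<eta>: "\<eta> \<in> X" "same_prefix (l + 2) \<xi> \<eta>" for \<eta>
  proof -
    have only: "k = l" if "active_at d k \<zeta>" "same_prefix (l + 2) \<xi> \<zeta>" for k \<zeta>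
    proof -
      have "\<not> l < k" using that l by (auto simp: active_at_def same_prefix_def)
      moreover have "\<not> k < l" using that l(2)[of k] d2 by (auto simp: active_at_def same_prefix_def)
      ultimately show ?thesis by simp
    qed
    show ?thesis
    proof (cases "active_at d l \<xi>")
      case True
      then have "active_at d l \<eta>" using active_at_same_prefix[OF same_prefix_mono[OF \<eta>(2)], of l] by simp
      then show ?thesis using True 2(3) \<eta> boundary_act_sp_active[OF 2(1) \<xi>(1)] boundary_act_sp_active[OF 2(1) \<eta>(1)]
        by (auto simp: same_prefix_def)
    next
      case False
      then have "\<not> active_at d l \<eta>" using active_at_same_prefix[OF same_prefix_mono[OF \<eta>(2)], of l] by simp
      then have "\<nexists>k. active_at d k \<xi>" "\<nexists>k. active_at d k \<eta>" using only False \<eta> same_prefix_refl by metis+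
      then show ?thesis using 2(3) \<eta> boundary_act_sp_not_active[OF \<xi>(1)] boundary_act_sp_not_active[OF \<eta>(1)]
        by auto
    qed
  qed
  then show ?thesis by blast
qed

text \<open>Every intermediate ray must differ from (d-1)^N; being outside the whole cofinality
  class guarantees this along any word.\<close>

lemma fold_locally_constant:
  assumes "ws \<in> lists S" "\<xi> \<in> X" "\<xi> \<notin> Cof d ray"
  shows "\<exists>N. \<forall>\<eta>\<in>X. same_prefix N \<xi> \<eta> \<longrightarrow> same_prefix N (fold bact ws \<xi>) (fold bact ws \<eta>) \<and> (\<forall>i\<ge>N. fold bact ws \<eta> i = \<eta> i)"
  using assms
proof (induction ws arbitrary: \<xi>)
  case (Cons s ws)
  then have s: "s \<in> S" "ws \<in> lists S" by auto
  have xX: "\<xi> \<in> X" using Cons.prems by blast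
  have "\<xi> \<noteq> ray" using Cons.prems Cof_refl[OF ray_X] by auto
  then obtain N1 where N1: "\<And>\<eta>. \<eta> \<in> X \<Longrightarrow> same_prefix N1 \<xi> \<eta> \<Longrightarrow>
      same_prefix N1 (bact s \<xi>) (bact s \<eta>) \<and> (\<forall>i\<ge>N1. bact s \<eta> i = \<eta> i)"
    using bact_locally_constant[OF s(1) xX] by blast
  have x1: "bact s \<xi> \<in> X" by (rule bact_X[OF s(1) xX])
  have "bact s \<xi> \<notin> Cof d ray"
    using Cons.prems bact_Cof1[OF s(1) xX] Cof_trans Cof_sym by blast
  then obtain N2 where N2: "\<And>\<eta>. \<eta> \<in> X \<Longrightarrow> same_prefix N2 (bact s \<xi>) \<eta> \<Longrightarrow>
      same_prefix N2 (fold bact ws (bact s \<xi>)) (fold bact ws \<eta>) \<and> (\<forall>i\<ge>N2. fold bact ws \<eta> i = \<eta> i)"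
    using Cons.IH[OF x1] by blast
  let ?N = "max N1 N2"
  have "same_prefix ?N (fold bact (s # ws) \<xi>) (fold bact (s # ws) \<eta>) \<and> (\<forall>i\<ge>?N. fold bact (s # ws) \<eta> i = \<eta> i)"
    if \<eta>: "\<eta> \<in> X" "same_prefix ?N \<xi> \<eta>" for \<eta>
  proof -
    have s1: "same_prefix N1 (bact s \<xi>) (bact s \<eta>)" "\<forall>i\<ge>N1. bact s \<eta> i = \<eta> i"
      using N1[OF \<eta>(1) same_prefix_mono[OF \<eta>(2)]] by auto
    have s2: "\<forall>i\<ge>N1. bact s \<xi> i = \<xi> i" using N1[OF xX same_prefix_refl] by blast
    \<comment> \<open>Letters from \<open>N1\<close> on are left alone by \<open>s\<close>, so
      agreement between \<open>N1\<close> and the maximum is inherited.\<close>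
    have e: "same_prefix ?N (bact s \<xi>) (bact s \<eta>)" using s1 s2 \<eta>(2) unfolding same_prefix_def by (metis not_le)
    have t1: "same_prefix N2 (fold bact ws (bact s \<xi>)) (fold bact ws (bact s \<eta>))"
      "\<forall>i\<ge>N2. fold bact ws (bact s \<eta>) i = bact s \<eta> i"
      using N2[OF bact_X[OF s(1) \<eta>(1)] same_prefix_mono[OF e]] by auto
    have t2: "\<forall>i\<ge>N2. fold bact ws (bact s \<xi>) i = bact s \<xi> i" using N2[OF x1 same_prefix_refl] by blast
    have "same_prefix ?N (fold bact ws (bact s \<xi>)) (fold bact ws (bact s \<eta>))"
      using e t1 t2 unfolding same_prefix_def by (metis not_le)
    moreover have "\<forall>i\<ge>?N. fold bact ws (bact s \<eta>) i = \<eta> i" using t1 s1 by simp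
    ultimately show ?thesis by simp
  qed
  then show ?case by blast
qed auto

lemma ray_code_locally_constant:
  assumes "ws \<in> lists S" "\<xi> \<in> X" "\<xi> \<notin> Cof d ray"
  shows "\<exists>N. \<forall>\<eta>\<in>X. same_prefix N \<xi> \<eta> \<longrightarrow> (ws \<in> ray_code \<eta> \<longleftrightarrow> ws \<in> ray_code \<xi>)"
proof -
  obtain N where N: "\<And>\<eta>. \<eta> \<in> X \<Longrightarrow> same_prefix N \<xi> \<eta> \<Longrightarrow>
    same_prefix N (fold bact ws \<xi>) (fold bact ws \<eta>) \<and> (\<forall>i\<ge>N. fold bact ws \<eta> i = \<eta> i)"
    using fold_locally_constant[OF assms] by blast
  have "fold bact ws \<eta> = \<eta> \<longleftrightarrow> fold bact ws \<xi> = \<xi>" if "\<eta> \<in> X" "same_prefix N \<xi> \<eta>" for \<eta>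
    using N[OF that] N[OF assms(2) same_prefix_refl] that(2) unfolding same_prefix_def fun_eq_iff by (metis not_le)
  then show ?thesis using assms(1) unfolding code_def by blast
qed

lemma finite_words_le: "finite (words_le r)"
  unfolding words_le_def using finite_lists_length_le[OF finite_S, of r]
  by (rule rev_finite_subset) auto

lemma ray_code_locally_constant_words:
  assumes "\<xi> \<in> X" "\<xi> \<notin> Cof d ray"
  shows "\<exists>N. \<forall>\<eta>\<in>X. same_prefix N \<xi> \<eta> \<longrightarrow> (\<forall>ws\<in>words_le r. ws \<in> ray_code \<eta> \<longleftrightarrow> ws \<in> ray_code \<xi>)"
proof -
  have "\<forall>ws\<in>words_le r. \<exists>N. \<forall>\<eta>\<in>X. same_prefix N \<xi> \<eta> \<longrightarrow> (ws \<in> ray_code \<eta> \<longleftrightarrow> ws \<in> ray_code \<xi>)"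
    using ray_code_locally_constant[OF _ assms] words_le_subset by blast
  then obtain f where f: "\<And>ws. ws \<in> words_le r \<Longrightarrow> \<forall>\<eta>\<in>X. same_prefix (f ws) \<xi> \<eta> \<longrightarrow> (ws \<in> ray_code \<eta> \<longleftrightarrow> ws \<in> ray_code \<xi>)"
    by metis
  have "f ws \<le> Max (f ` words_le r)" if "ws \<in> words_le r" for ws using that finite_words_le by simp
  then show ?thesis using f same_prefix_mono by (intro exI[of _ "Max (f ` words_le r)"]) blast
qed


section \<open>The limit graphs\<close>

text \<open>At the centre a label from B moves between copies by \<open>e\<close>; elsewhere a label
  acts inside its copy. With \<open>e\<close> the exponent of \<open>\<pi>\<close> this is the limit
  graph, and with \<open>e = 0\<close> it is \<open>d\<close> separate copies of the Schreier graph
  of (d-1)^N.\<close>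

definition star_act :: "((nat \<Rightarrow> int) \<Rightarrow> nat) \<Rightarrow> (nat list \<Rightarrow> nat list) \<Rightarrow> nat \<times> (nat \<Rightarrow> nat) \<Rightarrow> nat \<times> (nat \<Rightarrow> nat)" where
  "star_act e s = (\<lambda>(i, u). if u = ray \<and> s \<in> sp ` B then ((i + e (inv_into B sp s)) mod d, u) else (i, bact s u))"

lemma star_act_rotk: "0 < j \<Longrightarrow> j < d \<Longrightarrow> star_act e (rotk d j) (i, u) = (i, bact (rotk d j) u)"
proof -
  assume "0 < j" "j < d"
  then have "rotk d j \<noteq> \<one>\<^bsub>Aut_tree d\<^esub>" using rotk_eq_iff[OF d0, of j 0] by (simp add: rotk_one)
  then have "rotk d j \<notin> sp ` B" using sp_ne_rotk by blast
  then show ?thesis by (simp add: star_act_def)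
qed

lemma star_act_sp: "b \<in> B \<Longrightarrow> star_act e (sp b) (i, u) = (if u = ray then ((i + e b) mod d, u) else (i, bact (sp b) u))"
  using sp_inj by (simp add: star_act_def)

lemma bact_sp_ray: "bact (sp b) ray = ray"
  using boundary_act_sp_not_active[OF ray_X] not_active_at_ray by blast

text \<open>Forgetting the copy projects the star onto the Schreier graph of (d-1)^N, because the
  labels from B are loops at that ray.\<close>

lemma snd_star_act: 
  assumes "s \<in> S" 
  shows "snd (star_act e s (i, u)) = bact s u"
  using assms by (cases rule: S_cases) (auto simp: star_act_rotk star_act_sp bact_sp_ray)

lemma star_act_zero:
  assumes "s \<in> S" "i < d" 
  shows "star_act (\<lambda>_. 0) s (i, u) = (i, bact s u)"
  using assms(1) by (cases rule: S_cases) (auto simp: star_act_rotk star_act_sp bact_sp_ray assms(2))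

lemma snd_fold_star_act: "ws \<in> lists S \<Longrightarrow> snd (fold (star_act e) ws (i, u)) = fold bact ws u"
proof (induction ws arbitrary: i u)
  case (Cons s ws)
  then have "snd (star_act e s (i, u)) = bact s u" using snd_star_act by simp
  then show ?case using Cons by (cases "star_act e s (i, u)") simp
qed simp

lemma fold_star_act_zero: "ws \<in> lists S \<Longrightarrow> i < d \<Longrightarrow> fold (star_act (\<lambda>_. 0)) ws (i, u) = (i, fold bact ws u)"
  by (induction ws arbitrary: u) (auto simp: star_act_zero)

lemma code_star_act_zero: "i < d \<Longrightarrow> code S (star_act (\<lambda>_. 0)) (i, u) = ray_code u"
  unfolding code_def by (intro Collect_cong conj_cong refl) (simp add: fold_star_act_zero)

lemma action_star_act:
  assumes e: "\<And>b. b \<in> B \<Longrightarrow> (e (inv\<^bsub>Bgrp d m\<^esub> b) + e b) mod d = 0"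
  shows "action ({..<d} \<times> Cof d ray) (star_act e)"
proof -
  have *: "star_act e s (i, u) \<in> {..<d} \<times> Cof d ray \<and> star_act e (inva s) (star_act e s (i, u)) = (i, u) \<and>
      star_act e s (star_act e (inva s) (i, u)) = (i, u)" if s: "s \<in> S" and iu: "i < d" "u \<in> Cof d ray" for s i u
    using s
  proof (cases rule: S_cases)
    case (1 j)
    have uX: "u \<in> X" using iu Cof_boundary by blast
    have "inva s = rotk d (((d - 1) * j) mod d)" using rotk_inv[OF d0] rotk_mod_eq 1 by simp
    moreover have "inva s \<noteq> \<one>\<^bsub>Aut_tree d\<^esub>" using inva_S[OF s] by (auto simp: spinal_gens_def)
    ultimately obtain k where k: "0 < k" "k < d" "inva s = rotk d k"
      using d0 rotk_one by (metis bot_nat_0.not_eq_extremum mod_less_divisor)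
    have "star_act e s (i', u') = (i', bact s u')" "star_act e (inva s) (i', u') = (i', bact (inva s) u')" for i' u'
      using 1 k star_act_rotk by metis+
    then show ?thesis using bact_inva[OF s uX] action_Cof[OF ray_X] s iu by (auto simp: action_def)
  next
    case (2 b)
    have uX: "u \<in> X" using iu Cof_boundary by blast
    let ?b = "inv\<^bsub>Bgrp d m\<^esub> b"
    have b: "?b \<in> B" "inva s = sp ?b" using 2 sp_inv by auto
    show ?thesis
    proof (cases "u = ray")
      case True
      have "(i + e b + e ?b) mod d = (i + (e ?b + e b) mod d) mod d"
        by (simp add: mod_simps ac_simps)
      then have m: "(i + e b + e ?b) mod d = i" "(i + e ?b + e b) mod d = i" using e[OF 2(1)] iu by (simp_all add: ac_simps)
      then show ?thesis using True 2 b iu d0 by (simp add: star_act_sp mod_simps)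
    next
      case False
      \<comment> \<open>B permutes the rays and fixes (d-1)^N, so no other ray is moved onto it, and
        the two cases of \<open>star_act\<close> do not mix.\<close>
      have "bact s' u \<noteq> ray" if "s' \<in> {sp b, sp ?b}" for s'
        using bact_inva[OF s uX] bact_sp_ray False 2 b that by (metis insertE singletonD)
      then show ?thesis using False 2 b iu bact_inva[OF s uX] action_Cof[OF ray_X] s by (auto simp: star_act_sp action_def)
    qed
  qed
  then show ?thesis unfolding action_def by auto
qed

abbreviation "LV \<equiv> {..<d} \<times> Cof d ray"

lemma action_limit: "\<pi> \<in> Epi d m \<Longrightarrow> action LV (star_act (exponent d \<pi>))"
  by (rule action_star_act) (rule exponent_inv)

text \<open>A word leading to (d-1)^N in the projection leads to the centre of some copy. A label
  from B with the right exponent then passes between centres.\<close>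

lemma trans_action_limit:
  assumes \<pi>: "\<pi> \<in> Epi d m" and x: "x \<in> LV"
  shows "trans_action LV (star_act (exponent d \<pi>)) x"
proof -
  let ?A = "star_act (exponent d \<pi>)"
  have a: "action LV ?A" by (rule action_limit[OF \<pi>])
  have to_ray: "\<exists>ws\<in>lists S. \<exists>i<d. fold ?A ws y = (i, ray)" if y: "y \<in> LV" for y
  proof -
    obtain i u where yu: "y = (i, u)" "i < d" "u \<in> Cof d ray" using y by auto
    obtain ws where ws: "ws \<in> lists S" "fold bact ws u = ray"
      using Cof_words[OF Cof_boundary[OF yu(3)] Cof_sym[OF yu(3) ray_X]] by blast
    have "fold ?A ws y \<in> LV" by (rule fold_closed[OF a ws(1) y])
    moreover have "snd (fold ?A ws y) = ray" using snd_fold_star_act[OF ws(1)] ws(2) yu by simp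
    ultimately have "fold ?A ws y = (fst (fold ?A ws y), ray)" "fst (fold ?A ws y) < d" by auto
    then show ?thesis using ws by blast
  qed
  have "\<exists>ws\<in>lists S. fold ?A ws x = y" if y: "y \<in> LV" for y
  proof -
    obtain ws i where ws: "ws \<in> lists S" "i < d" "fold ?A ws x = (i, ray)" using to_ray[OF x] by blast
    obtain us j where us: "us \<in> lists S" "j < d" "fold ?A us y = (j, ray)" using to_ray[OF y] by blast
    have "\<exists>zs\<in>lists S. fold ?A zs (i, ray) = (j, ray)"
    proof (cases "i = j")
      case True
      then show ?thesis by (intro bexI[of _ "[]"]) auto
    next
      case False
      obtain b where b: "b \<in> B" "exponent d \<pi> b = (j + (d - i)) mod d" using exponent_surj[OF \<pi>, of "(j + (d - i)) mod d"] d0 by auto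
      have "(i + (j + (d - i)) mod d) mod d = (j + d) mod d" using ws(2) by (simp add: mod_simps)
      then have j: "(i + exponent d \<pi> b) mod d = j" using b us(2) by simp
      then have "b \<noteq> B1" using exponent_one[OF \<pi>] False ws(2) by auto
      then have "sp b \<in> S" using sp_S b by blast
      then show ?thesis using j b by (intro bexI[of _ "[sp b]"]) (auto simp: star_act_sp)
    qed
    then obtain zs where zs: "zs \<in> lists S" "fold ?A zs (i, ray) = (j, ray)" by blast
    have "fold ?A (ivw us) (j, ray) = y" using fold_ivw_left[OF a us(1) y] us(3) by simp
    then have "fold ?A (ws @ zs @ ivw us) x = y" using ws zs by simp
    then show ?thesis using ws zs us ivw_lists[OF us(1)] by (intro bexI[of _ "ws @ zs @ ivw us"]) auto
  qed
  then show ?thesis using a x by (simp add: trans_action_def)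
qed

text \<open>Hence the loops at (d-1)^N are precisely the edges with labels from B, which are the
  ones that the graph \<open>Lambda\<close> replaces in the star.\<close>

lemma bact_ray_eq:
  assumes "s \<in> S" "s \<notin> sp ` B"
  shows "bact s ray \<noteq> ray"
  using assms(1)
proof (cases rule: S_cases)
  case (1 j)
  have "(d - 1 + j) mod d \<noteq> d - 1"
    using 1 by (cases "d - 1 + j < d") (auto simp: le_mod_geq)
  then have "bact s ray 0 \<noteq> ray 0" using 1 boundary_act_rotk[OF ray_X] by (simp add: last_ray_def)
  then show ?thesis by metis
qed (use assms in auto)

text \<open>The power \<open>j\<close> in \<open>Lambda\<close> is determined modulo
  \<open>d\<close> only, and the target vertex sees no more than that.\<close>

lemma Lambda_edge:
  assumes "\<pi> \<in> Epi d m"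
  shows "(i, s, j) \<in> gedges (Lambda d m \<omega> \<pi>) \<longleftrightarrow>
    i < d \<and> s \<in> S \<inter> sp ` B \<and> j = (i + exponent d \<pi> (inv_into B sp s)) mod d"
proof
  assume "(i, s, j) \<in> gedges (Lambda d m \<omega> \<pi>)"
  then obtain b k where b: "i < d" "b \<in> B" "b \<noteq> B1" "s = sp b" "j = (i + k) mod d" "\<pi> b = rotk d k"
    using rot_pow[OF d0] by (auto simp: Lambda_def)
  have "exponent d \<pi> b = k mod d" by (rule exponent_eq[OF assms b(2,6)])
  then show "i < d \<and> s \<in> S \<inter> sp ` B \<and> j = (i + exponent d \<pi> (inv_into B sp s)) mod d"
    using b sp_S sp_inj by (auto simp: mod_simps)
next
  assume R: "i < d \<and> s \<in> S \<inter> sp ` B \<and> j = (i + exponent d \<pi> (inv_into B sp s)) mod d"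
  then obtain b where b: "b \<in> B" "s = sp b" by auto
  then have "b \<noteq> B1" using R sp_one by (auto simp: spinal_gens_def)
  moreover have "j = (i + exponent d \<pi> b) mod d" using R b sp_inj by simp
  moreover have "\<pi> b = rot d [^]\<^bsub>Aut_tree d\<^esub> exponent d \<pi> b"
    using rot_pow[OF d0] exponent_props(2)[OF assms b(1)] by simp
  ultimately show "(i, s, j) \<in> gedges (Lambda d m \<omega> \<pi>)" using R b by (auto simp: Lambda_def)
qed

lemma limit_graph_action_graph:
  assumes \<pi>: "\<pi> \<in> Epi d m"
  shows "limit_graph d m \<omega> \<pi> = action_graph S LV (star_act (exponent d \<pi>))"
proof -
  let ?E = "{((i, u), s, (i, w)) | i u s w. i < d \<and> (u, s, w) \<in> gedges (remove_loops (action_graph S (Cof d ray) bact) ray)}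
        \<union> {((i, ray), s, (j, ray)) | i s j. (i, s, j) \<in> gedges (Lambda d m \<omega> \<pi>)}"
  have "(p, s, q) \<in> ?E \<longleftrightarrow> p \<in> LV \<and> s \<in> S \<and> q = star_act (exponent d \<pi>) s p" for p s q
  proof -
    obtain i u j w where p: "p = (i, u)" "q = (j, w)" by (cases p, cases q)
    have r: "ray \<in> Cof d ray" by (rule Cof_refl[OF ray_X])
    show ?thesis
    proof (cases "u = ray \<and> s \<in> sp ` B")
      case True
      then have "bact s u = u" using bact_sp_ray by auto
      then show ?thesis using True p r Lambda_edge[OF \<pi>, of i s j]
        by (auto simp: star_act_def remove_loops_def)
    next
      case False
      then have "\<not> (u = ray \<and> bact s u = ray)" if "s \<in> S" using bact_ray_eq that by auto
      moreover have "star_act (exponent d \<pi>) s p = (i, bact s u)" using False p by (auto simp: star_act_def)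
      moreover have "(i', s, j') \<notin> gedges (Lambda d m \<omega> \<pi>) \<or> u \<noteq> ray" for i' j'
        using False Lambda_edge[OF \<pi>, of i' s j'] by auto
      ultimately show ?thesis using p by (auto simp: remove_loops_def)
    qed
  qed
  moreover have "(p, s, q) \<in> {(y, s, star_act (exponent d \<pi>) s y) | y s. y \<in> LV \<and> s \<in> S} \<longleftrightarrow>
      p \<in> LV \<and> s \<in> S \<and> q = star_act (exponent d \<pi>) s p" for p s q
    by blast
  ultimately have mem: "t \<in> ?E \<longleftrightarrow> t \<in> {(y, s, star_act (exponent d \<pi>) s y) | y s. y \<in> LV \<and> s \<in> S}" for t
    by (cases t) presburger
  have "?E = {(y, s, star_act (exponent d \<pi>) s y) | y s. y \<in> LV \<and> s \<in> S}" by (rule Set.set_eqI) (rule mem)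
  then show ?thesis unfolding limit_graph_def Star_def Schreier_action_graph[OF ray_X] action_graph_def[of S LV]
    by (simp add: Lambda_def remove_loops_def)
qed

abbreviation "limit_point \<pi> x \<equiv> iso_class S (limit_graph d m \<omega> \<pi>, x)"
abbreviation "limit_code \<pi> \<equiv> code S (star_act (exponent d \<pi>))"

lemma limit_point_points:
  assumes "\<pi> \<in> Epi d m" "x \<in> LV"
  shows "limit_point \<pi> x \<in> points" "class_code (limit_point \<pi> x) = limit_code \<pi> x"
proof -
  have c: "countable LV" using countable_Cof by (intro countable_SIGMA) auto
  show "limit_point \<pi> x \<in> points" "class_code (limit_point \<pi> x) = limit_code \<pi> x"
    using points_of_action[OF trans_action_limit[OF assms] c] limit_graph_action_graph[OF assms(1)] by auto
qed


subsection \<open>Rays close to the orbit of the last ray\<close>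

text \<open>This map places the star near \<open>\<xi>\<close>: the copy index becomes letter
  \<open>n + 1\<close>. Letter \<open>n\<close> remains that of \<open>\<xi>\<close>, since it
  decides whether B can reach letter \<open>n + 1\<close>.\<close>

definition graft :: "nat \<Rightarrow> (nat \<Rightarrow> nat) \<Rightarrow> nat \<times> (nat \<Rightarrow> nat) \<Rightarrow> nat \<Rightarrow> nat" where
  "graft n \<xi> = (\<lambda>(i, u) k. if k < n then u k else if k = Suc n then i else \<xi> k)"

text \<open>If letter \<open>n\<close> is not 0, the centre cannot be left by B, and exponent 0
  keeps the copies apart.\<close>

definition graft_exponent :: "nat \<Rightarrow> (nat \<Rightarrow> nat) \<Rightarrow> (nat \<Rightarrow> int) \<Rightarrow> nat" where
  "graft_exponent n \<xi> = (if \<xi> n = 0 then exponent d (\<omega> n) else (\<lambda>_. 0))"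

lemma graft_X: "\<xi> \<in> X \<Longrightarrow> u \<in> X \<Longrightarrow> i < d \<Longrightarrow> graft n \<xi> (i, u) \<in> X"
  by (auto simp: graft_def boundary_def)

text \<open>Grafting commutes with generators as long as the part of \<open>u\<close> differing from
  (d-1)^N stays below \<open>n\<close>. One step extends that part by at most one letter, hence
  \<open>Suc N\<close>.\<close>

lemma graft_step:
  assumes s: "s \<in> S" and \<xi>: "\<xi> \<in> X" "\<xi> n \<noteq> d - 1" and u: "u \<in> same_tail d N ray" and N: "N < n" and i: "i < d"
  shows "bact s (graft n \<xi> (i, u)) = graft n \<xi> (star_act (graft_exponent n \<xi>) s (i, u))
    \<and> star_act (graft_exponent n \<xi>) s (i, u) \<in> {..<d} \<times> same_tail d (Suc N) ray"
  using s
proof (cases rule: S_cases)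
  case (1 j)
  have uX: "u \<in> X" using u by (simp add: same_tail_def)
  have sX: "bact s u \<in> X" by (rule bact_X[OF s uX])
  have "(graft n \<xi> (i, u))(0 := (graft n \<xi> (i, u) 0 + j) mod d) = graft n \<xi> (i, u(0 := (u 0 + j) mod d))"
    by (rule ext) (use N in \<open>auto simp: graft_def\<close>)
  then have "bact s (graft n \<xi> (i, u)) = graft n \<xi> (i, bact s u)"
    using 1(3) boundary_act_rotk[OF uX] boundary_act_rotk[OF graft_X[OF \<xi>(1) uX i]] by simp
  moreover have "bact s u \<in> same_tail d (Suc N) ray"
    using sX u 1(3) boundary_act_rotk[OF uX] by (auto simp: same_tail_def)
  ultimately show ?thesis using 1 star_act_rotk i by simp
next
  case (2 b)
  have uX: "u \<in> X" using u by (simp add: same_tail_def)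
  have sX: "bact s u \<in> X" by (rule bact_X[OF s uX])
  let ?F = "graft n \<xi> (i, u)"
  have FX: "?F \<in> X" by (rule graft_X[OF \<xi>(1) uX i])
  have tail: "u k = d - 1" if "k \<ge> N" for k using that u by (simp add: same_tail_def last_ray_def)
  show ?thesis
  proof (cases "u = ray")
    case True
    have memb: "((i + graft_exponent n \<xi> b) mod d, ray) \<in> {..<d} \<times> same_tail d (Suc N) ray" using d0 by (simp add: same_tail_def)
    have F: "?F k = (if k < n then d - 1 else if k = Suc n then i else \<xi> k)" for k
      using True by (simp add: graft_def last_ray_def)
    show ?thesis
    \<comment> \<open>The grafted ray begins with (d-1)^n followed by the letter
      \<open>\<xi> n\<close>. If this letter is 0, B rotates letter \<open>n + 1\<close> through
      \<open>\<omega> n\<close>; otherwise it is neither 0 nor \<open>d - 1\<close>, and B fixes the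
      ray.\<close>
    proof (cases "\<xi> n = 0")
      case z: True
      then have p: "active_at d n ?F" using F by (simp add: active_at_def)
      have "bact s ?F = ?F(Suc n := (i + exponent d (\<omega> n) b) mod d)"
        using boundary_act_sp_active[OF 2(1) FX p] 2(3) F by simp
      also have "\<dots> = graft n \<xi> ((i + exponent d (\<omega> n) b) mod d, ray)"
        by (rule ext) (use True in \<open>auto simp: graft_def\<close>)
      finally show ?thesis using memb True 2 z by (simp add: star_act_sp graft_exponent_def)
    next
      case False
      have "\<not> active_at d k ?F" for k
      proof
        assume p: "active_at d k ?F"
        have "\<not> k < n" using p F[of k] d2 by (auto simp: active_at_def)
        moreover have "\<not> n < k" using p F[of n] \<xi>(2) by (auto simp: active_at_def)
        moreover have "k \<noteq> n" using p F[of n] False by (auto simp: active_at_def)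
        ultimately show False by simp
      qed
      then show ?thesis using memb True 2 False boundary_act_sp_not_active[OF FX] i
        by (auto simp: star_act_sp graft_exponent_def)
    qed
  next
    case False
    then obtain l where l: "u l \<noteq> d - 1" "\<And>i. i < l \<Longrightarrow> u i = d - 1" using not_ray_least by blast
    \<comment> \<open>The deciding letter of \<open>u\<close> and its successor lie before
      \<open>n\<close>, so B changes the same letter of \<open>u\<close> and of the grafted
      ray.\<close>
    have lN: "l < N" using l tail not_le by blast
    have eq: "same_prefix n u ?F" by (simp add: same_prefix_def graft_def)
    have only: "k = l" if "active_at d k \<zeta>" "same_prefix n u \<zeta>" for k \<zeta>
    proof -
      have "\<not> l < k" using that l lN N by (auto simp: active_at_def same_prefix_def)
      moreover have "\<not> k < l" using that l(2)[of k] lN N d2 by (auto simp: active_at_def same_prefix_def)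
      ultimately show ?thesis by simp
    qed
    show ?thesis
    proof (cases "active_at d l u")
      case True
      have "active_at d l ?F" using True active_at_same_prefix[OF same_prefix_mono[OF eq], of l] lN N by simp
      then have F: "bact s ?F = ?F(Suc l := (?F (Suc l) + exponent d (\<omega> l) b) mod d)"
        using boundary_act_sp_active[OF 2(1) FX] 2(3) by simp
      have U: "bact s u = u(Suc l := (u (Suc l) + exponent d (\<omega> l) b) mod d)"
        using boundary_act_sp_active[OF 2(1) uX True] 2(3) by simp
      have "?F(Suc l := (?F (Suc l) + exponent d (\<omega> l) b) mod d) =
          graft n \<xi> (i, u(Suc l := (u (Suc l) + exponent d (\<omega> l) b) mod d))"
        by (rule ext) (use lN N in \<open>auto simp: graft_def\<close>)
      then have "bact s ?F = graft n \<xi> (i, bact s u)" using F U by simp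
      moreover have "bact s u \<in> same_tail d (Suc N) ray"
        using sX U lN tail by (auto simp: same_tail_def last_ray_def)
      ultimately show ?thesis using False 2 i by (simp add: star_act_sp)
    next
      case np: False
      have "\<not> active_at d l ?F" using np active_at_same_prefix[OF same_prefix_mono[OF eq], of l] lN N by simp
      then have "\<nexists>k. active_at d k u" "\<nexists>k. active_at d k ?F" using only np eq same_prefix_refl by metis+
      then show ?thesis using False 2 i uX boundary_act_sp_not_active[OF uX] boundary_act_sp_not_active[OF FX] tail
        by (auto simp: star_act_sp same_tail_def last_ray_def)
    qed
  qed
qed

lemma graft_fold:
  assumes \<xi>: "\<xi> \<in> X" "\<xi> n \<noteq> d - 1"
  shows "set ws \<subseteq> S \<Longrightarrow> u \<in> same_tail d N ray \<Longrightarrow> N + length ws \<le> n \<Longrightarrow> i < d \<Longrightarrow>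
    fold bact ws (graft n \<xi> (i, u)) = graft n \<xi> (fold (star_act (graft_exponent n \<xi>)) ws (i, u))
    \<and> fold (star_act (graft_exponent n \<xi>)) ws (i, u) \<in> {..<d} \<times> same_tail d n ray"
proof (induction ws arbitrary: u N i)
  case Nil
  then show ?case by (auto simp: same_tail_def)
next
  case (Cons s ws)
  obtain j w where jw: "star_act (graft_exponent n \<xi>) s (i, u) = (j, w)" by fastforce
  have st: "bact s (graft n \<xi> (i, u)) = graft n \<xi> (j, w)" "j < d" "w \<in> same_tail d (Suc N) ray"
    using graft_step[OF _ \<xi> Cons.prems(2) _ Cons.prems(4), of s] Cons.prems jw by auto
  show ?case using Cons.IH[of w "Suc N" j] Cons.prems st jw by simp
qed

text \<open>\<open>\<xi>\<close> is itself a grafted point. Grafting is injective on pairs whose ray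
  equals (d-1)^N from \<open>n\<close> on, so a word closes up at \<open>\<xi>\<close> exactly if it
  does in the star. The bound on \<open>N + length ws\<close> keeps the path in this range.\<close>

lemma near_code:
  assumes \<xi>: "\<xi> \<in> X" "\<xi> n \<noteq> d - 1" and e: "same_prefix n u \<xi>" and u: "u \<in> same_tail d N ray"
    and ws: "ws \<in> lists S" "N + length ws \<le> n"
  shows "ws \<in> ray_code \<xi> \<longleftrightarrow> (if \<xi> n = 0 then ws \<in> limit_code (\<omega> n) (\<xi> (Suc n), u) else ws \<in> ray_code u)"
proof -
  let ?i = "\<xi> (Suc n)"
  have i: "?i < d" using X_lt[OF \<xi>(1)] .
  have F: "graft n \<xi> (?i, u) = \<xi>" using e by (auto simp: graft_def same_prefix_def fun_eq_iff)
  obtain j w where jw: "fold (star_act (graft_exponent n \<xi>)) ws (?i, u) = (j, w)" by fastforce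
  have "set ws \<subseteq> S" using ws by auto
  then have f: "fold bact ws \<xi> = graft n \<xi> (j, w)" "w \<in> same_tail d n ray"
    using graft_fold[OF \<xi>, of ws u N ?i] u ws i F jw by auto
  have un: "u \<in> same_tail d n ray" using u ws by (auto simp: same_tail_def)
  have "graft n \<xi> (j, w) = graft n \<xi> (?i, u) \<longleftrightarrow> (j, w) = (?i, u)"
  proof
    assume E: "graft n \<xi> (j, w) = graft n \<xi> (?i, u)"
    have "j = ?i" using fun_cong[OF E, of "Suc n"] by (simp add: graft_def)
    moreover have "w k = u k" for k
      using fun_cong[OF E, of k] f(2) un by (cases "k < n") (auto simp: graft_def same_tail_def)
    ultimately show "(j, w) = (?i, u)" by auto
  qed simp
  then have "ws \<in> ray_code \<xi> \<longleftrightarrow> ws \<in> code S (star_act (graft_exponent n \<xi>)) (?i, u)"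
    using f F jw ws by (simp add: code_def)
  then show ?thesis using code_star_act_zero[OF i] by (simp add: graft_exponent_def)
qed


subsection \<open>Ends of the limit graphs\<close>

text \<open>The last letter different from \<open>d - 1\<close> is pushed down one position at a time, until it
  reaches position \<open>N\<close>.\<close>
lemma outside_connected:
  assumes "N > 0"
  defines "z \<equiv> \<lambda>i. if i = N - 1 \<or> i = N then 0 else d - 1"
  shows "u \<in> Cof d ray \<Longrightarrow> u \<notin> same_tail d N ray \<Longrightarrow> (u, z) \<in> (stepR (Cof d ray - same_tail d N ray))\<^sup>*"
proof -
  let ?W = "Cof d ray - same_tail d N ray"
  have WX: "?W \<subseteq> X" using Cof_boundary by blast
  have *: "(u, z) \<in> (stepR ?W)\<^sup>*" if "u \<in> X" "k \<ge> N" "u k \<noteq> d - 1" "\<forall>i>k. u i = d - 1" for u k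
    using that
  proof (induction k arbitrary: u rule: less_induct)
    case (less k)
    define c where "c = (\<lambda>i. if i < k - 1 then d - 1 else if i = k - 1 then 0 else u i)"
    \<comment> \<open>Setting letter \<open>k\<close> to \<open>d - 1\<close> moves the last
      exceptional letter to \<open>k - 1\<close>. For \<open>k = N\<close> this could lead back into
      the deleted block, so letter \<open>N\<close> is set to 0; the resulting ray is the common
      meeting point \<open>z\<close>.\<close>
    define c' where "c' = c(k := (if k = N then 0 else d - 1))"
    have k0: "k > 0" using assms less by simp
    have tailCof: "w \<in> Cof d ray" if "w \<in> X" "\<forall>i>k. w i = d - 1" for w
      unfolding Cof_same_tail using that by (auto simp: same_tail_def last_ray_def intro!: exI[of _ "Suc k"])
    \<comment> \<open>Letter \<open>k\<close> is constant on this block and differs from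
      \<open>d - 1\<close>, so walking in the block never enters the deleted set.\<close>
    have sub: "same_tail d k u \<subseteq> ?W"
    proof
      fix w assume w: "w \<in> same_tail d k u"
      then have "w \<in> X" "\<forall>i>k. w i = d - 1" "w k \<noteq> d - 1" using less.prems by (auto simp: same_tail_def)
      then show "w \<in> ?W" using tailCof less.prems(2) by (auto simp: same_tail_def last_ray_def)
    qed
    have u: "u \<in> same_tail d k u" using less by (simp add: same_tail_def)
    have cX: "c \<in> X" using less.prems d0 by (auto simp: c_def boundary_def)
    have c: "c \<in> same_tail d k u" using cX k0 by (auto simp: c_def same_tail_def)
    have c'X: "c' \<in> X" using cX d0 by (auto simp: c'_def boundary_def)
    have c't: "\<forall>i>k. c' i = d - 1" using less.prems by (auto simp: c'_def c_def)
    have c'0: "c' (k - 1) = 0" using k0 by (simp add: c'_def c_def)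
    have "c' \<notin> same_tail d N ray"
    proof (cases "k = N")
      case True
      then show ?thesis using d2 by (auto simp: c'_def same_tail_def last_ray_def)
    next
      case False
      then have "k - 1 \<ge> N" using less.prems by simp
      then show ?thesis using c'0 d2 by (auto simp: same_tail_def last_ray_def)
    qed
    then have c'W: "c' \<in> ?W" using tailCof[OF c'X c't] by simp
    have "(u, c) \<in> (stepR ?W)\<^sup>*" using stepR_mono[OF sub block_connected[OF less.prems(1) c]] .
    also have "(c, c') \<in> (stepR ?W)\<^sup>*"
    proof -
      have "active_at d (k - 1) c" by (auto simp: active_at_def c_def)
      then show ?thesis using stepR_spin[of c ?W "k - 1" "c' k"] sub c c'W WX k0 by (auto simp: c'_def)
    qed
    also have "(c', z) \<in> (stepR ?W)\<^sup>*"
    proof (cases "k = N")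
      case True
      then have "c' = z" using less.prems(4) by (auto simp: z_def c'_def c_def fun_eq_iff not_less_iff_gr_or_eq)
      then show ?thesis by simp
    next
      case False
      have "c' (k - 1) \<noteq> d - 1" using c'0 d2 by simp
      moreover have "\<forall>i>k - 1. c' i = d - 1"
      proof (intro allI impI)
        fix i assume "i > k - 1"
        then have "i = k \<or> i > k" by auto
        then show "c' i = d - 1" using c't False by (auto simp: c'_def)
      qed
      moreover have "k - 1 \<ge> N" "k - 1 < k" using False less.prems k0 by auto
      ultimately show ?thesis using less.IH[of "k - 1" c'] c'X by blast
    qed
    finally show ?case .
  qed
  assume u: "u \<in> Cof d ray" "u \<notin> same_tail d N ray"
  have uX: "u \<in> X" using u Cof_boundary by blast
  define J where "J = {i. u i \<noteq> d - 1}"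
  have fin: "finite J" using u by (simp add: J_def Cof_def last_ray_def)
  have ex: "\<exists>i\<ge>N. i \<in> J" using u uX by (auto simp: J_def same_tail_def last_ray_def)
  then have "J \<noteq> {}" by blast
  then have M: "Max J \<in> J" "\<And>i. i \<in> J \<Longrightarrow> i \<le> Max J" using fin by auto
  have "Max J \<ge> N" using ex M(2) order_trans by blast
  moreover have "u (Max J) \<noteq> d - 1" using M(1) by (simp add: J_def)
  moreover have "\<forall>i>Max J. u i = d - 1"
  proof (intro allI impI)
    fix i assume "i > Max J"
    then have "i \<notin> J" using M(2)[of i] by auto
    then show "u i = d - 1" by (simp add: J_def)
  qed
  ultimately show "(u, z) \<in> (stepR ?W)\<^sup>*" using *[OF uX] by blast
qed

end


section \<open>Finite subsets of cofinality classes, and the topology and compactness of the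
  boundary\<close>

lemma same_tail_mono: "M \<le> N \<Longrightarrow> same_tail d M \<xi> \<subseteq> same_tail d N \<xi>"
  by (auto simp: same_tail_def)

lemma finite_Cof_same_tail:
  assumes "finite F" "F \<subseteq> Cof d \<xi>"
  shows "\<exists>N>0. F \<subseteq> same_tail d N \<xi>"
proof -
  have "\<forall>u\<in>F. \<exists>N. u \<in> same_tail d N \<xi>" using assms(2) unfolding Cof_same_tail by blast
  then obtain f where f: "\<And>u. u \<in> F \<Longrightarrow> u \<in> same_tail d (f u) \<xi>" by metis
  have "f u \<le> Suc (Max (f ` F))" if "u \<in> F" for u using assms(1) that by (simp add: le_SucI)
  then have "F \<subseteq> same_tail d (Suc (Max (f ` F))) \<xi>" using f same_tail_mono by blast
  then show ?thesis by blast
qed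

lemma openin_same_prefix:
  assumes "\<xi> \<in> boundary d"
  shows "openin (boundary_topology d) {\<eta> \<in> boundary d. same_prefix N \<xi> \<eta>}"
  unfolding boundary_topology_def openin_product_topology_alt
proof
  fix \<eta> assume \<eta>: "\<eta> \<in> {\<eta> \<in> boundary d. same_prefix N \<xi> \<eta>}"
  let ?U = "\<lambda>i. if i < N then {\<xi> i} else {..<d}"
  have 1: "finite {i \<in> UNIV. ?U i \<noteq> topspace (discrete_topology {..<d})}"
    by (rule finite_subset[of _ "{..<N}"]) auto
  have 2: "\<forall>i\<in>UNIV. openin (discrete_topology {..<d}) (?U i)" using assms by (auto simp: boundary_def)
  have 3: "\<eta> \<in> Pi\<^sub>E UNIV ?U" using \<eta> by (auto simp: same_prefix_def boundary_def)
  have 4: "Pi\<^sub>E UNIV ?U \<subseteq> {\<eta> \<in> boundary d. same_prefix N \<xi> \<eta>}"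
  proof
    fix \<zeta> assume z: "\<zeta> \<in> Pi\<^sub>E UNIV ?U"
    have zi: "\<zeta> i \<in> ?U i" for i using z by (rule PiE_mem) simp
    have "\<zeta> i < d \<and> (i < N \<longrightarrow> \<xi> i = \<zeta> i)" for i
      using zi[of i] assms by (cases "i < N") (auto simp: boundary_def split: if_splits)
    then show "\<zeta> \<in> {\<eta> \<in> boundary d. same_prefix N \<xi> \<eta>}" by (auto simp: same_prefix_def boundary_def)
  qed
  show "\<exists>U. finite {i \<in> UNIV. U i \<noteq> topspace (discrete_topology {..<d})} \<and>
      (\<forall>i\<in>UNIV. openin (discrete_topology {..<d}) (U i)) \<and> \<eta> \<in> Pi\<^sub>E UNIV U \<and>
      Pi\<^sub>E UNIV U \<subseteq> {\<eta> \<in> boundary d. same_prefix N \<xi> \<eta>}"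
    by (intro exI[of _ ?U] conjI 1 2 3 4)
qed

lemma openin_boundary_same_prefix:
  assumes "openin (boundary_topology d) U" "\<xi> \<in> U"
  shows "\<exists>N. \<forall>\<eta>\<in>boundary d. same_prefix N \<xi> \<eta> \<longrightarrow> \<eta> \<in> U"
proof -
  obtain V where V: "finite {i \<in> UNIV. V i \<noteq> topspace (discrete_topology {..<d})}"
      "\<xi> \<in> Pi\<^sub>E UNIV V" "Pi\<^sub>E UNIV V \<subseteq> U"
    using assms unfolding boundary_topology_def openin_product_topology_alt by meson
  then obtain N where N: "\<forall>i\<in>{i \<in> UNIV. V i \<noteq> topspace (discrete_topology {..<d})}. i < N"
    using finite_nat_set_iff_bounded by meson
  have "\<eta> \<in> U" if "\<eta> \<in> boundary d" "same_prefix N \<xi> \<eta>" for \<eta>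
  proof -
    have "\<eta> i \<in> V i" for i
    proof (cases "i < N")
      case True
      have "\<xi> i \<in> V i" using V(2) by auto
      then show ?thesis using True that by (simp add: same_prefix_def)
    next
      case False
      then have "V i = {..<d}" using N by auto
      then show ?thesis using that by (simp add: boundary_def)
    qed
    then show ?thesis using V(3) by auto
  qed
  then show ?thesis by blast
qed

text \<open>Koenig's argument: a prefix shared by infinitely many of the rays has an extension by
  one letter that is again shared by infinitely many.\<close>

lemma cluster_ray:
  fixes \<xi> :: "nat \<Rightarrow> nat \<Rightarrow> nat"
  assumes "\<And>k. \<xi> k \<in> boundary d"
  obtains \<eta> where "\<eta> \<in> boundary d" "\<And>N. infinite {k. same_prefix N \<eta> (\<xi> k)}"
proof -
  define P where "P n w \<longleftrightarrow> length w = n \<and> w \<in> words d \<and> infinite {k. \<forall>i<n. \<xi> k i = w ! i}" for n w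
  have "\<exists>f. \<forall>n. P n (f n) \<and> (\<exists>x. f (Suc n) = f n @ [x])"
  proof (rule dependent_nat_choice)
    show "\<exists>w. P 0 w" by (auto simp: P_def)
    fix w n assume w: "P n w"
    let ?A = "{k. \<forall>i<n. \<xi> k i = w ! i}"
    have "(\<lambda>k. \<xi> k n) ` ?A \<subseteq> {..<d}" using assms by (auto simp: boundary_def)
    then have "finite ((\<lambda>k. \<xi> k n) ` ?A)" using finite_subset by blast
    then obtain k0 where k0: "k0 \<in> ?A" "infinite {k \<in> ?A. \<xi> k n = \<xi> k0 n}"
      using pigeonhole_infinite[of ?A "\<lambda>k. \<xi> k n"] w by (auto simp: P_def)
    have "{k \<in> ?A. \<xi> k n = \<xi> k0 n} = {k. \<forall>i<Suc n. \<xi> k i = (w @ [\<xi> k0 n]) ! i}"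
      using w by (auto simp: P_def nth_append less_Suc_eq)
    then have "P (Suc n) (w @ [\<xi> k0 n])" using k0(2) w assms[of k0] by (simp add: P_def boundary_def)
    then show "\<exists>y. P (Suc n) y \<and> (\<exists>x. y = w @ [x])" by blast
  qed
  then obtain f where f: "\<And>n. P n (f n)" "\<And>n. \<exists>x. f (Suc n) = f n @ [x]" by metis
  define \<eta> where "\<eta> n = f (Suc n) ! n" for n
  have active_at: "f n = map \<eta> [0..<n]" for n
  proof (induction n)
    case 0
    then show ?case using f(1)[of 0] by (simp add: P_def)
  next
    case (Suc n)
    obtain x where x: "f (Suc n) = f n @ [x]" using f(2) by blast
    have "length (f n) = n" using f(1)[of n] by (simp add: P_def)
    then have "\<eta> n = x" using x by (simp add: \<eta>_def nth_append)
    then show ?case using x Suc by simp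
  qed
  have "\<eta> \<in> boundary d"
    unfolding boundary_def using f(1)[of "Suc _"] unfolding active_at by (simp add: P_def words_def)
  moreover have "infinite {k. same_prefix N \<eta> (\<xi> k)}" for N
  proof -
    have "{k. same_prefix N \<eta> (\<xi> k)} = {k. \<forall>i<N. \<xi> k i = f N ! i}" unfolding active_at same_prefix_def by auto
    then show ?thesis using f(1)[of N] by (simp add: P_def)
  qed
  ultimately show ?thesis by (rule that)
qed

context spinal
begin

subsection \<open>Ends of the limit graphs\<close>

lemma adj_induced_limit:
  assumes "\<pi> \<in> Epi d m"
  shows "(x, y) \<in> adj (induced (limit_graph d m \<omega> \<pi>) (- F)) \<longleftrightarrow>
    x \<in> LV - F \<and> y \<in> LV - F \<and> (\<exists>s\<in>S. y = star_act (exponent d \<pi>) s x)"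
proof -
  have a: "action LV (star_act (exponent d \<pi>))" by (rule action_limit[OF assms])
  have "(x, y) \<in> adj (induced (action_graph S LV (star_act (exponent d \<pi>))) (- F)) \<longleftrightarrow>
     (x, y) \<in> adj (action_graph S LV (star_act (exponent d \<pi>))) \<and> x \<notin> F \<and> y \<notin> F"
    by (auto simp: adj_def induced_def)
  then show ?thesis unfolding limit_graph_action_graph[OF assms] adj_action_graph[OF a]
    using a by (auto simp: action_def)
qed

text \<open>A path avoiding (d-1)^N never uses the edges between copies, so it lifts to any single
  copy.\<close>

lemma lift_stepR:
  assumes \<pi>: "\<pi> \<in> Epi d m" and W: "W \<subseteq> Cof d ray - {ray}" "({i} \<times> W) \<inter> F = {}" and i: "i < d"
  shows "(u, w) \<in> (stepR W)\<^sup>* \<Longrightarrow> ((i, u), (i, w)) \<in> (adj (induced (limit_graph d m \<omega> \<pi>) (- F)))\<^sup>*"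
proof (induction rule: rtrancl_induct)
  case (step y z)
  then obtain s where s: "s \<in> S" "y \<in> W" "z \<in> W" "z = bact s y" by (auto simp: stepR_def)
  have "star_act (exponent d \<pi>) s (i, y) = (i, z)" using s W by (auto simp: star_act_def)
  then have "((i, y), (i, z)) \<in> adj (induced (limit_graph d m \<omega> \<pi>) (- F))"
    unfolding adj_induced_limit[OF \<pi>] using s W i by (auto intro!: bexI[of _ s])
  then show ?case using step by simp
qed simp

lemma infinite_Cof_ray: "infinite (Cof d ray)"
proof -
  have "inj (\<lambda>k. ray(k := 0))"
  proof (rule injI)
    fix k l assume e: "ray(k := 0) = ray(l := 0)"
    show "k = l" using fun_cong[OF e, of k] d2 by (auto simp: last_ray_def split: if_splits)
  qed
  moreover have "range (\<lambda>k. ray(k := 0)) \<subseteq> Cof d ray"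
  proof
    fix u assume "u \<in> range (\<lambda>k. ray(k := 0))"
    then obtain k where u: "u = ray(k := 0)" by blast
    have "{n. u n \<noteq> ray n} \<subseteq> {k}" using u by auto
    then have "finite {n. u n \<noteq> ray n}" using finite_subset by blast
    moreover have "u \<in> X" using u d0 by (auto simp: boundary_def last_ray_def)
    ultimately show "u \<in> Cof d ray" by (simp add: Cof_def)
  qed
  ultimately show ?thesis by (meson finite_imageD finite_subset infinite_UNIV_nat)
qed

text \<open>In each copy, the complement of a large block is connected, so at most \<open>d\<close>
  infinite components remain. Deleting the centres separates the copies, so \<open>d\<close> is
  attained.\<close>

lemma num_ends_limit_graph:
  assumes \<pi>: "\<pi> \<in> Epi d m"
  shows "num_ends (limit_graph d m \<omega> \<pi>) = enat d"
proof -
  let ?\<Gamma> = "limit_graph d m \<omega> \<pi>"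
  let ?R = "\<lambda>F. (adj (induced ?\<Gamma> (- F)))\<^sup>*"
  let ?K = "\<lambda>F. {C \<in> components_off ?\<Gamma> F. infinite C}"
  let ?z = "\<lambda>N i. if i = N - 1 \<or> i = N then 0 else d - 1"
  let ?T = "\<lambda>N. Cof d ray - same_tail d N ray"
  have gv: "gverts ?\<Gamma> = LV" by (simp add: limit_graph_action_graph[OF \<pi>])
  have T: "?T N \<subseteq> Cof d ray - {ray}" for N by (auto simp: same_tail_def)
  have symR: "(x, y) \<in> ?R F \<Longrightarrow> (y, x) \<in> ?R F" for x y F
  proof -
    have "sym (adj (induced ?\<Gamma> (- F)))" by (auto simp: sym_def adj_def)
    then show "(x, y) \<in> ?R F \<Longrightarrow> (y, x) \<in> ?R F" using sym_rtrancl by (metis symD)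
  qed
  have tail: "((i, u), (i, ?z N)) \<in> ?R F" if "N > 0" "F \<subseteq> {..<d} \<times> same_tail d N ray" "i < d" "u \<in> ?T N" for N F i u
    using lift_stepR[OF \<pi> T, of i N F u "?z N"] outside_connected[OF that(1), of u] that by blast
  \<comment> \<open>An infinite component leaves the finite block in some copy \<open>i\<close>, and
    there it contains the meeting point of that copy.\<close>
  have up: "?K F \<subseteq> (\<lambda>i. {w. ((i, ?z N), w) \<in> ?R F}) ` {..<d}"
    if N: "N > 0" and F: "F \<subseteq> {..<d} \<times> same_tail d N ray" for N F
  proof
    fix C assume C: "C \<in> ?K F"
    then obtain x where x: "x \<in> LV - F" "C = {w. (x, w) \<in> ?R F}" "infinite C" using gv by (auto simp: components_off_def)
    have "C \<subseteq> LV"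
    proof
      fix w assume "w \<in> C"
      then have "(x, w) \<in> ?R F" using x by blast
      then show "w \<in> LV" using x(1) by cases (auto simp: adj_induced_limit[OF \<pi>])
    qed
    moreover have "finite ({..<d} \<times> same_tail d N ray)" using finite_same_tail by simp
    then have "\<not> C \<subseteq> {..<d} \<times> same_tail d N ray" using x(3) finite_subset by blast
    ultimately obtain i u where iu: "(i, u) \<in> C" "i < d" "u \<in> ?T N" by blast
    have "(x, (i, u)) \<in> ?R F" using iu(1) x(2) by blast
    then have xz: "(x, (i, ?z N)) \<in> ?R F" using tail[OF N F iu(2,3)] by (rule rtrancl_trans)
    have "(x, w) \<in> ?R F \<longleftrightarrow> ((i, ?z N), w) \<in> ?R F" for w
      using rtrancl_trans[OF xz] rtrancl_trans[OF symR[OF xz]] by blast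
    then have "C = {w. ((i, ?z N), w) \<in> ?R F}" using x(2) by blast
    then show "C \<in> (\<lambda>i. {w. ((i, ?z N), w) \<in> ?R F}) ` {..<d}" using iu by blast
  qed
  have le: "finite (?K F) \<and> card (?K F) \<le> d" if F: "finite F" "F \<subseteq> LV" for F
  proof -
    have "finite (snd ` F)" "snd ` F \<subseteq> Cof d ray" using F by auto
    then obtain N where N: "N > 0" "snd ` F \<subseteq> same_tail d N ray" using finite_Cof_same_tail by blast
    have FN: "F \<subseteq> {..<d} \<times> same_tail d N ray"
    proof
      fix p assume p: "p \<in> F"
      then have "snd p \<in> same_tail d N ray" "fst p < d" using N(2) F(2) by auto
      then show "p \<in> {..<d} \<times> same_tail d N ray" by (cases p) simp
    qed
    have "finite ((\<lambda>i. {w. ((i, ?z N), w) \<in> ?R F}) ` {..<d})" by simp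
    then show ?thesis using up[OF N(1) FN] 
      by (metis (no_types, lifting) card_image_le card_lessThan card_mono finite_lessThan finite_subset le_trans)
  qed
  \<comment> \<open>This finite set contains all centres; depth 1 is the least to which
    \<open>outside_connected\<close> applies.\<close>
  let ?F = "{..<d} \<times> same_tail d 1 ray"
  let ?c = "\<lambda>i. {w. ((i, ?z 1), w) \<in> ?R ?F}"
  have F: "finite ?F" "?F \<subseteq> LV" using finite_same_tail unfolding Cof_same_tail by auto
  have zT: "?z 1 \<in> ?T 1"
  proof -
    have "?z 1 \<in> same_tail d 2 ray" using d0 by (auto simp: same_tail_def boundary_def last_ray_def)
    moreover have "?z 1 1 \<noteq> ray 1" using d2 by (simp add: last_ray_def)
    then have "?z 1 \<notin> same_tail d 1 ray" by (auto simp: same_tail_def)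
    ultimately show ?thesis unfolding Cof_same_tail by blast
  qed
  have sub: "?c i \<in> ?K ?F" if i: "i < d" for i
  proof -
    have "{i} \<times> ?T 1 \<subseteq> ?c i"
    proof
      fix p assume "p \<in> {i} \<times> ?T 1"
      then obtain u where "p = (i, u)" "u \<in> ?T 1" by blast
      then show "p \<in> ?c i" using symR[OF tail[of 1 ?F i u]] i by simp
    qed
    moreover have "infinite (?T 1)" using infinite_Cof_ray finite_same_tail by simp
    then have "infinite ({i} \<times> ?T 1)" using finite_cartesian_productD2 by blast
    ultimately have "infinite (?c i)" using finite_subset by blast
    moreover have "(i, ?z 1) \<in> LV - ?F" using i zT by blast
    ultimately show ?thesis unfolding components_off_def gv by blast
  qed
  \<comment> \<open>Only the centres have edges into other copies, and they have been
    deleted.\<close>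
  have stay: "fst w = i \<and> snd w \<notin> same_tail d 1 ray" if "w \<in> ?c i" "i < d" for w i
  proof -
    have "((i, ?z 1), w) \<in> ?R ?F" using that by blast
    then show ?thesis
    proof (induction rule: rtrancl_induct)
      case base
      show ?case using zT by simp
    next
      case (step y w)
      then obtain s where s: "w \<in> LV - ?F" "s \<in> S" "w = star_act (exponent d \<pi>) s y" 
        unfolding adj_induced_limit[OF \<pi>] by blast
      obtain u where y: "y = (i, u)" "u \<notin> same_tail d 1 ray" using step by (cases y) auto
      then have "u \<noteq> ray" by (auto simp: same_tail_def)
      then show ?case using s y by (auto simp: star_act_def)
    qed
  qed
  have inj: "inj_on ?c {..<d}"
  proof (rule inj_onI)
    fix i j assume ij: "i \<in> {..<d}" "j \<in> {..<d}" "?c i = ?c j"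
    have "(i, ?z 1) \<in> ?c i" by blast
    then have "(i, ?z 1) \<in> ?c j" using ij(3) by blast
    then show "i = j" using stay[of "(i, ?z 1)" j] ij by simp
  qed
  have "?c ` {..<d} \<subseteq> ?K ?F" using sub by blast
  then have "card (?c ` {..<d}) \<le> card (?K ?F)" using le[OF F] by (intro card_mono) auto
  then have ge: "d \<le> card (?K ?F)" unfolding card_image[OF inj] by simp
  show ?thesis
  proof (rule antisym)
    show "num_ends ?\<Gamma> \<le> enat d"
      unfolding num_ends_def gv by (rule SUP_least) (use le in \<open>simp add: Let_def\<close>)
    have "enat d \<le> (let K = ?K ?F in if finite K then enat (card K) else \<infinity>)" using ge le[OF F] by (simp add: Let_def)
    then show "enat d \<le> num_ends ?\<Gamma>"
      unfolding num_ends_def gv by (rule SUP_upper2[rotated]) (use F in simp)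
  qed
qed


subsection \<open>The closure and its isolated points\<close>

abbreviation "sch \<equiv> Sch d m \<omega>"
abbreviation "Rec \<equiv> recurrent_epis d m \<omega>"

lemma Rec_Epi: "\<pi> \<in> Rec \<Longrightarrow> \<pi> \<in> Epi d m" by (simp add: recurrent_epis_def)

lemma Rec_ex: "\<exists>\<pi>. \<pi> \<in> Rec"
proof -
  have "range \<omega> \<subseteq> Epi d m" using \<omega>_Epi by blast
  then have "finite (range \<omega>)" using finite_Epi finite_subset by blast
  then obtain a where "infinite {b \<in> UNIV. \<omega> b = \<omega> a}" using pigeonhole_infinite[of UNIV \<omega>] by auto
  then show ?thesis using \<omega>_Epi by (auto simp: recurrent_epis_def)
qed

lemma agree_sch: "\<xi> \<in> X \<Longrightarrow> \<eta> \<in> X \<Longrightarrow> agree r (sch \<xi>) (sch \<eta>) \<longleftrightarrow> (\<forall>ws\<in>words_le r. ws \<in> ray_code \<xi> \<longleftrightarrow> ws \<in> ray_code \<eta>)"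
  by (simp add: agree_def Sch_points)

lemma agree_trans: "agree r C D \<Longrightarrow> agree r D E \<Longrightarrow> agree r C E"
  by (simp add: agree_def)

lemma inj_sch: "inj_on sch X"
proof (rule inj_onI)
  fix \<xi> \<eta> assume x: "\<xi> \<in> X" "\<eta> \<in> X" "sch \<xi> = sch \<eta>"
  then have c: "ray_code \<xi> = ray_code \<eta>" using Sch_points(2) by metis
  show "\<xi> = \<eta>"
  proof (rule ccontr)
    assume "\<xi> \<noteq> \<eta>"
    then obtain ws N where "separates ws N \<xi> \<eta>" using separation x by blast
    then show False using c x same_prefix_refl unfolding separates_def by blast
  qed
qed

lemma continuous_sch:
  assumes "\<xi> \<in> X" "\<xi> \<notin> Cof d ray"
  shows "\<exists>N. \<forall>\<eta>\<in>X. same_prefix N \<xi> \<eta> \<longrightarrow> agree r (sch \<xi>) (sch \<eta>)"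
proof -
  obtain N where "\<forall>\<eta>\<in>X. same_prefix N \<xi> \<eta> \<longrightarrow> (\<forall>ws\<in>words_le r. ws \<in> ray_code \<eta> \<longleftrightarrow> ws \<in> ray_code \<xi>)"
    using ray_code_locally_constant_words[OF assms] by blast
  then show ?thesis using agree_sch assms(1) by blast
qed

lemma near_agree:
  assumes \<xi>: "\<xi> \<in> X" "\<xi> n \<noteq> d - 1" and e: "same_prefix n u \<xi>" and u: "u \<in> same_tail d N ray" and r: "N + r \<le> n"
  shows "\<xi> n \<noteq> 0 \<Longrightarrow> agree r (sch u) (sch \<xi>)"
    and "\<xi> n = 0 \<Longrightarrow> agree r (limit_point (\<omega> n) (\<xi> (Suc n), u)) (sch \<xi>)"
proof -
  have uX: "u \<in> X" "u \<in> Cof d ray" using u unfolding Cof_same_tail by (auto simp: same_tail_def)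
  have c: "ws \<in> ray_code \<xi> \<longleftrightarrow> (if \<xi> n = 0 then ws \<in> limit_code (\<omega> n) (\<xi> (Suc n), u) else ws \<in> ray_code u)" if "ws \<in> words_le r" for ws
    using near_code[OF \<xi> e u, of ws] that r by (auto simp: words_le_def)
  show "\<xi> n \<noteq> 0 \<Longrightarrow> agree r (sch u) (sch \<xi>)"
    using c agree_sch[OF uX(1) \<xi>(1)] by simp
  have "(\<xi> (Suc n), u) \<in> LV" using X_lt[OF \<xi>(1)] uX by simp
  then show "\<xi> n = 0 \<Longrightarrow> agree r (limit_point (\<omega> n) (\<xi> (Suc n), u)) (sch \<xi>)"
    using c limit_point_points(2)[OF \<omega>_Epi] by (simp add: agree_def Sch_points(2)[OF \<xi>(1)])
qed

lemma near_ray_ex: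
  assumes u: "u \<in> X" and xi: "x < d" "i < d"
  obtains \<xi> where "\<xi> \<in> X" "same_prefix n u \<xi>" "\<xi> n = x" "\<xi> (Suc n) = i"
proof -
  let ?x = "\<lambda>k. if k < n then u k else if k = n then x else i"
  have "?x \<in> X" using assms by (auto simp: boundary_def)
  then show ?thesis using that[of ?x] by (auto simp: same_prefix_def)
qed

text \<open>Far out there is an \<open>n\<close> with \<open>\<omega> n = \<pi>\<close>; the
  approximating ray follows \<open>u\<close> up to \<open>n\<close> and continues with the letters 0
  and \<open>i\<close>. The prefix of length \<open>M\<close> makes the rays, and not only their
  graphs, converge.\<close>

lemma approx_limit:
  assumes \<pi>: "\<pi> \<in> Rec" and iu: "i < d" "u \<in> Cof d ray"
  shows "\<exists>\<xi>\<in>X. same_prefix M u \<xi> \<and> agree r (limit_point \<pi> (i, u)) (sch \<xi>)"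
proof -
  have uX: "u \<in> X" using iu Cof_boundary by blast
  obtain N where N: "u \<in> same_tail d N ray" using iu unfolding Cof_same_tail by blast
  have "infinite {n. \<omega> n = \<pi>}" using \<pi> by (simp add: recurrent_epis_def)
  then obtain n where n: "n \<ge> max M (N + r)" "\<omega> n = \<pi>" unfolding infinite_nat_iff_unbounded_le by blast
  obtain \<xi> where \<xi>: "\<xi> \<in> X" "same_prefix n u \<xi>" "\<xi> n = 0" "\<xi> (Suc n) = i" using near_ray_ex[OF uX d0 iu(1)] by metis
  have "\<xi> n \<noteq> d - 1" using \<xi>(3) d2 by simp
  then have "agree r (limit_point \<pi> (i, u)) (sch \<xi>)" using near_agree(2)[OF \<xi>(1) _ \<xi>(2) N _ \<xi>(3), of r] n \<xi>(4) by simp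
  then show ?thesis using \<xi>(1) same_prefix_mono[OF \<xi>(2), of M] n(1) by auto
qed

text \<open>The letter 1 placed far out differs from both 0 and \<open>d - 1\<close>, which is
  possible only for \<open>d > 2\<close>.\<close>

lemma approx_orbit:
  assumes "d > 2" and u: "u \<in> Cof d ray"
  shows "\<exists>\<xi>\<in>X. \<xi> \<noteq> u \<and> agree r (sch u) (sch \<xi>)"
proof -
  have uX: "u \<in> X" using u Cof_boundary by blast
  obtain N where N: "u \<in> same_tail d N ray" using u unfolding Cof_same_tail by blast
  let ?n = "N + r"
  obtain \<xi> where \<xi>: "\<xi> \<in> X" "same_prefix ?n u \<xi>" "\<xi> ?n = 1" using near_ray_ex[OF uX, of 1 0 ?n] assms(1) by auto
  have ne: "\<xi> ?n \<noteq> d - 1" "\<xi> ?n \<noteq> 0" using \<xi>(3) assms(1) by auto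
  have "u ?n = d - 1" using N by (simp add: same_tail_def last_ray_def)
  then have "\<xi> \<noteq> u" using ne by auto
  then show ?thesis using near_agree(1)[OF \<xi>(1) ne(1) \<xi>(2) N _ ne(2), of r] \<xi>(1) by auto
qed

lemma limit_points_eq: "limit_points d m \<omega> = {limit_point \<pi> x | \<pi> x. \<pi> \<in> Rec \<and> x \<in> LV}"
proof -
  have "gverts (limit_graph d m \<omega> \<pi>) = LV" if "\<pi> \<in> Rec" for \<pi>
    using limit_graph_action_graph[OF Rec_Epi[OF that]] by simp
  then show ?thesis unfolding limit_points_def by blast
qed

text \<open>Move both roots so that the limit graph is rooted at a centre. If the ray then is
  (d-1)^N, a label of exponent 1 is a loop in its Schreier graph but not in the star. Otherwise a
  word separates it from all rays close to (d-1)^N, and such rays approximate the limit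
  graph.\<close>

lemma sch_not_limit:
  assumes \<pi>: "\<pi> \<in> Rec" and x: "x \<in> LV" and \<xi>: "\<xi> \<in> X"
  shows "limit_point \<pi> x \<noteq> sch \<xi>"
proof
  assume "limit_point \<pi> x = sch \<xi>"
  then have c: "limit_code \<pi> x = ray_code \<xi>" using limit_point_points(2)[OF Rec_Epi[OF \<pi>] x] Sch_points(2)[OF \<xi>] by simp
  let ?A = "star_act (exponent d \<pi>)"
  have a: "action LV ?A" by (rule action_limit[OF Rec_Epi[OF \<pi>]])
  have "(0, ray) \<in> LV" using d0 Cof_refl[OF ray_X] by simp
  then obtain ws where ws: "ws \<in> lists S" "fold ?A ws x = (0, ray)"
    using trans_action_limit[OF Rec_Epi[OF \<pi>] x] unfolding trans_action_def by blast
  define \<zeta> where "\<zeta> = fold bact ws \<xi>"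
  have \<zeta>: "\<zeta> \<in> X" unfolding \<zeta>_def by (rule fold_X[OF ws(1) \<xi>])
  have c0: "us \<in> limit_code \<pi> (0, ray) \<longleftrightarrow> us \<in> ray_code \<zeta>" if "us \<in> lists S" for us
  proof -
    have "us \<in> limit_code \<pi> (0, ray) \<longleftrightarrow> fold ?A us (0, ray) = (0, ray)" "us \<in> ray_code \<zeta> \<longleftrightarrow> fold bact us \<zeta> = \<zeta>"
      using that by (simp_all add: code_def)
    then show ?thesis
      using conj_code_iff[OF a x ws(1) that] conj_code_iff[OF action_X \<xi> ws(1) that]
      unfolding c ws(2) \<zeta>_def by blast
  qed
  show False
  proof (cases "\<zeta> = ray")
    case True
    obtain b where b: "b \<in> B" "exponent d \<pi> b = 1" using exponent_surj[OF Rec_Epi[OF \<pi>], of 1] d2 by auto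
    then have "b \<noteq> B1" using exponent_one[OF Rec_Epi[OF \<pi>]] by auto
    then have "[sp b] \<in> lists S" using sp_S b by auto
    then show False using c0[of "[sp b]"] True b d2 by (simp add: code_def star_act_sp bact_sp_ray)
  next
    case False
    then obtain us N where us: "separates us N \<zeta> ray" using separation[OF \<zeta> ray_X] by blast
    then have usS: "us \<in> lists S" by (simp add: separates_def)
    obtain \<eta> where \<eta>: "\<eta> \<in> X" "same_prefix N ray \<eta>" "agree (length us) (limit_point \<pi> (0, ray)) (sch \<eta>)"
      using approx_limit[OF \<pi> d0 Cof_refl[OF ray_X]] by blast
    have "us \<in> words_le (length us)" using usS by (simp add: words_le_def)
    then have "us \<in> limit_code \<pi> (0, ray) \<longleftrightarrow> us \<in> ray_code \<eta>"
      using \<eta> limit_point_points(2)[OF Rec_Epi[OF \<pi>] \<open>(0, ray) \<in> LV\<close>] Sch_points(2)[OF \<eta>(1)] unfolding agree_def by blast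
    moreover have "us \<in> ray_code \<zeta> \<longleftrightarrow> us \<notin> ray_code \<eta>" using us \<zeta> \<eta> same_prefix_refl unfolding separates_def by blast
    ultimately show False using c0[OF usS] by blast
  qed
qed

text \<open>Rays converging to a point of the exceptional class may have graphs converging to a
  limit graph rooted in copy 0. Continuity would identify that graph with the Schreier graph of the
  point.\<close>

lemma topcontinuous_sch_iff:
  assumes \<xi>: "\<xi> \<in> X"
  shows "topcontinuous_at (boundary_topology d) (graph_topology S) sch \<xi> \<longleftrightarrow> \<xi> \<notin> Cof d ray"
proof -
  have "topcontinuous_at (boundary_topology d) (graph_topology S) sch \<xi> \<longleftrightarrow>
    (\<forall>r. \<exists>U. openin (boundary_topology d) U \<and> \<xi> \<in> U \<and> (\<forall>y\<in>U. agree r (sch \<xi>) (sch y)))"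
    by (rule topcontinuous_at_points_iff) (use Sch_points \<xi> in auto)
  also have "\<dots> \<longleftrightarrow> \<xi> \<notin> Cof d ray"
  proof
    assume *: "\<xi> \<notin> Cof d ray"
    show "\<forall>r. \<exists>U. openin (boundary_topology d) U \<and> \<xi> \<in> U \<and> (\<forall>y\<in>U. agree r (sch \<xi>) (sch y))"
    proof
      fix r
      obtain N where "\<forall>\<eta>\<in>X. same_prefix N \<xi> \<eta> \<longrightarrow> agree r (sch \<xi>) (sch \<eta>)" using continuous_sch[OF \<xi> *] by blast
      then show "\<exists>U. openin (boundary_topology d) U \<and> \<xi> \<in> U \<and> (\<forall>y\<in>U. agree r (sch \<xi>) (sch y))"
        using openin_same_prefix[OF \<xi>] \<xi> by (intro exI[of _ "{\<eta> \<in> X. same_prefix N \<xi> \<eta>}"]) auto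
    qed
  next
    assume c: "\<forall>r. \<exists>U. openin (boundary_topology d) U \<and> \<xi> \<in> U \<and> (\<forall>y\<in>U. agree r (sch \<xi>) (sch y))"
    show "\<xi> \<notin> Cof d ray"
    proof
      assume u: "\<xi> \<in> Cof d ray"
      obtain \<pi> where \<pi>: "\<pi> \<in> Rec" using Rec_ex by blast
      have x: "(0, \<xi>) \<in> LV" using u d0 by simp
      have "agree r (limit_point \<pi> (0, \<xi>)) (sch \<xi>)" for r
      proof -
        obtain U where U: "openin (boundary_topology d) U" "\<xi> \<in> U" "\<forall>y\<in>U. agree r (sch \<xi>) (sch y)" using c by blast
        then obtain M where M: "\<forall>\<eta>\<in>X. same_prefix M \<xi> \<eta> \<longrightarrow> \<eta> \<in> U" using openin_boundary_same_prefix by blast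
        obtain \<eta> where "\<eta> \<in> X" "same_prefix M \<xi> \<eta>" "agree r (limit_point \<pi> (0, \<xi>)) (sch \<eta>)"
          using approx_limit[OF \<pi> d0 u] by blast
        then show ?thesis using U(3) M agree_sym agree_trans by blast
      qed
      then have "limit_point \<pi> (0, \<xi>) = sch \<xi>"
        using points_eqI limit_point_points(1)[OF Rec_Epi[OF \<pi>] x] Sch_points(1)[OF \<xi>] by blast
      then show False using sch_not_limit[OF \<pi> x \<xi>] by blast
    qed
  qed
  finally show ?thesis .
qed

lemma sch_image_points: "sch ` X \<subseteq> points" using Sch_points by blast

lemma limit_points_points: "limit_points d m \<omega> \<subseteq> points"
  unfolding limit_points_eq using limit_point_points(1) Rec_Epi by blast

lemma closure_sub:
  assumes C: "C \<in> points" "\<And>r. \<exists>\<xi>\<in>X. agree r C (sch \<xi>)"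
  shows "C \<in> sch ` X \<union> limit_points d m \<omega>"
proof -
  obtain \<xi> where \<xi>: "\<And>r. \<xi> r \<in> X" "\<And>r. agree r C (sch (\<xi> r))" using C(2) by metis
  obtain u where u: "u \<in> X" "\<And>N. infinite {k. same_prefix N u (\<xi> k)}" using cluster_ray[of \<xi> d] \<xi>(1) by blast
  have far: "\<exists>k\<ge>r. same_prefix N u (\<xi> k)" for r N
    using u(2)[of N] unfolding infinite_nat_iff_unbounded_le by blast
  show ?thesis
  proof (cases "u \<in> Cof d ray")
    case False
    have "agree r C (sch u)" for r
    proof -
      obtain N where N: "\<forall>\<eta>\<in>X. same_prefix N u \<eta> \<longrightarrow> agree r (sch u) (sch \<eta>)" using continuous_sch[OF u(1) False] by blast
      obtain k where k: "k \<ge> r" "same_prefix N u (\<xi> k)" using far by blast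
      have "agree r C (sch (\<xi> k))" using agree_mono[OF \<xi>(2) k(1)] .
      moreover have "agree r (sch (\<xi> k)) (sch u)" using N k \<xi>(1) agree_sym by blast
      ultimately show ?thesis by (rule agree_trans)
    qed
    then have "C = sch u" using points_eqI[OF C(1) Sch_points(1)[OF u(1)]] by blast
    then show ?thesis using u by blast
  next
    case True
    then obtain N where N: "u \<in> same_tail d N ray" unfolding Cof_same_tail by blast
    \<comment> \<open>In this subsequence the index bounds both the agreement with \<open>C\<close>
      and the prefix shared with \<open>u\<close>.\<close>
    have "\<forall>k. \<exists>l. l \<ge> k \<and> same_prefix k u (\<xi> l)" using far by blast
    then obtain f where f: "\<And>k. f k \<ge> k" "\<And>k. same_prefix k u (\<xi> (f k))" by metis
    define \<eta> where "\<eta> k = \<xi> (f k)" for k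
    have \<eta>: "\<eta> k \<in> X" "agree k C (sch (\<eta> k))" "same_prefix k u (\<eta> k)" for k
      using \<xi> f agree_mono unfolding \<eta>_def by blast+
    define n where "n k = (LEAST n. \<eta> k n \<noteq> u n)" for k
    have n: "\<eta> k (n k) \<noteq> u (n k)" "same_prefix (n k) u (\<eta> k)" "k \<le> n k" if "\<eta> k \<noteq> u" for k
    proof -
      have "\<exists>n. \<eta> k n \<noteq> u n" using that by auto
      then show 1: "\<eta> k (n k) \<noteq> u (n k)" unfolding n_def by (rule LeastI_ex)
      show "same_prefix (n k) u (\<eta> k)" unfolding same_prefix_def n_def using not_less_Least by force
      show "k \<le> n k" using 1 \<eta>(3)[of k] unfolding same_prefix_def by (metis not_le)
    qed
    \<comment> \<open>The type records which graph the approximant imitates: \<open>None\<close>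
      stands for the Schreier graph of \<open>u\<close>, and a pair for an epimorphism and a copy
      index. Finitely many types occur, so one recurs infinitely often.\<close>
    define ty where "ty k = (if \<eta> k \<noteq> u \<and> \<eta> k (n k) = 0 then Some (\<omega> (n k), \<eta> k (Suc (n k))) else None)" for k
    have sub: "range ty \<subseteq> insert None (Some ` (Epi d m \<times> {..<d}))" using \<omega>_Epi X_lt \<eta>(1) by (auto simp: ty_def)
    have "finite (range ty)" by (rule finite_subset[OF sub]) (use finite_Epi in simp)
    then obtain k0 where inf: "infinite {k. ty k = ty k0}" using pigeonhole_infinite[of UNIV ty] by auto
    have far': "\<exists>k\<ge>K. ty k = ty k0" for K using inf unfolding infinite_nat_iff_unbounded_le by blast
    have ne: "\<eta> k (n k) \<noteq> d - 1" if "\<eta> k \<noteq> u" "k \<ge> N" for k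
    proof -
      have "u (n k) = d - 1" using N n(3)[OF that(1)] that(2) by (simp add: same_tail_def last_ray_def)
      then show ?thesis using n(1)[OF that(1)] by simp
    qed
    show ?thesis
    proof (cases "ty k0")
      case None
      have "agree r C (sch u)" for r
      proof -
        obtain k where k: "k \<ge> N + r" "ty k = None" using far' None by metis
        have 1: "agree r C (sch (\<eta> k))" using agree_mono[OF \<eta>(2)] k by simp
        have "agree r (sch u) (sch (\<eta> k))"
        proof (cases "\<eta> k = u")
          case True
          then show ?thesis by (simp add: agree_def)
        next
          case False
          then have "\<eta> k (n k) \<noteq> 0" using k by (auto simp: ty_def)
          then show ?thesis using near_agree(1)[OF \<eta>(1) ne[OF False] n(2)[OF False] N, of r] n(3)[OF False] k by simp
        qed
        then show ?thesis using 1 agree_sym agree_trans by blast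
      qed
      then have "C = sch u" using points_eqI[OF C(1) Sch_points(1)[OF u(1)]] by blast
      then show ?thesis using u by blast
    next
      case (Some t)
      obtain \<pi> i where t: "t = (\<pi>, i)" by (cases t)
      have tyk: "\<eta> k \<noteq> u" "\<eta> k (n k) = 0" "\<omega> (n k) = \<pi>" "\<eta> k (Suc (n k)) = i" if "ty k = Some (\<pi>, i)" for k
        using that by (auto simp: ty_def split: if_splits)
      \<comment> \<open>The first disagreement \<open>n k\<close> is at least \<open>k\<close>, so a
        type that recurs yields arbitrarily late occurrences of \<open>\<pi>\<close>.\<close>
      have "\<exists>l\<ge>K. \<omega> l = \<pi>" for K
      proof -
        obtain k where "k \<ge> K" "ty k = Some (\<pi>, i)" using far' Some t by metis
        then show ?thesis using tyk[of k] n(3)[of k] by (intro exI[of _ "n k"]) auto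
      qed
      then have "infinite {l. \<omega> l = \<pi>}" unfolding infinite_nat_iff_unbounded_le by blast
      moreover have "\<pi> \<in> Epi d m" using tyk(3)[of k0] Some t \<omega>_Epi by metis
      ultimately have \<pi>: "\<pi> \<in> Rec" by (simp add: recurrent_epis_def)
      have "i < d" using tyk(4)[of k0] Some t X_lt[OF \<eta>(1)] by metis
      then have x: "(i, u) \<in> LV" using True by simp
      have "agree r C (limit_point \<pi> (i, u))" for r
      proof -
        obtain k where k: "k \<ge> N + r" "ty k = Some (\<pi>, i)" using far' Some t by metis
        have 1: "agree r C (sch (\<eta> k))" using agree_mono[OF \<eta>(2)] k by simp
        have "agree r (limit_point \<pi> (i, u)) (sch (\<eta> k))"
          using near_agree(2)[OF \<eta>(1) ne n(2) N _ tyk(2), of k r] tyk[OF k(2)] n(3)[of k] k by simp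
        then show ?thesis using 1 agree_sym agree_trans by blast
      qed
      then have "C = limit_point \<pi> (i, u)" using points_eqI[OF C(1) limit_point_points(1)[OF Rec_Epi[OF \<pi>] x]] by blast
      then show ?thesis using \<pi> x unfolding limit_points_eq by blast
    qed
  qed
qed

lemma Sch_closure_eq: "Sch_closure d m \<omega> = sch ` X \<union> limit_points d m \<omega>"
proof (intro equalityI subsetI)
  fix C assume "C \<in> Sch_closure d m \<omega>"
  then have "C \<in> points" "\<And>r. \<exists>D\<in>sch ` X. agree r C D"
    unfolding Sch_closure_def in_closure_points_iff[OF sch_image_points] by auto
  then show "C \<in> sch ` X \<union> limit_points d m \<omega>" using closure_sub by blast
next
  fix C assume C: "C \<in> sch ` X \<union> limit_points d m \<omega>"
  then have "C \<in> points" using sch_image_points limit_points_points by blast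
  moreover have "\<exists>D\<in>sch ` X. agree r C D" for r
  proof (cases "C \<in> sch ` X")
    case True
    then show ?thesis by (intro bexI[of _ C]) (auto simp: agree_def)
  next
    case False
    then obtain \<pi> i u where l: "\<pi> \<in> Rec" "i < d" "u \<in> Cof d ray" "C = limit_point \<pi> (i, u)"
      using C unfolding limit_points_eq by blast
    obtain \<eta> where "\<eta> \<in> X" "agree r (limit_point \<pi> (i, u)) (sch \<eta>)" using approx_limit[OF l(1-3)] by blast
    then show ?thesis using l(4) by blast
  qed
  ultimately show "C \<in> Sch_closure d m \<omega>"
    unfolding Sch_closure_def in_closure_points_iff[OF sch_image_points] by blast
qed

lemma sch_limit_disjoint: "sch ` X \<inter> limit_points d m \<omega> = {}"
  unfolding limit_points_eq using sch_not_limit by fastforce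

lemma countable_limit_points: "countable (limit_points d m \<omega>)"
proof -
  have "limit_points d m \<omega> \<subseteq> (\<lambda>(\<pi>, x). limit_point \<pi> x) ` (Epi d m \<times> LV)"
    unfolding limit_points_eq using Rec_Epi by auto
  moreover have "countable (Epi d m \<times> LV)"
    using finite_Epi countable_Cof by (intro countable_SIGMA) (auto intro: countable_finite)
  ultimately show ?thesis by (blast intro: countable_subset[OF _ countable_image])
qed

lemma finite_Rec: "finite Rec"
  using finite_Epi by (rule rev_finite_subset) (auto simp: recurrent_epis_def)

text \<open>With two letters, the first letter other than \<open>d - 1\<close> is 0, so every other
  ray is active somewhere and is moved by an element of exponent 1.\<close>

lemma fixed_by_B:
  assumes "d = 2" "\<zeta> \<in> X" "\<And>b. b \<in> B \<Longrightarrow> b \<noteq> B1 \<Longrightarrow> bact (sp b) \<zeta> = \<zeta>"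
  shows "\<zeta> = ray"
proof (rule ccontr)
  assume "\<zeta> \<noteq> ray"
  then obtain l where l: "\<zeta> l \<noteq> d - 1" "\<And>i. i < l \<Longrightarrow> \<zeta> i = d - 1" using not_ray_least by blast
  then have "\<zeta> l = 0" using assms(1) X_lt[OF assms(2), of l] by simp
  then have p: "active_at d l \<zeta>" using l by (simp add: active_at_def)
  obtain b where b: "b \<in> B" "exponent d (\<omega> l) b = 1" using exponent_surj[OF \<omega>_Epi, of 1] d2 by auto
  then have "b \<noteq> B1" using exponent_one[OF \<omega>_Epi] by auto
  then have "bact (sp b) \<zeta> (Suc l) = \<zeta> (Suc l)" using assms(3)[OF b(1)] by simp
  then have "(\<zeta> (Suc l) + 1) mod d = \<zeta> (Suc l)" using boundary_act_sp_active[OF b(1) assms(2) p] b by simp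
  then show False using X_lt[OF assms(2), of "Suc l"] assms(1) by (auto simp: numeral_2_eq_2 less_Suc_eq)
qed

text \<open>The words \<open>ws @ [sp b] @ ivw ws\<close>, of length
  \<open>2 * length ws + 1\<close>, state that B fixes the vertex reached by \<open>ws\<close>.
  Among Schreier graphs this forces that vertex to be (d-1)^N. In a limit graph it could only be a
  centre, but there exponent 1 leads to another copy.\<close>

lemma isolated_orbit:
  assumes d: "d = 2" and u: "u \<in> Cof d ray" and D: "D \<in> Sch_closure d m \<omega>"
    and ws: "ws \<in> lists S" "fold bact ws u = ray" and ag: "agree (2 * length ws + 1) (sch u) D"
  shows "D = sch u"
proof -
  have uX: "u \<in> X" using u Cof_boundary by blast
  have w: "ws @ [sp b] @ ivw ws \<in> class_code D" if b: "b \<in> B" "b \<noteq> B1" for b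
  proof -
    have bS: "sp b \<in> S" using sp_S b by blast
    have "ws @ [sp b] @ ivw ws \<in> ray_code u" using conj_ray_code_iff[OF uX ws(1) bS] ws(2) bact_sp_ray by simp
    moreover have "ws @ [sp b] @ ivw ws \<in> words_le (2 * length ws + 1)"
      using ws(1) bS ivw_lists[OF ws(1)] by (simp add: words_le_def)
    ultimately show ?thesis using ag Sch_points(2)[OF uX] unfolding agree_def by blast
  qed
  consider \<xi> where "\<xi> \<in> X" "D = sch \<xi>" | \<pi> x where "\<pi> \<in> Rec" "x \<in> LV" "D = limit_point \<pi> x"
    using D unfolding Sch_closure_eq limit_points_eq by blast
  then show ?thesis
  proof cases
    case 1
    have "bact (sp b) (fold bact ws \<xi>) = fold bact ws \<xi>" if "b \<in> B" "b \<noteq> B1" for b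
      using w[OF that] conj_ray_code_iff[OF 1(1) ws(1) sp_S[OF that]] 1 Sch_points(2) by metis
    then have "fold bact ws \<xi> = ray" using fixed_by_B[OF d fold_X[OF ws(1) 1(1)]] by blast
    then have "\<xi> = u"
      using fold_ivw_left[OF action_X ws(1) 1(1)] fold_ivw_left[OF action_X ws(1) uX] ws(2) by simp
    then show ?thesis using 1 by simp
  next
    case 2
    let ?A = "star_act (exponent d \<pi>)"
    have \<pi>: "\<pi> \<in> Epi d m" using 2 Rec_Epi by blast
    have a: "action LV ?A" by (rule action_limit[OF \<pi>])
    obtain j w where jw: "fold ?A ws x = (j, w)" by fastforce
    have in_LV: "(j, w) \<in> LV" using fold_closed[OF a ws(1) 2(2)] jw by simp
    have fix_b: "?A (sp b) (j, w) = (j, w)" if b: "b \<in> B" "b \<noteq> B1" for b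
    proof -
      have "[sp b] \<in> lists S" using sp_S b by simp
      then show ?thesis
        using w[OF b] conj_code_iff[OF a 2(2) ws(1), of "[sp b]"] jw limit_point_points(2)[OF \<pi> 2(2)] 2(3) by simp
    qed
    have "w = ray"
    proof (rule ccontr)
      assume "w \<noteq> ray"
      then have "bact (sp b) w = w" if "b \<in> B" "b \<noteq> B1" for b using fix_b[OF that] star_act_sp[OF that(1)] by simp
      then have "w = ray" using fixed_by_B[OF d] in_LV Cof_boundary by blast
      then show False using \<open>w \<noteq> ray\<close> by blast
    qed
    obtain b where b: "b \<in> B" "exponent d \<pi> b = 1" using exponent_surj[OF \<pi>, of 1] d2 by auto
    then have "b \<noteq> B1" using exponent_one[OF \<pi>] by auto
    then have "(j + 1) mod d = j" using fix_b[OF b(1)] \<open>w = ray\<close> star_act_sp[OF b(1)] b(2) by simp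
    then show ?thesis using in_LV d by (auto simp: numeral_2_eq_2 less_Suc_eq)
  qed
qed

lemma isolated_iff:
  "C \<in> isolated_points (graph_topology S) (Sch_closure d m \<omega>) \<longleftrightarrow> d = 2 \<and> C \<in> sch ` Cof d ray"
proof -
  have Q: "Sch_closure d m \<omega> \<subseteq> points"
    unfolding Sch_closure_eq using sch_image_points limit_points_points by blast
  have sub: "Cof d ray \<subseteq> X" using Cof_boundary by blast
  have "(\<exists>r. \<forall>D\<in>Sch_closure d m \<omega>. agree r C D \<longrightarrow> D = C) \<longleftrightarrow> d = 2 \<and> C \<in> sch ` Cof d ray"
    if C: "C \<in> Sch_closure d m \<omega>"
  proof
    assume "\<exists>r. \<forall>D\<in>Sch_closure d m \<omega>. agree r C D \<longrightarrow> D = C"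
    then obtain r where r: "\<And>\<eta>. \<eta> \<in> X \<Longrightarrow> agree r C (sch \<eta>) \<Longrightarrow> sch \<eta> = C"
      unfolding Sch_closure_eq by blast
    \<comment> \<open>A limit graph is approximated by Schreier graphs, all different from
      it.\<close>
    have "C \<notin> limit_points d m \<omega>"
    proof
      assume l: "C \<in> limit_points d m \<omega>"
      then obtain \<pi> i u where p: "\<pi> \<in> Rec" "i < d" "u \<in> Cof d ray" "C = limit_point \<pi> (i, u)"
        unfolding limit_points_eq by blast
      obtain \<eta> where "\<eta> \<in> X" "agree r C (sch \<eta>)" using approx_limit[OF p(1-3)] unfolding p(4) by blast
      then show False using r l sch_limit_disjoint by blast
    qed
    then obtain \<xi> where \<xi>: "\<xi> \<in> X" "C = sch \<xi>" using C unfolding Sch_closure_eq by blast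
    have un: "\<eta> = \<xi>" if "\<eta> \<in> X" "agree r (sch \<xi>) (sch \<eta>)" for \<eta>
      using r[OF that(1)] that \<xi> inj_sch by (auto dest: inj_onD)
    have cof: "\<xi> \<in> Cof d ray"
    proof (rule ccontr)
      assume "\<xi> \<notin> Cof d ray"
      then obtain N where N: "\<forall>\<eta>\<in>X. same_prefix N \<xi> \<eta> \<longrightarrow> agree r (sch \<xi>) (sch \<eta>)" using continuous_sch[OF \<xi>(1)] by blast
      \<comment> \<open>Any change of letter \<open>N\<close> gives a second ray in the
        neighbourhood on which the codes agree.\<close>
      define a where "a = (if \<xi> N = 0 then 1 else 0::nat)"
      have "\<xi>(N := a) \<in> X" using \<xi>(1) d2 by (auto simp: boundary_def a_def)
      moreover have "same_prefix N \<xi> (\<xi>(N := a))" by (simp add: same_prefix_def)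
      ultimately have "\<xi>(N := a) = \<xi>" using N un by blast
      then have "a = \<xi> N" by (metis fun_upd_same)
      then show False by (simp add: a_def split: if_splits)
    qed
    moreover have "d = 2"
    proof (rule ccontr)
      assume "d \<noteq> 2"
      then have "d > 2" using d2 by simp
      then show False using approx_orbit[OF _ cof] un by blast
    qed
    ultimately show "d = 2 \<and> C \<in> sch ` Cof d ray" using \<xi> by blast
  next
    assume "d = 2 \<and> C \<in> sch ` Cof d ray"
    then obtain u where u: "d = 2" "u \<in> Cof d ray" "C = sch u" by blast
    obtain ws where "ws \<in> lists S" "fold bact ws u = ray"
      using Cof_words[OF Cof_boundary[OF u(2)] Cof_sym[OF u(2) ray_X]] by blast
    then show "\<exists>r. \<forall>D\<in>Sch_closure d m \<omega>. agree r C D \<longrightarrow> D = C" using isolated_orbit[OF u(1,2)] u(3) by blast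
  qed
  moreover have "C \<in> Sch_closure d m \<omega>" if "C \<in> sch ` Cof d ray"
    using that sub unfolding Sch_closure_eq by blast
  ultimately show ?thesis unfolding isolated_points_iff[OF Q] by blast
qed

end

theorem theorem5p3:
  fixes d m :: nat
    and \<omega> :: "nat \<Rightarrow> (nat \<Rightarrow> int) \<Rightarrow> nat list \<Rightarrow> nat list"
  assumes "(d = 2 \<and> m \<ge> 2) \<or> (d \<ge> 3 \<and> m \<ge> 1)"
    and "\<omega> \<in> Omega d m"
  shows "(inj_on (Sch d m \<omega>) (boundary d)
      \<and> (\<forall>\<xi>\<in>boundary d.
            topcontinuous_at (boundary_topology d) (graph_topology (spinal_gens d m \<omega>))
              (Sch d m \<omega>) \<xi>
            \<longleftrightarrow> \<xi> \<notin> Cof d (last_ray d)))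
    \<and> ((d > 2 \<longrightarrow>
          isolated_points (graph_topology (spinal_gens d m \<omega>)) (Sch_closure d m \<omega>) = {})
      \<and> (d = 2 \<longrightarrow>
          isolated_points (graph_topology (spinal_gens d m \<omega>)) (Sch_closure d m \<omega>)
            = Sch d m \<omega> ` Cof d (last_ray d)))
    \<and> (Sch_closure d m \<omega> = Sch d m \<omega> ` boundary d \<union> limit_points d m \<omega>
      \<and> Sch d m \<omega> ` boundary d \<inter> limit_points d m \<omega> = {}
      \<and> countable (limit_points d m \<omega>)
      \<and> finite (limit_graph d m \<omega> ` recurrent_epis d m \<omega>)
      \<and> (\<forall>\<pi>\<in>recurrent_epis d m \<omega>. num_ends (limit_graph d m \<omega> \<pi>) = enat d))"
proof -
  interpret spinal d m \<omega> using assms by unfold_locales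
  have iso: "isolated_points (graph_topology S) (Sch_closure d m \<omega>) = {C. d = 2 \<and> C \<in> sch ` Cof d ray}"
    using isolated_iff by blast
  show ?thesis
    unfolding iso using inj_sch topcontinuous_sch_iff Sch_closure_eq sch_limit_disjoint
      countable_limit_points finite_Rec num_ends_limit_graph Rec_Epi by auto
qed

end
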